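(* Let $K$ be an algebraically closed field endowed with a complete, non-trivial non-archimedean absolute value. Let $X$ be a smooth projective curve over $K$ and $V$ a strictly simple open subset of $X^{\mathrm{an}}$. Then the topological boundary $\partial V$ of $V$ in $X^{\mathrm{an}}$ is finite.
   Context: $X^{\mathrm{an}}$ is the Berkovich analytification. Open discs are analytic spaces isomorphic to $\{x\in\mathbb{A}^{1,\mathrm{an}}:|T(x)|<r\}$, $r>0$; open annuli are those isomorphic to $\{r_1<|T(x)|<r_2\}$, $0<r_1<r_2$. A point $x\in X^{\mathrm{an}}$ is of type 2 if the residue field of the completed residue field $\mathscr{H}(x)$ has transcendence degree $1$ over the residue field of $K$. A semistable vertex set of $X$ is a finite set $V_0$ of type 2 points of $X^{\mathrm{an}}$ such that $X^{\mathrm{an}}\setminus V_0$ is a disjoint union of open discs and finitely many open annuli. The skeleton of an annulus $\{r_1<|T|<r_2\}$ is the set of points given by the sup norms $f\mapsto\sup_{|c|\le r}|f(c)|$, $r_1<r<r_2$. $\Sigma(X,V_0)$ is the union of $V_0$ and the skeleta of the annuli components of $X^{\mathrm{an}}\setminus V_0$ (a finite graph inside $X^{\mathrm{an}}$). The retraction $\tau_{V_0}:X^{\mathrm{an}}\to\Sigma(X,V_0)$ is the identity on $\Sigma(X,V_0)$, on an annulus component it is the canonical retraction to its skeleton, and it maps each open disc component to its unique boundary point in $V_0$. An open $V\subset X^{\mathrm{an}}$ is simple if it is isomorphic to an open disc or an open annulus, or if there are a semistable vertex set $V_0$ and a simply connected open $W\subset\Sigma(X,V_0)$ with $V=\tau_{V_0}^{-1}(W)$.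 A simple open subset is strictly simple if its closure in $X^{\mathrm{an}}$ is simply connected (in the case of a disc or an annulus), respectively if the closure of $W$ in $\Sigma(X,V_0)$ is simply connected (when $V=\tau_{V_0}^{-1}(W)$). *)

theory Defs
  imports
    "HOL-Analysis.Analysis"
    "HOL-Algebra.Finite_Extensions"
    "HOL-Algebra.Generated_Fields"
    "HOL-Algebra.QuotRing"
    "HOL-Computational_Algebra.Polynomial"
    "HOL-Library.Poly_Mapping"
begin

section \<open>The ground field\<close>

definition nonarch_abs :: "('k::field \<Rightarrow> real) \<Rightarrow> bool" where
  "nonarch_abs v \<longleftrightarrow>
     (\<forall>x. 0 \<le> v x) \<and> (\<forall>x. v x = 0 \<longleftrightarrow> x = 0) \<and>
     (\<forall>x y. v (x * y) = v x * v y) \<and> (\<forall>x y. v (x + y) \<le> max (v x) (v y))"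

definition nontrivial_abs :: "('k::field \<Rightarrow> real) \<Rightarrow> bool" where
  "nontrivial_abs v \<longleftrightarrow> (\<exists>x. x \<noteq> 0 \<and> v x \<noteq> 1)"

definition complete_abs :: "('k::field \<Rightarrow> real) \<Rightarrow> bool" where
  "complete_abs v \<longleftrightarrow>
     (\<forall>s :: nat \<Rightarrow> 'k. (\<forall>e>0. \<exists>N. \<forall>i\<ge>N. \<forall>j\<ge>N. v (s i - s j) < e)
        \<longrightarrow> (\<exists>l. (\<lambda>i. v (s i - l)) \<longlonglongrightarrow> 0))"


section \<open>Smooth projective curves\<close>

type_synonym 'k mpoly = "(nat \<Rightarrow>\<^sub>0 nat) \<Rightarrow>\<^sub>0 'k"

definition mconst :: "'k::comm_ring_1 \<Rightarrow> 'k mpoly" where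
  "mconst c = Poly_Mapping.single 0 c"

definition mvar :: "nat \<Rightarrow> 'k::comm_ring_1 mpoly" where
  "mvar i = Poly_Mapping.single (Poly_Mapping.single i 1) 1"

definition meval :: "(nat \<Rightarrow> 'k::comm_ring_1) \<Rightarrow> 'k mpoly \<Rightarrow> 'k" where
  "meval a p = (\<Sum>m\<in>Poly_Mapping.keys p. Poly_Mapping.lookup p m *
                  (\<Prod>i\<in>Poly_Mapping.keys m. a i ^ Poly_Mapping.lookup m i))"

definition mpderiv :: "nat \<Rightarrow> 'k::comm_ring_1 mpoly \<Rightarrow> 'k mpoly" where
  "mpderiv i p = (\<Sum>m\<in>Poly_Mapping.keys p.
     Poly_Mapping.single (m - Poly_Mapping.single i 1)
       (of_nat (Poly_Mapping.lookup m i) * Poly_Mapping.lookup p m))"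

text \<open>Homogeneous polynomials of degree \<open>d\<close> in \<open>T\<^sub>0, \<dots>, T\<^sub>n\<close> (including \<open>0\<close>).\<close>

definition homog :: "nat \<Rightarrow> nat \<Rightarrow> 'k::comm_ring_1 mpoly set" where
  "homog n d = {p. \<forall>m\<in>Poly_Mapping.keys p.
     Poly_Mapping.keys m \<subseteq> {..n} \<and> (\<Sum>i\<le>n. Poly_Mapping.lookup m i) = d}"

text \<open>
  A subset of \<open>\<P>\<^sup>n(K)\<close> is represented by the set of all vectors of homogeneous
  coordinates of its points, that is, by a punctured cone.
\<close>

definition hcoords :: "nat \<Rightarrow> (nat \<Rightarrow> 'k::field) set" where
  "hcoords n = {a. (\<forall>i>n. a i = 0) \<and> (\<exists>i\<le>n. a i \<noteq> 0)}"

definition proj_closed :: "nat \<Rightarrow> (nat \<Rightarrow> 'k::field) set \<Rightarrow> bool" where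
  "proj_closed n Z \<longleftrightarrow>
     (\<exists>F \<subseteq> (\<Union>d. homog n d). Z = {a \<in> hcoords n. \<forall>f\<in>F. meval a f = 0})"

definition proj_irreducible :: "nat \<Rightarrow> (nat \<Rightarrow> 'k::field) set \<Rightarrow> bool" where
  "proj_irreducible n Z \<longleftrightarrow> proj_closed n Z \<and> Z \<noteq> {} \<and>
     (\<forall>A B. proj_closed n A \<and> proj_closed n B \<and> Z = A \<union> B \<longrightarrow> Z = A \<or> Z = B)"

definition proj_chain :: "nat \<Rightarrow> (nat \<Rightarrow> 'k::field) set \<Rightarrow> nat \<Rightarrow> (nat \<Rightarrow> (nat \<Rightarrow> 'k) set) \<Rightarrow> bool" where
  "proj_chain n Z d C \<longleftrightarrow> (\<forall>i\<le>d. proj_irreducible n (C i) \<and> C i \<subseteq> Z) \<and> (\<forall>i<d. C i \<subset> C (Suc i))"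

definition proj_dim :: "nat \<Rightarrow> (nat \<Rightarrow> 'k::field) set \<Rightarrow> nat \<Rightarrow> bool" where
  "proj_dim n Z d \<longleftrightarrow> (\<exists>C. proj_chain n Z d C) \<and> \<not> (\<exists>C. proj_chain n Z (Suc d) C)"

definition hideal :: "nat \<Rightarrow> (nat \<Rightarrow> 'k::field) set \<Rightarrow> 'k mpoly set" where
  "hideal n Z = {f \<in> (\<Union>d. homog n d). \<forall>a\<in>Z. meval a f = 0}"

text \<open>
  Jacobian criterion: the gradients at \<open>a\<close> of the homogeneous equations span a space of
  dimension equal to the codimension of \<open>Z\<close>.
\<close>

definition jacobian_rank :: "nat \<Rightarrow> (nat \<Rightarrow> 'k::field) set \<Rightarrow> (nat \<Rightarrow> 'k) \<Rightarrow> nat" where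
  "jacobian_rank n Z a =
     vector_space.dim (\<lambda>(c::'k) (w :: nat \<Rightarrow>\<^sub>0 'k). Poly_Mapping.map ((*) c) w)
       ((\<lambda>f. \<Sum>i\<le>n. Poly_Mapping.single i (meval a (mpderiv i f))) ` hideal n Z)"

definition smooth_projective_curve :: "nat \<Rightarrow> (nat \<Rightarrow> 'k::field) set \<Rightarrow> bool" where
  "smooth_projective_curve n Z \<longleftrightarrow>
     proj_irreducible n Z \<and> proj_dim n Z 1 \<and> (\<forall>a\<in>Z. jacobian_rank n Z a + 1 = n)"


section \<open>Analytic spaces with functions given as local limits of rational functions\<close>

text \<open>
  Following Berkovich, the points of an analytic space are seminorms on a ring of
  polynomials, and an analytic function assigns to each point \<open>x\<close> of an open set an element
  of the completed residue field \<open>\<H>(x)\<close>, and is locally a uniform limit of rational functions.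
  (On the reduced spaces used below this gives the usual structure sheaf.)  The component
  \<open>fractions\<close> lists the pairs \<open>(g, h)\<close> for which \<open>g / h\<close> is a rational function: all pairs for
  the affine line, pairs of homogeneous polynomials of equal degree for a projective variety.
  Sets of points carry the topology of pointwise convergence.
\<close>

record ('a, 'k) berk_space =
  points :: "('a \<Rightarrow> real) set"
  fractions :: "('a \<times> 'a) set"
  scalar :: "'k \<Rightarrow> 'a"

definition fadd :: "'a::comm_ring_1 \<times> 'a \<Rightarrow> 'a \<times> 'a \<Rightarrow> 'a \<times> 'a" where
  "fadd p q = (fst p * snd q + fst q * snd p, snd p * snd q)"

definition fdiff :: "'a::comm_ring_1 \<times> 'a \<Rightarrow> 'a \<times> 'a \<Rightarrow> 'a \<times> 'a" where
  "fdiff p q = (fst p * snd q - fst q * snd p, snd p * snd q)"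

definition fmult :: "'a::comm_ring_1 \<times> 'a \<Rightarrow> 'a \<times> 'a \<Rightarrow> 'a \<times> 'a" where
  "fmult p q = (fst p * fst q, snd p * snd q)"

definition fnorm :: "('a \<Rightarrow> real) \<Rightarrow> 'a \<times> 'a \<Rightarrow> real" where
  "fnorm x q = x (fst q) / x (snd q)"

definition cauchy_fracs ::
    "('a::comm_ring_1, 'k) berk_space \<Rightarrow> ('a \<Rightarrow> real) \<Rightarrow> (nat \<Rightarrow> 'a \<times> 'a) set" where
  "cauchy_fracs S x =
     {s. (\<forall>i. s i \<in> fractions S \<and> x (snd (s i)) \<noteq> 0) \<and>
         (\<forall>e>0. \<exists>N. \<forall>i\<ge>N. \<forall>j\<ge>N. fnorm x (fdiff (s i) (s j)) < e)}"

definition null_rel ::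
    "('a::comm_ring_1, 'k) berk_space \<Rightarrow> ('a \<Rightarrow> real) \<Rightarrow> ((nat \<Rightarrow> 'a \<times> 'a) \<times> (nat \<Rightarrow> 'a \<times> 'a)) set" where
  "null_rel S x =
     {(s, t). s \<in> cauchy_fracs S x \<and> t \<in> cauchy_fracs S x \<and>
              (\<lambda>i. fnorm x (fdiff (s i) (t i))) \<longlonglongrightarrow> 0}"

definition hfrac ::
    "('a::comm_ring_1, 'k) berk_space \<Rightarrow> ('a \<Rightarrow> real) \<Rightarrow> 'a \<times> 'a \<Rightarrow> (nat \<Rightarrow> 'a \<times> 'a) set" where
  "hfrac S x q = null_rel S x `` {\<lambda>_. q}"

text \<open>The completed residue field \<open>\<H>(x)\<close>, as Cauchy sequences of fractions modulo null sequences.\<close>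

definition hfield ::
    "('a::comm_ring_1, 'k) berk_space \<Rightarrow> ('a \<Rightarrow> real) \<Rightarrow> (nat \<Rightarrow> 'a \<times> 'a) set ring" where
  "hfield S x =
     \<lparr> carrier = cauchy_fracs S x // null_rel S x,
       mult = (\<lambda>A B. \<Union>s\<in>A. \<Union>t\<in>B. null_rel S x `` {\<lambda>i. fmult (s i) (t i)}),
       one = hfrac S x (1, 1),
       zero = hfrac S x (0, 1),
       add = (\<lambda>A B. \<Union>s\<in>A. \<Union>t\<in>B. null_rel S x `` {\<lambda>i. fadd (s i) (t i)}) \<rparr>"

definition hnorm :: "('a \<Rightarrow> real) \<Rightarrow> (nat \<Rightarrow> 'a \<times> 'a) set \<Rightarrow> real" where
  "hnorm x A = (THE r. \<exists>s\<in>A. (\<lambda>i. fnorm x (s i)) \<longlonglongrightarrow> r)"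

definition analytic_functions ::
    "('a::comm_ring_1, 'k) berk_space \<Rightarrow> ('a \<Rightarrow> real) set
       \<Rightarrow> (('a \<Rightarrow> real) \<Rightarrow> (nat \<Rightarrow> 'a \<times> 'a) set) ring" where
  "analytic_functions S U =
     \<lparr> carrier = {f \<in> (\<Pi>\<^sub>E x\<in>U. carrier (hfield S x)).
          \<forall>x\<in>U. \<exists>N. openin (top_of_set (points S)) N \<and> x \<in> N \<and> N \<subseteq> U \<and>
            (\<forall>e>0. \<exists>q\<in>fractions S. \<forall>y\<in>N. y (snd q) \<noteq> 0 \<and>
               hnorm y (f y \<ominus>\<^bsub>hfield S y\<^esub> hfrac S y q) < e)},
       mult = (\<lambda>f g. \<lambda>x\<in>U. f x \<otimes>\<^bsub>hfield S x\<^esub> g x),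
       one = (\<lambda>x\<in>U. \<one>\<^bsub>hfield S x\<^esub>),
       zero = (\<lambda>x\<in>U. \<zero>\<^bsub>hfield S x\<^esub>),
       add = (\<lambda>f g. \<lambda>x\<in>U. f x \<oplus>\<^bsub>hfield S x\<^esub> g x) \<rparr>"

text \<open>
  An isomorphism of \<open>K\<close>-analytic spaces from the open subspace \<open>U\<close> of \<open>S\<close> to the open
  subspace \<open>U'\<close> of \<open>S'\<close>: a homeomorphism together with an isomorphism of the sheaves of
  \<open>K\<close>-algebras that respects the absolute values of functions at points (so that it is
  local on stalks and induces isometries of completed residue fields).
\<close>

definition analytic_iso ::
    "('a::comm_ring_1, 'k) berk_space \<Rightarrow> ('a \<Rightarrow> real) set \<Rightarrow>
     ('b::comm_ring_1, 'k) berk_space \<Rightarrow> ('b \<Rightarrow> real) set \<Rightarrow>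
     (('a \<Rightarrow> real) \<Rightarrow> ('b \<Rightarrow> real)) \<Rightarrow> bool" where
  "analytic_iso S U S' U' \<phi> \<longleftrightarrow>
     openin (top_of_set (points S)) U \<and> openin (top_of_set (points S')) U' \<and>
     (\<exists>\<psi>. homeomorphism U U' \<phi> \<psi>) \<and>
     (\<exists>\<Phi>. \<forall>W. openin (top_of_set U') W \<longrightarrow>
        \<Phi> W \<in> ring_iso (analytic_functions S' W) (analytic_functions S {x \<in> U. \<phi> x \<in> W}) \<and>
        (\<forall>c. \<Phi> W (\<lambda>y\<in>W. hfrac S' y (scalar S' c, 1))
               = (\<lambda>x\<in>{x \<in> U. \<phi> x \<in> W}. hfrac S x (scalar S c, 1))) \<and>
        (\<forall>f\<in>carrier (analytic_functions S' W).
           (\<forall>x\<in>U. \<phi> x \<in> W \<longrightarrow> hnorm x (\<Phi> W f x) = hnorm (\<phi> x) (f (\<phi> x))) \<and>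
           (\<forall>W0. openin (top_of_set U') W0 \<and> W0 \<subseteq> W \<longrightarrow>
              \<Phi> W0 (restrict f W0) = restrict (\<Phi> W f) {x \<in> U. \<phi> x \<in> W0})))"


section \<open>Analytification of a projective variety and the affine line\<close>

text \<open>
  Points of the analytification of \<open>Z \<subseteq> \<P>\<^sup>n\<close> are multiplicative seminorms on homogeneous
  polynomials extending the absolute value of \<open>K\<close>, killing the ideal of \<open>Z\<close> but not all
  coordinates, up to the equivalence \<open>x \<sim> y\<close> iff there is \<open>C > 0\<close> with \<open>x f = C\<^sup>d * y f\<close> for all
  \<open>f\<close> of degree \<open>d\<close>.  Each class is represented by its unique member with
  \<open>max (x T\<^sub>i) = 1\<close>, extended by \<open>0\<close> to inhomogeneous polynomials.
\<close>

definition proj_points :: "('k::field \<Rightarrow> real) \<Rightarrow> nat \<Rightarrow> (nat \<Rightarrow> 'k) set \<Rightarrow> ('k mpoly \<Rightarrow> real) set" where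
  "proj_points v n Z = {x.
     (\<forall>f. 0 \<le> x f) \<and>
     (\<forall>f. f \<notin> (\<Union>d. homog n d) \<longrightarrow> x f = 0) \<and>
     (\<forall>c. x (mconst c) = v c) \<and>
     (\<forall>d e. \<forall>f\<in>homog n d. \<forall>g\<in>homog n e. x (f * g) = x f * x g) \<and>
     (\<forall>d. \<forall>f\<in>homog n d. \<forall>g\<in>homog n d. x (f + g) \<le> max (x f) (x g)) \<and>
     (\<forall>f\<in>hideal n Z. x f = 0) \<and>
     Max ((\<lambda>i. x (mvar i)) ` {..n}) = 1}"

definition analytification ::
    "('k::field \<Rightarrow> real) \<Rightarrow> nat \<Rightarrow> (nat \<Rightarrow> 'k) set \<Rightarrow> ('k mpoly, 'k) berk_space" where
  "analytification v n Z =
     \<lparr> points = proj_points v n Z,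
       fractions = (\<Union>d. homog n d \<times> homog n d),
       scalar = mconst \<rparr>"

definition line_points :: "('k::field \<Rightarrow> real) \<Rightarrow> ('k poly \<Rightarrow> real) set" where
  "line_points v = {x.
     (\<forall>f. 0 \<le> x f) \<and> (\<forall>c. x [:c:] = v c) \<and>
     (\<forall>f g. x (f * g) = x f * x g) \<and> (\<forall>f g. x (f + g) \<le> max (x f) (x g))}"

definition affine_line :: "('k::field \<Rightarrow> real) \<Rightarrow> ('k poly, 'k) berk_space" where
  "affine_line v = \<lparr> points = line_points v, fractions = UNIV, scalar = (\<lambda>c. [:c:]) \<rparr>"

definition std_disc :: "('k::field \<Rightarrow> real) \<Rightarrow> real \<Rightarrow> ('k poly \<Rightarrow> real) set" where
  "std_disc v r = {x \<in> line_points v. x [:0, 1:] < r}"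

definition std_annulus :: "('k::field \<Rightarrow> real) \<Rightarrow> real \<Rightarrow> real \<Rightarrow> ('k poly \<Rightarrow> real) set" where
  "std_annulus v r1 r2 = {x \<in> line_points v. r1 < x [:0, 1:] \<and> x [:0, 1:] < r2}"

definition sup_point :: "('k::field \<Rightarrow> real) \<Rightarrow> real \<Rightarrow> 'k poly \<Rightarrow> real" where
  "sup_point v r = (\<lambda>f. SUP c\<in>{c. v c \<le> r}. v (poly f c))"

definition std_skeleton :: "('k::field \<Rightarrow> real) \<Rightarrow> real \<Rightarrow> real \<Rightarrow> ('k poly \<Rightarrow> real) set" where
  "std_skeleton v r1 r2 = sup_point v ` {r1<..<r2}"


section \<open>Discs, annuli and type 2 points\<close>

definition is_open_disc ::
    "('k::field \<Rightarrow> real) \<Rightarrow> ('a::comm_ring_1, 'k) berk_space \<Rightarrow> ('a \<Rightarrow> real) set \<Rightarrow> bool" where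
  "is_open_disc v S U \<longleftrightarrow> (\<exists>r>0. \<exists>\<phi>. analytic_iso S U (affine_line v) (std_disc v r) \<phi>)"

definition is_annulus_chart ::
    "('k::field \<Rightarrow> real) \<Rightarrow> ('a::comm_ring_1, 'k) berk_space \<Rightarrow> ('a \<Rightarrow> real) set \<Rightarrow>
     (('a \<Rightarrow> real) \<Rightarrow> ('k poly \<Rightarrow> real)) \<times> real \<times> real \<Rightarrow> bool" where
  "is_annulus_chart v S U = (\<lambda>(\<phi>, r1, r2).
     0 < r1 \<and> r1 < r2 \<and> analytic_iso S U (affine_line v) (std_annulus v r1 r2) \<phi>)"

definition is_open_annulus ::
    "('k::field \<Rightarrow> real) \<Rightarrow> ('a::comm_ring_1, 'k) berk_space \<Rightarrow> ('a \<Rightarrow> real) set \<Rightarrow> bool" where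
  "is_open_annulus v S U \<longleftrightarrow> (\<exists>c. is_annulus_chart v S U c)"

definition hvaluation_ring ::
    "('a::comm_ring_1, 'k) berk_space \<Rightarrow> ('a \<Rightarrow> real) \<Rightarrow> (nat \<Rightarrow> 'a \<times> 'a) set ring" where
  "hvaluation_ring S x = (hfield S x)\<lparr>carrier := {A \<in> carrier (hfield S x). hnorm x A \<le> 1}\<rparr>"

definition hmaximal_ideal ::
    "('a::comm_ring_1, 'k) berk_space \<Rightarrow> ('a \<Rightarrow> real) \<Rightarrow> (nat \<Rightarrow> 'a \<times> 'a) set set" where
  "hmaximal_ideal S x = {A \<in> carrier (hfield S x). hnorm x A < 1}"

definition hresidue_field ::
    "('a::comm_ring_1, 'k) berk_space \<Rightarrow> ('a \<Rightarrow> real) \<Rightarrow> (nat \<Rightarrow> 'a \<times> 'a) set set ring" where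
  "hresidue_field S x = hvaluation_ring S x Quot hmaximal_ideal S x"

text \<open>The image in \<open>hresidue_field S x\<close> of the residue field of \<open>K\<close>.\<close>

definition base_residue_field ::
    "('k::field \<Rightarrow> real) \<Rightarrow> ('a::comm_ring_1, 'k) berk_space \<Rightarrow> ('a \<Rightarrow> real)
       \<Rightarrow> (nat \<Rightarrow> 'a \<times> 'a) set set set" where
  "base_residue_field v S x =
     {hmaximal_ideal S x +>\<^bsub>hvaluation_ring S x\<^esub> hfrac S x (scalar S c, 1) | c. v c \<le> 1}"

text \<open>\<open>L\<close> has a one-element transcendence basis \<open>{t}\<close> over its subfield \<open>F\<close>.\<close>

definition transcendence_degree_one :: "'l ring \<Rightarrow> 'l set \<Rightarrow> bool" where
  "transcendence_degree_one L F \<longleftrightarrow>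
     (\<exists>t\<in>carrier L. ring.transcendental L F t \<and>
        (\<forall>y\<in>carrier L. ring.algebraic L (generate_field L (insert t F)) y))"

definition type2_point ::
    "('k::field \<Rightarrow> real) \<Rightarrow> ('a::comm_ring_1, 'k) berk_space \<Rightarrow> ('a \<Rightarrow> real) \<Rightarrow> bool" where
  "type2_point v S x \<longleftrightarrow> x \<in> points S \<and>
     transcendence_degree_one (hresidue_field S x) (base_residue_field v S x)"


section \<open>Semistable vertex sets, skeleta and retractions\<close>

text \<open>
  \<open>P\<close> is the set of connected components of the complement of \<open>V0\<close>; it is determined by \<open>V0\<close>
  because open discs and open annuli are connected and the members of \<open>P\<close> are open
  (\<open>analytic_iso\<close> requires this).
\<close>

definition semistable_decomposition ::
    "('k::field \<Rightarrow> real) \<Rightarrow> ('a::comm_ring_1, 'k) berk_space \<Rightarrow>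
     ('a \<Rightarrow> real) set \<Rightarrow> ('a \<Rightarrow> real) set set \<Rightarrow> bool" where
  "semistable_decomposition v S V0 P \<longleftrightarrow>
     finite V0 \<and> (\<forall>x\<in>V0. type2_point v S x) \<and>
     partition_on (points S - V0) P \<and>
     (\<forall>C\<in>P. is_open_disc v S C \<or> is_open_annulus v S C) \<and>
     finite {C \<in> P. is_open_annulus v S C}"

text \<open>
  The skeleton of an annulus and the retraction onto it do not depend on the chart.  On a
  standard annulus the retraction sends \<open>x\<close> to the sup norm on the disc of radius \<open>x T\<close>.
\<close>

definition annulus_chart ::
    "('k::field \<Rightarrow> real) \<Rightarrow> ('a::comm_ring_1, 'k) berk_space \<Rightarrow> ('a \<Rightarrow> real) set \<Rightarrow>
     (('a \<Rightarrow> real) \<Rightarrow> ('k poly \<Rightarrow> real)) \<times> real \<times> real" where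
  "annulus_chart v S A = (SOME c. is_annulus_chart v S A c)"

definition annulus_skeleton ::
    "('k::field \<Rightarrow> real) \<Rightarrow> ('a::comm_ring_1, 'k) berk_space \<Rightarrow> ('a \<Rightarrow> real) set \<Rightarrow> ('a \<Rightarrow> real) set" where
  "annulus_skeleton v S A =
     (case annulus_chart v S A of (\<phi>, r1, r2) \<Rightarrow> {x \<in> A. \<phi> x \<in> std_skeleton v r1 r2})"

definition annulus_retraction ::
    "('k::field \<Rightarrow> real) \<Rightarrow> ('a::comm_ring_1, 'k) berk_space \<Rightarrow> ('a \<Rightarrow> real) set \<Rightarrow>
     ('a \<Rightarrow> real) \<Rightarrow> ('a \<Rightarrow> real)" where
  "annulus_retraction v S A x =
     (case annulus_chart v S A of (\<phi>, r1, r2) \<Rightarrow> inv_into A \<phi> (sup_point v (\<phi> x [:0, 1:])))"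

definition skeleton ::
    "('k::field \<Rightarrow> real) \<Rightarrow> ('a::comm_ring_1, 'k) berk_space \<Rightarrow>
     ('a \<Rightarrow> real) set \<Rightarrow> ('a \<Rightarrow> real) set set \<Rightarrow> ('a \<Rightarrow> real) set" where
  "skeleton v S V0 P = V0 \<union> (\<Union>A\<in>{A \<in> P. is_open_annulus v S A}. annulus_skeleton v S A)"

definition retraction_map ::
    "('k::field \<Rightarrow> real) \<Rightarrow> ('a::comm_ring_1, 'k) berk_space \<Rightarrow>
     ('a \<Rightarrow> real) set \<Rightarrow> ('a \<Rightarrow> real) set set \<Rightarrow> ('a \<Rightarrow> real) \<Rightarrow> ('a \<Rightarrow> real)" where
  "retraction_map v S V0 P x =
     (if x \<in> skeleton v S V0 P then x
      else let C = (THE C. C \<in> P \<and> x \<in> C) in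
        if is_open_annulus v S C then annulus_retraction v S C x
        else (THE p. p \<in> V0 \<and> p \<in> top_of_set (points S) frontier_of C))"


section \<open>Simple and strictly simple open subsets\<close>

text \<open>\<open>\<tau>\<close>-presentations \<open>V = \<tau>\<^sup>-\<^sup>1(W)\<close> of an open subset.\<close>

definition retraction_preimage ::
    "('k::field \<Rightarrow> real) \<Rightarrow> ('a::comm_ring_1, 'k) berk_space \<Rightarrow>
     ('a \<Rightarrow> real) set \<Rightarrow> ('a \<Rightarrow> real) set set \<Rightarrow> ('a \<Rightarrow> real) set \<Rightarrow> ('a \<Rightarrow> real) set \<Rightarrow> bool" where
  "retraction_preimage v S V0 P W V \<longleftrightarrow>
     semistable_decomposition v S V0 P \<and>
     openin (top_of_set (skeleton v S V0 P)) W \<and> simply_connected W \<and>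
     V = {x \<in> points S. retraction_map v S V0 P x \<in> W}"

definition simple_open ::
    "('k::field \<Rightarrow> real) \<Rightarrow> ('a::comm_ring_1, 'k) berk_space \<Rightarrow> ('a \<Rightarrow> real) set \<Rightarrow> bool" where
  "simple_open v S V \<longleftrightarrow> openin (top_of_set (points S)) V \<and>
     (is_open_disc v S V \<or> is_open_annulus v S V \<or> (\<exists>V0 P W. retraction_preimage v S V0 P W V))"

definition strictly_simple_open ::
    "('k::field \<Rightarrow> real) \<Rightarrow> ('a::comm_ring_1, 'k) berk_space \<Rightarrow> ('a \<Rightarrow> real) set \<Rightarrow> bool" where
  "strictly_simple_open v S V \<longleftrightarrow> simple_open v S V \<and>
     ((is_open_disc v S V \<or> is_open_annulus v S V) \<and>
        simply_connected (top_of_set (points S) closure_of V) \<or>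
      (\<exists>V0 P W. retraction_preimage v S V0 P W V \<and>
         simply_connected (top_of_set (skeleton v S V0 P) closure_of W)))"

end

theory Submission
  imports Defs
begin

text \<open>
  If \<open>V\<close> is the preimage of a connected open subset \<open>W\<close> of a skeleton, then outside the vertices
  a boundary point of \<open>V\<close> lies on the skeleton of an annulus and corresponds to a boundary point of
  \<open>W\<close> inside an edge. By connectedness of \<open>W\<close>, there are at most two of these on each edge.

  If \<open>V\<close> is a disc or an annulus with coordinate \<open>T\<close>, compactness shows that a boundary point is a
  cluster point of one of the ends of \<open>V\<close> (\<open>\<bar>T\<bar>\<close> tending to a boundary radius), so it suffices that
  \<open>x f\<close> has a limit along each end for every form \<open>f\<close>. A form that does not vanish on the curve has
  only finitely many zeros on the analytification: otherwise an ultrafilter on its zeros yields a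
  homogeneous prime ideal, which by the Nullstellensatz is the ideal of a point because the curve has
  dimension one. Hence, near an end, quotients of forms are invertible analytic functions. Their
  absolute values are locally those of invertible rational functions, and the maximum
  principle for \<open>F\<^sup>k \<bar>T\<bar>\<^sup>m\<close> and its inverse, applied for all \<open>k\<close> and \<open>m\<close>, forces them to be of
  the form \<open>C \<bar>T\<bar>\<^sup>\<alpha>\<close>, which converges.
\<close>

section \<open>Valued fields and points of the affine line\<close>

text \<open>A chart identifies rings of analytic functions and preserves \<open>hnorm\<close>, so
  what it carries over to the affine line is the real function |F|. This is why the analysis there
  deals with positive real functions that are locally quotients |f| / |g|. The exponent of C
  |T|^\<alpha> comes from a choice of slope. The maximum principle bounds ln F + \<beta> ln |T| by
  its values at two radii, for every rational and hence by continuity for every real \<beta>. For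
  the \<beta> that makes the two values equal, the bound and the corresponding one for 1 / F
  coincide. Limits of quotients of forms do not yet give limits of \<open>x f\<close>, because
  points are scaled by max x T_i = 1. The scaling itself supplies the missing factor: the maximum
  over j of x T_j / x T_i is 1 / x T_i. The Nullstellensatz rests on cardinality: a complete
  nontrivially valued field is uncountable, while the forms of a fixed degree span a
  finite-dimensional space.\<close>

locale nonarch_field =
  fixes v :: "'k::alg_closed_field \<Rightarrow> real"
  assumes nonarch: "nonarch_abs v" and nontrivial: "nontrivial_abs v" and complete: "complete_abs v"
begin

lemma v_nonneg [simp]: "0 \<le> v x"
  and v_eq_0_iff [simp]: "v x = 0 \<longleftrightarrow> x = 0"
  and v_mult: "v (x * y) = v x * v y"
  and v_add_le: "v (x + y) \<le> max (v x) (v y)"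
  using nonarch unfolding nonarch_abs_def by blast+

lemma v_0 [simp]: "v 0 = 0" by simp

lemma v_pos_iff [simp]: "0 < v x \<longleftrightarrow> x \<noteq> 0"
  using v_nonneg[of x] v_eq_0_iff[of x] by (metis less_eq_real_def less_irrefl)

lemma v_1 [simp]: "v 1 = 1"
  using v_mult[of 1 1] v_eq_0_iff[of 1] by (metis mult_cancel_right1 mult_1 one_neq_zero)

lemma v_power: "v (x ^ n) = v x ^ n"
  by (induction n) (auto simp: v_mult)

lemma v_minus [simp]: "v (- x) = v x"
proof -
  have "v (- 1) ^ 2 = 1" by (simp flip: v_power)
  then have "v (- 1) = 1" using v_nonneg[of "-1"] by (simp add: power2_eq_1_iff)
  then show ?thesis using v_mult[of "-1" x] by simp
qed

lemma v_minus_commute: "v (x - y) = v (y - x)"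
  using v_minus[of "x - y"] by simp

lemma v_diff_le: "v (x - y) \<le> max (v x) (v y)"
  using v_add_le[of x "- y"] by simp

lemma v_diff_triangle: "v (x - z) \<le> max (v (x - y)) (v (y - z))"
  using v_add_le[of "x - y" "y - z"] by simp

lemma v_inverse: "v (inverse x) = inverse (v x)"
proof (cases "x = 0")
  case False
  then have "v x * v (inverse x) = 1" by (simp flip: v_mult)
  then show ?thesis using False by (simp add: field_simps)
qed simp

lemma v_diff_eq_max: "v (x - z) \<noteq> v (y - z) \<Longrightarrow> v (x - y) = max (v (x - z)) (v (y - z))"
  using v_diff_triangle[of x y z] v_diff_triangle[of x z y] v_diff_triangle[of y z x]
    v_minus_commute[of x y] v_minus_commute[of x z] v_minus_commute[of z y]
  by linarith

lemma exists_gt_1: "\<exists>p. 1 < v p"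
proof -
  obtain x where x: "x \<noteq> 0" "v x \<noteq> 1" using nontrivial unfolding nontrivial_abs_def by blast
  show ?thesis
  proof (cases "1 < v x")
    case False
    then have "v x < 1" "0 < v x" using x by auto
    then have "1 < v (inverse x)" by (simp add: v_inverse one_less_inverse)
    then show ?thesis by blast
  qed blast
qed

lemma v_power_int: "v (x powi k) = v x powi k"
  by (simp add: power_int_def v_power v_inverse)

text \<open>The field is algebraically closed, so an element \<open>p\<close> with
  \<open>1 < v p\<close> has roots \<open>w\<close> of every order. For large order the logarithms
  of the values of the integer powers of \<open>w\<close> form a grid finer than the gap between
  \<open>a\<close> and \<open>b\<close>.\<close>

lemma value_dense:
  assumes "0 \<le> a" "a < b"
  obtains u where "a < v u" "v u < b"
proof -
  \<comment> \<open>A positive lower bound is needed for logarithms, and \<open>a\<close> may be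
    0.\<close>
  define a' where "a' = max a (b / 2)"
  have a': "0 < a'" "a \<le> a'" "a' < b" using assms by (auto simp: a'_def)
  obtain p where p: "1 < v p" using exists_gt_1 by blast
  define l where "l = ln (v p)"
  have l: "0 < l" unfolding l_def using p by (rule ln_gt_zero)
  have d: "0 < ln b - ln a'" using a' by simp
  obtain n :: nat where n: "l / (ln b - ln a') < real n" using reals_Archimedean2 by blast
  have n0: "0 < n" using n l d by (metis divide_pos_pos of_nat_0_less_iff order.strict_trans)
  define s where "s = l / real n"
  have s: "0 < s" "s < ln b - ln a'" using n n0 l d by (auto simp: s_def field_simps)
  obtain w where w: "w ^ n = p"
    using nth_root_exists[of n p] n0 by blast
  have w0: "w \<noteq> 0" using w p n0 by (auto simp: zero_power)
  have "real n * ln (v w) = l"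
    unfolding l_def w[symmetric] v_power using w0 by (simp add: ln_realpow)
  then have lw: "ln (v w) = s" using n0 by (simp add: s_def field_simps)
  define k where "k = \<lfloor>ln a' / s\<rfloor> + 1"
  have "ln a' / s < real_of_int k" "real_of_int k \<le> ln a' / s + 1" unfolding k_def by linarith+
  then have k: "ln a' < real_of_int k * s" "real_of_int k * s \<le> ln a' + s" using s by (auto simp: field_simps)
  have "v (w powi k) = exp (real_of_int k * s)"
    using w0 lw by (simp add: v_power_int flip: powr_real_of_int' add: powr_def)
  moreover have "a' < exp (real_of_int k * s)"
    using k a' by (metis exp_ln exp_less_mono)
  moreover have "exp (real_of_int k * s) < b"
    using k s a' by (smt (verit) exp_ln exp_less_mono)
  ultimately show ?thesis using a' that[of "w powi k"] by simp
qed

text \<open>Serves to pick radii that differ from the distances to finitely many roots.\<close>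

lemma value_dense_avoid:
  assumes "finite F" "0 \<le> a" "a < b"
  obtains u where "a < v u" "v u < b" "v u \<notin> F"
proof -
  define c where "c = Max (insert a {x \<in> F. x < b})"
  have fin: "finite (insert a {x \<in> F. x < b})" using assms by auto
  have "c \<in> insert a {x \<in> F. x < b}" unfolding c_def by (rule Max_in) (use fin in auto)
  then have cb: "c < b" using assms by auto
  have ca: "a \<le> c" unfolding c_def using fin by simp
  obtain u where u: "c < v u" "v u < b" using value_dense[of c b] ca cb assms by auto
  moreover have "v u \<notin> F"
  proof
    assume "v u \<in> F"
    then have "v u \<le> c" unfolding c_def using fin u by (intro Max_ge) auto
    then show False using u by simp
  qed
  ultimately show ?thesis using that[of u] ca by linarith
qed

text \<open>The sup norm on the closed disc of radius \<open>t\<close> around \<open>c\<close>; for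
  \<open>t = 0\<close> it is evaluation at \<open>c\<close>. The skeleton of a standard annulus
  consists of the points \<open>zeta 0 t\<close>.\<close>

definition zeta :: "'k \<Rightarrow> real \<Rightarrow> 'k poly \<Rightarrow> real" where
  "zeta c t f = (SUP u\<in>{u. v (u - c) \<le> t}. v (poly f u))"

lemma sup_point_eq_zeta: "sup_point v t = zeta 0 t"
  by (rule ext) (simp add: sup_point_def zeta_def)

lemma v_poly_factors: "v (poly (Polynomial.smult k (\<Prod>b\<in>#A. [:-b, 1:])) u) = v k * (\<Prod>b\<in>#A. v (b - u))"
proof -
  have "v (poly (\<Prod>b\<in>#A. [:-b, 1:]) u) = (\<Prod>b\<in>#A. v (b - u))"
  proof (induction A)
    case (add x A)
    have "v (poly [:-x, 1:] u) = v (x - u)" by (simp add: v_minus_commute[of u])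
    then show ?case using add
      by (simp del: mult_pCons_left poly_pCons add: v_mult)
  qed simp
  then show ?thesis by (simp add: v_mult)
qed

lemma prod_mset_mono_nonneg:
  fixes f g :: "'a \<Rightarrow> real"
  assumes "\<And>x. x \<in># A \<Longrightarrow> 0 \<le> f x \<and> f x \<le> g x"
  shows "0 \<le> (\<Prod>x\<in>#A. f x) \<and> (\<Prod>x\<in>#A. f x) \<le> (\<Prod>x\<in>#A. g x)"
  using assms
proof (induction A)
  case (add x A)
  have "0 \<le> f x \<and> f x \<le> g x" by (rule add.prems) simp
  moreover have "0 \<le> (\<Prod>x\<in>#A. f x) \<and> (\<Prod>x\<in>#A. f x) \<le> (\<Prod>x\<in>#A. g x)"
    by (rule add.IH) (simp add: add.prems)
  ultimately show ?case by (simp add: mult_mono)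
qed simp

lemma continuous_prod_mset_max:
  "isCont (\<lambda>t. \<Prod>b\<in>#A. max (w b :: real) t) t0"
proof (induction A)
  case (add x A)
  have "isCont (\<lambda>t. max (w x) t) t0" by (intro continuous_intros)
  then show ?case using add by (simp add: continuous_mult)
qed simp

lemma zeta_upper:
  assumes "v (u - c) \<le> t"
  shows "v (poly (Polynomial.smult k (\<Prod>b\<in>#A. [:-b, 1:])) u) \<le> v k * (\<Prod>b\<in>#A. max (v (b - c)) t)"
proof -
  have "v (b - u) \<le> max (v (b - c)) t" for b
    using v_diff_triangle[of b u c] v_minus_commute[of u c] assms by linarith
  then have "(\<Prod>b\<in>#A. v (b - u)) \<le> (\<Prod>b\<in>#A. max (v (b - c)) t)"
    using prod_mset_mono_nonneg[of A "\<lambda>b. v (b - u)" "\<lambda>b. max (v (b - c)) t"] by simp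
  then show ?thesis unfolding v_poly_factors by (rule mult_left_mono) simp
qed

text \<open>If |u - c| is a value that differs from the distances of all roots to \<open>c\<close>,
  the ultrametric inequality for every factor is an equality. Such values are dense, so the upper
  bound is approached from inside the disc. Multiplicativity of the sup norm follows from this
  formula.\<close>

lemma zeta_factors:
  assumes t: "0 \<le> t"
  shows "zeta c t (Polynomial.smult k (\<Prod>b\<in>#A. [:-b, 1:])) = v k * (\<Prod>b\<in>#A. max (v (b - c)) t)"
    (is "zeta c t ?f = ?r t")
proof (cases "t = 0")
  case True
  have "v x \<le> 0 \<longleftrightarrow> x = 0" for x using v_nonneg[of x] v_eq_0_iff[of x] by linarith
  then have "{u. v (u - c) \<le> t} = {c}" using True by simp
  moreover have "max (v (b - c)) t = v (b - c)" for b using True by (simp add: max_absorb1)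
  ultimately show ?thesis by (simp add: zeta_def v_poly_factors del: poly_smult)
next
  case False
  then have t: "0 < t" using t by simp
  let ?S = "(\<lambda>u. v (poly ?f u)) ` {u. v (u - c) \<le> t}"
  have bdd: "bdd_above ?S" by (rule bdd_aboveI2, rule zeta_upper) simp
  have "c \<in> {u. v (u - c) \<le> t}" using t by simp
  then have ne: "?S \<noteq> {}" by blast
  have up: "Sup ?S \<le> ?r t"
    by (rule cSup_least[OF ne]) (clarify, rule zeta_upper, simp)
  have low: "?r s \<le> Sup ?S" if s: "0 \<le> s" "s < t" for s
  proof -
    obtain u where u: "s < v u" "v u < t" "v u \<notin> (\<lambda>b. v (b - c)) ` set_mset A"
      using value_dense_avoid[of "(\<lambda>b. v (b - c)) ` set_mset A" s t] s by auto
    have "max (v (b - c)) s \<le> v (b - (u + c))" if "b \<in># A" for b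
    proof -
      have "v (b - c) \<noteq> v u" using u(3) that by (metis imageI)
      then have "v (b - (u + c)) = max (v (b - c)) (v u)"
        using v_diff_eq_max[of b c "u + c"] by simp
      then show ?thesis using u by auto
    qed
    moreover have "0 \<le> max (v (b - c)) s" for b using s by linarith
    ultimately have "(\<Prod>b\<in>#A. max (v (b - c)) s) \<le> (\<Prod>b\<in>#A. v (b - (u + c)))"
      by (intro prod_mset_mono_nonneg[THEN conjunct2]) blast
    then have "?r s \<le> v (poly ?f (u + c))" unfolding v_poly_factors by (rule mult_left_mono) simp
    also have "\<dots> \<le> Sup ?S" by (rule cSup_upper[OF _ bdd], rule imageI) (use u in simp)
    finally show ?thesis .
  qed
  have "isCont ?r t" by (intro continuous_intros continuous_prod_mset_max)
  then have lim: "(?r \<longlongrightarrow> ?r t) (at_left t)" by (simp add: isCont_def filterlim_at_split)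
  have "?r t \<le> Sup ?S"
  proof (rule tendsto_upperbound[OF lim])
    show "\<forall>\<^sub>F s in at_left t. ?r s \<le> Sup ?S"
      by (rule eventually_at_leftI[OF low t]) auto
  qed simp
  then show ?thesis using up by (simp add: zeta_def)
qed

lemma obtain_factors:
  fixes f :: "'k poly"
  obtains k A where "f = Polynomial.smult k (\<Prod>b\<in>#A. [:-b, 1:])" "f \<noteq> 0 \<Longrightarrow> k \<noteq> 0"
proof (cases "f = 0")
  case True then show ?thesis using that[of 0 "{#}"] by simp
next
  case False
  then show ?thesis using alg_closed_imp_factorization[OF False] that by (metis leading_coeff_0_iff)
qed

lemma zeta_bdd: "bdd_above ((\<lambda>u. v (poly f u)) ` {u. v (u - c) \<le> t})"
proof -
  obtain k A where f: "f = Polynomial.smult k (\<Prod>b\<in>#A. [:-b, 1:])" using obtain_factors by blast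
  show ?thesis unfolding f by (rule bdd_aboveI2, rule zeta_upper) simp
qed

lemma zeta_linear [simp]: "0 \<le> t \<Longrightarrow> zeta c t [:-b, 1:] = max (v (b - c)) t"
  using zeta_factors[of t c 1 "{#b#}"] by simp

lemma zeta_T [simp]: "0 \<le> t \<Longrightarrow> zeta c t [:0, 1:] = max (v c) t"
  using zeta_linear[of t c 0] by simp

lemma zeta_in_line:
  assumes t: "0 \<le> t"
  shows "zeta c t \<in> line_points v"
proof -
  have const: "zeta c t [:a:] = v a" for a
    using zeta_factors[OF t, of c a "{#}"] by simp
  have mult: "zeta c t (f * g) = zeta c t f * zeta c t g" for f g
  proof -
    obtain k A where f: "f = Polynomial.smult k (\<Prod>b\<in>#A. [:-b, 1:])" using obtain_factors by blast
    obtain l B where g: "g = Polynomial.smult l (\<Prod>b\<in>#B. [:-b, 1:])" using obtain_factors by blast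
    have "f * g = Polynomial.smult (k * l) (\<Prod>b\<in>#A + B. [:-b, 1:])" unfolding f g by (simp add: mult_ac)
    then show ?thesis unfolding f g by (simp only: zeta_factors[OF t]) (simp add: v_mult mult_ac)
  qed
  have add: "zeta c t (f + g) \<le> max (zeta c t f) (zeta c t g)" for f g
    unfolding zeta_def
  proof (rule cSUP_least)
    fix u assume u: "u \<in> {u. v (u - c) \<le> t}"
    have "v (poly f u) \<le> (SUP u\<in>{u. v (u - c) \<le> t}. v (poly f u))" for f
      using u zeta_bdd by (intro cSUP_upper) auto
    from this[of f] this[of g] show "v (poly (f + g) u) \<le> max (SUP u\<in>{u. v (u - c) \<le> t}. v (poly f u)) (SUP u\<in>{u. v (u - c) \<le> t}. v (poly g u))"
      using v_add_le[of "poly f u" "poly g u"] unfolding poly_add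
      by (meson max.mono order_trans)
  qed (use t in \<open>auto intro!: exI[of _ c]\<close>)
  have nn: "0 \<le> zeta c t f" for f
  proof -
    have "0 \<le> v (poly f c)" by simp
    also have "\<dots> \<le> zeta c t f" unfolding zeta_def using zeta_bdd t by (intro cSUP_upper) auto
    finally show ?thesis .
  qed
  show ?thesis using const mult add nn by (simp add: line_points_def)
qed

section \<open>Points of the affine line as distance functions on the field\<close>

lemma line_nonneg: "y \<in> line_points v \<Longrightarrow> 0 \<le> y f"
  and line_const: "y \<in> line_points v \<Longrightarrow> y [:c:] = v c"
  and line_mult: "y \<in> line_points v \<Longrightarrow> y (f * g) = y f * y g"
  and line_add_le: "y \<in> line_points v \<Longrightarrow> y (f + g) \<le> max (y f) (y g)"
  by (auto simp: line_points_def)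

lemma line_0 [simp]: "y \<in> line_points v \<Longrightarrow> y 0 = 0"
  and line_1 [simp]: "y \<in> line_points v \<Longrightarrow> y 1 = 1"
  using line_const[of y 0] line_const[of y 1] by (simp_all add: one_pCons)

lemma line_factors:
  assumes y: "y \<in> line_points v"
  shows "y (Polynomial.smult k (\<Prod>b\<in>#A. [:-b, 1:])) = v k * (\<Prod>b\<in>#A. y [:-b, 1:])"
proof -
  have "y (\<Prod>b\<in>#A. [:-b, 1:]) = (\<Prod>b\<in>#A. y [:-b, 1:])"
    by (induction A) (use y in \<open>simp_all del: mult_pCons_left add: line_mult\<close>)
  moreover have "Polynomial.smult k (\<Prod>b\<in>#A. [:-b, 1:]) = [:k:] * (\<Prod>b\<in>#A. [:-b, 1:])" by simp
  ultimately show ?thesis using y by (metis line_const line_mult)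
qed

text \<open>Every polynomial splits into linear factors, and points are multiplicative.\<close>

lemma line_eqI:
  assumes "y \<in> line_points v" "z \<in> line_points v" "\<And>b. y [:-b, 1:] = z [:-b, 1:]"
  shows "y = z"
proof
  fix f :: "'k poly"
  obtain k A where f: "f = Polynomial.smult k (\<Prod>b\<in>#A. [:-b, 1:])" using obtain_factors[of f] by blast
  show "y f = z f" unfolding f line_factors[OF assms(1)] line_factors[OF assms(2)] assms(3) ..
qed

text \<open>The number \<open>y [:-b, 1:]\<close> acts as the distance from \<open>b\<close> to the
  point \<open>y\<close>. This lemma and the next are the ultrametric triangle inequality with
  \<open>y\<close> as one of the corners.\<close>

lemma line_linear_triangle:
  assumes y: "y \<in> line_points v"
  shows "y [:-b, 1:] \<le> max (v (b - c)) (y [:-c, 1:])"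
proof -
  have "[:-b, 1:] = [:c - b:] + [:-c, 1:]" by simp
  then show ?thesis using line_add_le[OF y] line_const[OF y] v_minus_commute by metis
qed

lemma line_linear_triangle2:
  assumes y: "y \<in> line_points v"
  shows "v (b - c) \<le> max (y [:-b, 1:]) (y [:-c, 1:])"
proof -
  have n: "y [:b, -1:] = y [:-b, 1:]"
  proof -
    have "[:b, -1:] = [:-1:] * [:-b, 1:]" by simp
    then show ?thesis using y by (metis line_const line_mult v_minus v_1 mult_1)
  qed
  have "[:b - c:] = [:-c, 1:] + [:b, -1:]" by simp
  then show ?thesis using line_add_le[OF y] line_const[OF y] n by (metis max.commute)
qed

text \<open>A point whose smallest distance to the field is attained is the sup norm of a disc: by
  the triangle inequalities its other distances are those of the disc around the nearest
  \<open>c\<close>.\<close>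

lemma line_eq_zeta:
  assumes y: "y \<in> line_points v" and "y [:-c, 1:] = t" "\<And>b. t \<le> y [:-b, 1:]"
  shows "y = zeta c t"
proof (rule line_eqI[OF y])
  have t: "0 \<le> t" using assms line_nonneg by blast
  then show "zeta c t \<in> line_points v" by (rule zeta_in_line)
  fix b show "y [:-b, 1:] = zeta c t [:-b, 1:]"
    using line_linear_triangle[OF y, of b c] line_linear_triangle2[OF y, of b c] assms(2) assms(3)[of b] t
    by simp
qed

lemma line_eq_zeta_0:
  assumes y: "y \<in> line_points v" and "\<And>b. y [:0, 1:] \<le> y [:-b, 1:]"
  shows "y = zeta 0 (y [:0, 1:])"
  using line_eq_zeta[OF y, of 0 "y [:0,1:]"] assms(2) by simp

lemma continuous_on_zeta: "continuous_on {0..} (\<lambda>t. zeta c t)"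
proof (rule continuous_on_coordinatewise_then_product)
  fix f :: "'k poly"
  obtain k A where f: "f = Polynomial.smult k (\<Prod>b\<in>#A. [:-b, 1:])" using obtain_factors by blast
  have "continuous_on {0..} (\<lambda>t. v k * (\<Prod>b\<in>#A. max (v (b - c)) t))"
    by (intro continuous_at_imp_continuous_on ballI continuous_intros continuous_prod_mset_max)
  then show "continuous_on {0..} (\<lambda>t. zeta c t f)"
    by (rule continuous_on_eq) (simp only: f zeta_factors atLeast_iff)
qed

lemma zeta_cong:
  assumes "v (c - d) \<le> t"
  shows "zeta c t = zeta d t"
proof (rule line_eqI)
  have t: "0 \<le> t" using assms v_nonneg order_trans by blast
  then show "zeta c t \<in> line_points v" "zeta d t \<in> line_points v" by (simp_all add: zeta_in_line)
  fix b
  show "zeta c t [:-b, 1:] = zeta d t [:-b, 1:]"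
    using v_diff_triangle[of b d c] v_diff_triangle[of b c d] v_minus_commute[of c d] assms t
    by (simp del: v_0)
qed

end


section \<open>The maximum principle on annuli\<close>

context nonarch_field
begin

definition closed_annulus :: "real \<Rightarrow> real \<Rightarrow> ('k poly \<Rightarrow> real) set" where
  "closed_annulus a b = {y \<in> line_points v. a \<le> y [:0, 1:] \<and> y [:0, 1:] \<le> b}"

text \<open>Among the points with |T| at most \<open>t\<close> the sup norm is the largest, factor
  by factor. This gives the bounds that make closed annuli compact.\<close>

lemma line_le_zeta:
  assumes y: "y \<in> line_points v" and "y [:0, 1:] \<le> t"
  shows "y f \<le> zeta 0 t f"
proof -
  have t: "0 \<le> t" using assms line_nonneg order_trans by blast
  obtain k A where f: "f = Polynomial.smult k (\<Prod>b\<in>#A. [:-b, 1:])" using obtain_factors by blast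
  have "y [:-b, 1:] \<le> max (v (b - 0)) t" for b
    using line_linear_triangle[OF y, of b 0] assms(2) by simp
  then have "(\<Prod>b\<in>#A. y [:-b, 1:]) \<le> (\<Prod>b\<in>#A. max (v (b - 0)) t)"
    using line_nonneg[OF y] by (intro prod_mset_mono_nonneg[THEN conjunct2]) blast
  then show ?thesis unfolding f line_factors[OF y] zeta_factors[OF t] by (rule mult_left_mono) simp
qed

lemma closed_line_points: "closed (line_points v)"
proof -
  have "line_points v = (\<Inter>f. {x. 0 \<le> x f}) \<inter> (\<Inter>c. {x. x [:c:] = v c}) \<inter>
      (\<Inter>f. \<Inter>g. {x. x (f * g) = x f * x g}) \<inter> (\<Inter>f. \<Inter>g. {x. x (f + g) \<le> max (x f) (x g)})"
    by (auto simp: line_points_def)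
  also have "closed \<dots>"
    by (intro closed_Int closed_INT ballI closed_Collect_le closed_Collect_eq continuous_intros
        continuous_on_product_coordinates)
  finally show ?thesis .
qed

text \<open>Tychonoff: a closed annulus is a closed subset of the product of the intervals
  \<open>{0..zeta 0 b f}\<close>.\<close>

lemma compact_closed_annulus: "compact (closed_annulus a b)"
proof -
  let ?B = "PiE UNIV (\<lambda>f. {0..zeta 0 b f})"
  have "compactin (product_topology (\<lambda>_. euclidean) UNIV) ?B"
    by (subst compactin_PiE) (auto simp: compactin_euclidean_iff)
  then have "compact ?B" by (simp add: euclidean_product_topology compactin_euclidean_iff)
  moreover have "closed_annulus a b = line_points v \<inter> ({y. a \<le> y [:0, 1:]} \<inter> {y. y [:0, 1:] \<le> b})"
    by (auto simp: closed_annulus_def)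
  then have "closed (closed_annulus a b)"
    by (simp only:) (intro closed_Int closed_line_points closed_Collect_le continuous_intros
        continuous_on_product_coordinates)
  moreover have "closed_annulus a b \<subseteq> ?B"
    by (auto simp: closed_annulus_def line_nonneg line_le_zeta)
  ultimately show ?thesis using compact_Int_closed[of ?B "closed_annulus a b"] by (simp add: Int_absorb1)
qed

text \<open>What is left of an invertible analytic function when only its absolute value is kept.
  Requiring \<open>z f\<close> and \<open>z g\<close> to be nonzero on \<open>N\<close> excludes
  zeros and poles.\<close>

definition loc_rational :: "('k poly \<Rightarrow> real) set \<Rightarrow> (('k poly \<Rightarrow> real) \<Rightarrow> real) \<Rightarrow> bool" where
  "loc_rational W F \<longleftrightarrow> (\<forall>y\<in>W. \<exists>N f g. openin (top_of_set (line_points v)) N \<and> y \<in> N \<and> N \<subseteq> W \<and>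
     (\<forall>z\<in>N. z f \<noteq> 0 \<and> z g \<noteq> 0 \<and> F z = z f / z g))"

lemma loc_rationalE:
  assumes "loc_rational W F" "y \<in> W"
  obtains N f g where "openin (top_of_set (line_points v)) N" "y \<in> N" "N \<subseteq> W"
    "\<And>z. z \<in> N \<Longrightarrow> z f \<noteq> 0 \<and> z g \<noteq> 0 \<and> F z = z f / z g"
  using assms unfolding loc_rational_def by meson

lemma openin_lineD: "openin (top_of_set (line_points v)) N \<Longrightarrow> z \<in> N \<Longrightarrow> z \<in> line_points v"
  using openin_imp_subset by blast

lemma loc_rational_pos:
  assumes "loc_rational W F" "y \<in> W"
  shows "0 < F y"
proof -
  obtain N f g where N: "openin (top_of_set (line_points v)) N" "y \<in> N"
    "\<And>z. z \<in> N \<Longrightarrow> z f \<noteq> 0 \<and> z g \<noteq> 0 \<and> F z = z f / z g"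
    using loc_rationalE[OF assms] by metis
  have "0 \<le> y f" "0 \<le> y g" using openin_lineD[OF N(1,2)] by (simp_all add: line_nonneg)
  then show ?thesis using N(3)[OF N(2)] by (simp add: zero_less_divide_iff less_le)
qed

lemma loc_rational_continuous:
  assumes "loc_rational W F" "E \<subseteq> W" "W \<subseteq> line_points v"
  shows "continuous_on E F"
  unfolding continuous_on_def
proof
  fix y assume "y \<in> E"
  then have yW: "y \<in> W" using assms by blast
  then obtain N f g where N: "openin (top_of_set (line_points v)) N" "y \<in> N"
    "\<And>z. z \<in> N \<Longrightarrow> z f \<noteq> 0 \<and> z g \<noteq> 0 \<and> F z = z f / z g"
    using loc_rationalE[OF assms(1)] by metis
  obtain O' where O': "open O'" "N = line_points v \<inter> O'" using N(1) by (auto simp: openin_open)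
  have "eventually (\<lambda>z. z \<in> O') (at y within E)"
    using O' N(2) by (intro topological_tendstoD[OF tendsto_ident_at]) auto
  then have ev: "eventually (\<lambda>z. z f / z g = F z) (at y within E)"
    using eventually_at_topological[of "\<lambda>z. z \<in> E" y E] N(3) O'(2) assms(2,3)
    by (auto simp: eventually_at_filter elim!: eventually_mono)
  have "((\<lambda>z. z h) \<longlongrightarrow> y h) (at y within E)" for h :: "'k poly"
    using continuous_on_subset[OF continuous_on_product_coordinates[of h], of E] \<open>y \<in> E\<close>
    by (simp add: continuous_on_def)
  then have "((\<lambda>z. z f / z g) \<longlongrightarrow> y f / y g) (at y within E)"
    using N(3)[OF N(2)] by (intro tendsto_divide) auto
  then have "((\<lambda>z. z f / z g) \<longlongrightarrow> F y) (at y within E)" using N(3)[OF N(2)] by simp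
  then show "(F \<longlongrightarrow> F y) (at y within E)" by (rule Lim_transform_eventually[OF _ ev])
qed

text \<open>A basic open set of the product topology restricts finitely many coordinates. Hence a
  point that agrees with \<open>y\<close> on suitable finitely many polynomials already lies in
  \<open>N\<close>.\<close>

lemma openin_line_finite_determined:
  assumes "openin (top_of_set (line_points v)) N" "y \<in> N"
  obtains J where "finite J" "\<And>z. z \<in> line_points v \<Longrightarrow> (\<And>h. h \<in> J \<Longrightarrow> z h = y h) \<Longrightarrow> z \<in> N"
proof -
  obtain O' where O': "open O'" "N = line_points v \<inter> O'" using assms(1) by (auto simp: openin_open)
  then have "openin (product_topology (\<lambda>_::'k poly. euclidean :: real topology) UNIV) O'"
    by (simp add: euclidean_product_topology)
  moreover have "y \<in> O'" using O' assms by auto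
  ultimately obtain U where U: "finite {i. U i \<noteq> (UNIV :: real set)}" "y \<in> PiE UNIV U" "PiE UNIV U \<subseteq> O'"
    unfolding openin_product_topology_alt by (fastforce simp del: PiE_UNIV_domain)
  show ?thesis
  proof (rule that[OF U(1)])
    fix z assume z: "z \<in> line_points v" "\<And>h. h \<in> {i. U i \<noteq> UNIV} \<Longrightarrow> z h = y h"
    have "z i \<in> U i" for i using z(2)[of i] U(2) by (cases "U i = UNIV") auto
    then show "z \<in> N" using U(3) O' z by auto
  qed
qed

lemma zeta_near:
  assumes "openin (top_of_set (line_points v)) N" "zeta c t \<in> N" "0 \<le> t"
  obtains e where "0 < e" "\<And>s. 0 \<le> s \<Longrightarrow> \<bar>s - t\<bar> < e \<Longrightarrow> zeta c s \<in> N"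
proof -
  obtain O' where O': "open O'" "N = line_points v \<inter> O'" using assms(1) by (auto simp: openin_open)
  have "\<exists>V. open V \<and> t \<in> V \<and> (\<forall>s\<in>{0..}. s \<in> V \<longrightarrow> zeta c s \<in> O')"
    using continuous_on_zeta[of c, unfolded continuous_on_topological] assms O' by auto
  then obtain V where V: "open V" "t \<in> V" "\<And>s. 0 \<le> s \<Longrightarrow> s \<in> V \<Longrightarrow> zeta c s \<in> O'" by auto
  obtain e where "0 < e" "\<And>s. dist s t < e \<Longrightarrow> s \<in> V" using V open_dist by blast
  then show ?thesis using V O' zeta_in_line by (intro that[of e]) (auto simp: dist_real_def)
qed

section \<open>Slopes of sup norms and numbers of roots in discs\<close>

lemma prod_mset_max_split:
  fixes w :: "'a \<Rightarrow> real"
  assumes "\<And>b. b \<in># A \<Longrightarrow> (P b \<longrightarrow> w b \<le> t) \<and> (\<not> P b \<longrightarrow> t \<le> w b)"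
  shows "(\<Prod>b\<in>#A. max (w b) t) =
    (\<Prod>b\<in>#filter_mset (\<lambda>b. \<not> P b) A. w b) * t ^ size (filter_mset P A)"
  using assms
proof (induction A)
  case (add x A)
  have "(P x \<longrightarrow> w x \<le> t) \<and> (\<not> P x \<longrightarrow> t \<le> w x)" by (rule add.prems) simp
  moreover have "(\<Prod>b\<in>#A. max (w b) t) =
    (\<Prod>b\<in>#filter_mset (\<lambda>b. \<not> P b) A. w b) * t ^ size (filter_mset P A)"
    by (rule add.IH) (simp add: add.prems)
  ultimately show ?case by (cases "P x") (auto simp: max_absorb1 max_absorb2)
qed simp

lemma prod_mset_pos:
  fixes w :: "'a \<Rightarrow> real"
  shows "(\<And>b. b \<in># A \<Longrightarrow> 0 < w b) \<Longrightarrow> 0 < (\<Prod>b\<in>#A. w b)"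
  by (induction A) auto

text \<open>The number of roots of \<open>f\<close> in a disc is the slope of \<open>log zeta c t f\<close> against \<open>log t\<close>.\<close>

lemma zeta_slope_right:
  assumes "0 \<le> D" "k \<noteq> 0"
  obtains e K where "0 < e" "0 < K"
    "\<And>t. D \<le> t \<Longrightarrow> t < D + e \<Longrightarrow> zeta c t (Polynomial.smult k (\<Prod>b\<in>#A. [:-b, 1:])) =
       K * t ^ size (filter_mset (\<lambda>b. v (b - c) \<le> D) A)"
proof -
  let ?P = "\<lambda>b. v (b - c) \<le> D"
  define m where "m = Min (insert (D + 1) {v (b - c) | b. b \<in># A \<and> \<not> ?P b})"
  have fin: "finite (insert (D + 1) {v (b - c) | b. b \<in># A \<and> \<not> ?P b})" by simp
  then have "m \<in> insert (D + 1) {v (b - c) | b. b \<in># A \<and> \<not> ?P b}" unfolding m_def by (rule Min_in) simp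
  then have m: "D < m" by auto
  have mle: "m \<le> v (b - c)" if "b \<in># A" "\<not> ?P b" for b unfolding m_def using that fin by (intro Min_le) auto
  show ?thesis
  proof (rule that[of "m - D" "v k * (\<Prod>b\<in>#filter_mset (\<lambda>b. \<not> ?P b) A. v (b - c))"])
    show "0 < v k * (\<Prod>b\<in>#filter_mset (\<lambda>b. \<not> ?P b) A. v (b - c))"
    proof (rule mult_pos_pos)
      show "0 < (\<Prod>b\<in>#filter_mset (\<lambda>b. \<not> ?P b) A. v (b - c))"
        by (rule prod_mset_pos) (use assms in \<open>auto simp del: v_pos_iff\<close>)
    qed (use assms in simp)
    fix t assume t: "D \<le> t" "t < D + (m - D)"
    have "(\<Prod>b\<in>#A. max (v (b - c)) t) =
      (\<Prod>b\<in>#filter_mset (\<lambda>b. \<not> ?P b) A. v (b - c)) * t ^ size (filter_mset ?P A)"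
      by (rule prod_mset_max_split) (use t mle in fastforce)
    then show "zeta c t (Polynomial.smult k (\<Prod>b\<in>#A. [:-b, 1:])) =
       v k * (\<Prod>b\<in>#filter_mset (\<lambda>b. \<not> ?P b) A. v (b - c)) * t ^ size (filter_mset ?P A)"
      using zeta_factors[of t c k A] t assms by simp
  qed (use m in simp)
qed

lemma zeta_slope_left:
  assumes "0 < D" "k \<noteq> 0"
  obtains e K where "0 < e" "0 < K"
    "\<And>t. 0 \<le> t \<Longrightarrow> D - e < t \<Longrightarrow> t \<le> D \<Longrightarrow> zeta c t (Polynomial.smult k (\<Prod>b\<in>#A. [:-b, 1:])) =
       K * t ^ size (filter_mset (\<lambda>b. v (b - c) < D) A)"
proof -
  let ?P = "\<lambda>b. v (b - c) < D"
  define m where "m = Max (insert 0 {v (b - c) | b. b \<in># A \<and> ?P b})"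
  have fin: "finite (insert 0 {v (b - c) | b. b \<in># A \<and> ?P b})" by simp
  then have "m \<in> insert 0 {v (b - c) | b. b \<in># A \<and> ?P b}" unfolding m_def by (rule Max_in) simp
  then have m: "m < D" using assms by auto
  have mle: "v (b - c) \<le> m" if "b \<in># A" "?P b" for b unfolding m_def using that fin by (intro Max_ge) auto
  show ?thesis
  proof (rule that[of "D - m" "v k * (\<Prod>b\<in>#filter_mset (\<lambda>b. \<not> ?P b) A. v (b - c))"])
    show "0 < v k * (\<Prod>b\<in>#filter_mset (\<lambda>b. \<not> ?P b) A. v (b - c))"
    proof (rule mult_pos_pos)
      show "0 < (\<Prod>b\<in>#filter_mset (\<lambda>b. \<not> ?P b) A. v (b - c))"
        by (rule prod_mset_pos) (use assms in \<open>auto simp del: v_pos_iff\<close>)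
    qed (use assms in simp)
    fix t assume t: "0 \<le> t" "D - (D - m) < t" "t \<le> D"
    have "(\<Prod>b\<in>#A. max (v (b - c)) t) =
      (\<Prod>b\<in>#filter_mset (\<lambda>b. \<not> ?P b) A. v (b - c)) * t ^ size (filter_mset ?P A)"
      by (rule prod_mset_max_split) (use t mle in fastforce)
    then show "zeta c t (Polynomial.smult k (\<Prod>b\<in>#A. [:-b, 1:])) =
       v k * (\<Prod>b\<in>#filter_mset (\<lambda>b. \<not> ?P b) A. v (b - c)) * t ^ size (filter_mset ?P A)"
      using zeta_factors[of t c k A] t assms by simp
  qed (use m in simp)
qed

text \<open>A closed disc is the disjoint union of the open discs of the same radius.\<close>

lemma size_le_residue_classes:
  assumes "\<And>c. c \<in># B \<Longrightarrow>
    size (filter_mset (\<lambda>b. v (b - c) < D) B) \<le> size (filter_mset (\<lambda>b. v (b - c) < D) A)"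
    and "0 < D"
  shows "size B \<le> size A"
  using assms(1)
proof (induction "size B" arbitrary: A B rule: less_induct)
  case less
  show ?case
  proof (cases "B = {#}")
    case False
    then obtain c where c: "c \<in># B" by blast
    let ?P = "\<lambda>b. v (b - c) < D"
    let ?A = "filter_mset (\<lambda>b. \<not> ?P b) A" and ?B = "filter_mset (\<lambda>b. \<not> ?P b) B"
    have sA: "size A = size (filter_mset ?P A) + size ?A" and sB: "size B = size (filter_mset ?P B) + size ?B"
      by (metis multiset_partition size_union)+
    have "c \<in># filter_mset ?P B" using c assms(2) by simp
    then have "0 < size (filter_mset ?P B)" by (metis empty_not_add_mset gr0I multi_member_split size_eq_0_iff_empty)
    then have lt: "size ?B < size B" using sB by simp
    \<comment> \<open>The open disc of \<open>c\<close> is counted and taken away. The discs around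
      the remaining elements are disjoint from it, so they lose nothing and the hypothesis passes to
      the rest.\<close>
    have "size ?B \<le> size ?A"
    proof (rule less.hyps[OF lt])
      fix d assume d: "d \<in># ?B"
      have far: "\<not> ?P b" if "v (b - d) < D" for b
        using v_diff_triangle[of d c b] v_minus_commute[of d b] d that by auto
      have *: "filter_mset (\<lambda>b. v (b - d) < D) (filter_mset (\<lambda>b. \<not> ?P b) M) =
          filter_mset (\<lambda>b. v (b - d) < D) M" for M
        using far by (auto simp: filter_filter_mset intro!: filter_mset_cong)
      show "size (filter_mset (\<lambda>b. v (b - d) < D) ?B) \<le> size (filter_mset (\<lambda>b. v (b - d) < D) ?A)"
        unfolding * using d by (intro less.prems) simp
    qed
    then show ?thesis using sA sB less.prems[OF c] by linarith
  qed simp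
qed


text \<open>All roots are farther from \<open>y\<close> than \<open>c\<close> is, so their distances
  to \<open>y\<close> and to \<open>c\<close> coincide, and the roots cannot tell \<open>y\<close>
  from the disc around \<open>c\<close>.\<close>

lemma line_eq_of_roots:
  assumes y: "y \<in> line_points v" and c: "y [:-c, 1:] = t" and t: "\<And>b. b \<in># A \<Longrightarrow> t < y [:-b, 1:]"
  shows "zeta c t (Polynomial.smult k (\<Prod>b\<in>#A. [:-b, 1:])) = y (Polynomial.smult k (\<Prod>b\<in>#A. [:-b, 1:]))"
proof -
  have t0: "0 \<le> t" using c line_nonneg[OF y] by blast
  have "max (v (b - c)) t = y [:-b, 1:]" if "b \<in># A" for b
    using line_linear_triangle[OF y, of b c] line_linear_triangle2[OF y, of b c] t[OF that] c by simp
  then have "(\<Prod>b\<in>#A. max (v (b - c)) t) = (\<Prod>b\<in>#A. y [:-b, 1:])"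
    by (intro arg_cong[where f = prod_mset] image_mset_cong)
  then show ?thesis by (simp only: zeta_factors[OF t0] line_factors[OF y])
qed

text \<open>The diameter of a point is the infimum of its distances \<open>y [:-c, 1:]\<close>. That
  it is at least \<open>s\<close> is a closed condition, so the supremum \<open>D\<close> over the
  compact set \<open>K\<close> is attained by the finite intersection property. The bound
  \<open>r\<close>, used with centre 0, keeps \<open>D\<close> finite.\<close>

lemma maximal_diameter:
  assumes K: "compact K" "K \<noteq> {}" "K \<subseteq> line_points v" and bd: "\<And>y. y \<in> K \<Longrightarrow> y [:0, 1:] \<le> r"
  obtains y D where "y \<in> K" "\<And>c. D \<le> y [:-c, 1:]" "0 \<le> D"
    "\<And>z t. z \<in> K \<Longrightarrow> D < t \<Longrightarrow> \<exists>c. z [:-c, 1:] < t"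
proof -
  define S where "S = {s. \<exists>y\<in>K. \<forall>c. s \<le> y [:-c, 1:]}"
  have S0: "0 \<in> S" using K line_nonneg unfolding S_def by blast
  have ub: "s \<le> r" if s: "s \<in> S" for s
  proof -
    obtain y where y: "y \<in> K" "\<And>c. s \<le> y [:-c, 1:]" using s unfolding S_def by blast
    then show ?thesis using bd[OF y(1)] y(2)[of 0] by simp
  qed
  then have bdd: "bdd_above S" by (rule bdd_aboveI)
  define D where "D = Sup S"
  define F where "F = {{y :: 'k poly \<Rightarrow> real. s \<le> y [:-c, 1:]} | s c. s < D}"
  have cl: "closed {y :: 'k poly \<Rightarrow> real. s \<le> y h}" for s h
    by (intro closed_Collect_le continuous_intros continuous_on_product_coordinates)
  have "K \<inter> \<Inter>F \<noteq> {}"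
  proof (rule compact_imp_fip[OF K(1)])
    fix T assume "T \<in> F" then show "closed T" using cl unfolding F_def by blast
  next
    fix F' assume F': "finite F'" "F' \<subseteq> F"
    then have "\<forall>T\<in>F'. \<exists>s. s < D \<and> (\<exists>c. T = {y. s \<le> y [:-c, 1:]})" unfolding F_def by blast
    then obtain s where s: "\<And>T. T \<in> F' \<Longrightarrow> s T < D \<and> (\<exists>c. T = {y. s T \<le> y [:-c, 1:]})" by metis
    define m where "m = Max (insert (D - 1) (s ` F'))"
    have "m \<in> insert (D - 1) (s ` F')" unfolding m_def by (rule Max_in) (use F' in auto)
    then have "m < D" using s by auto
    then obtain u where u: "u \<in> S" "m < u" unfolding D_def using less_cSup_iff[OF _ bdd] S0 by blast
    then obtain y where y: "y \<in> K" "\<And>c. u \<le> y [:-c, 1:]" unfolding S_def by blast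
    have "y \<in> T" if T: "T \<in> F'" for T
    proof -
      have "s T \<le> m" unfolding m_def using F' T by (intro Max_ge) auto
      then have "s T \<le> y [:-c, 1:]" for c using u y(2)[of c] by linarith
      then show ?thesis using s[OF T] by auto
    qed
    then show "K \<inter> \<Inter>F' \<noteq> {}" using y by blast
  qed
  then obtain y where y: "y \<in> K" "\<And>T. T \<in> F \<Longrightarrow> y \<in> T" by blast
  have "s \<le> y [:-c, 1:]" if "s < D" for s c
    using y(2)[of "{y. s \<le> y [:-c, 1:]}"] that unfolding F_def by blast
  then have 1: "D \<le> y [:-c, 1:]" for c using dense_ge by (metis dense not_le)
  have 2: "\<exists>c. z [:-c, 1:] < t" if "z \<in> K" "D < t" for z t
  proof (rule ccontr)
    assume "\<not> ?thesis"
    then have "t \<in> S" using that unfolding S_def by (auto simp: not_less)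
    then have "t \<le> D" unfolding D_def using bdd by (rule cSup_upper)
    then show False using that by simp
  qed
  have 3: "0 \<le> D" unfolding D_def using S0 bdd by (rule cSup_upper)
  show ?thesis by (rule that[OF y(1) 1 3 2])
qed

text \<open>
  Take a maximum point \<open>y\<close> of largest diameter \<open>D\<close>. If \<open>y\<close> is not the sup norm of a closed disc, a slightly
  larger disc gives the same value. Otherwise \<open>y = zeta c D\<close>, and either the slope of \<open>F\<close> towards larger
  discs is nonnegative or \<open>F\<close> increases strictly into one of the open discs inside.
\<close>

lemma max_principle:
  assumes F: "loc_rational W F" and W: "W \<subseteq> line_points v"
    and r: "0 < r1" "r1 < r2" "closed_annulus r1 r2 \<subseteq> W"
    and x: "x \<in> closed_annulus r1 r2"
  shows "F x \<le> max (F (zeta 0 r1)) (F (zeta 0 r2))"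
proof -
  let ?E = "closed_annulus r1 r2"
  have zE: "zeta c t \<in> ?E" if "0 \<le> t" "r1 \<le> max (v c) t" "max (v c) t \<le> r2" for c t
    using that by (simp add: closed_annulus_def zeta_in_line)
  have cont: "continuous_on ?E F" by (rule loc_rational_continuous[OF F r(3) W])
  obtain x0 where x0: "x0 \<in> ?E" "\<And>z. z \<in> ?E \<Longrightarrow> F z \<le> F x0"
    using continuous_attains_sup[OF compact_closed_annulus _ cont] x by blast
  define M where "M = F x0"
  have M: "F z \<le> M" if "z \<in> ?E" for z using x0 that by (simp add: M_def)
  define K where "K = {y \<in> ?E. F y = M}"
  have "closedin (top_of_set ?E) K" unfolding K_def by (rule continuous_closedin_preimage_constant[OF cont])
  then have "compact K" using closedin_compact compact_closed_annulus by blast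
  moreover have "K \<noteq> {}" using x0 by (auto simp: K_def M_def)
  moreover have "K \<subseteq> line_points v" by (auto simp: K_def closed_annulus_def)
  moreover have "y [:0, 1:] \<le> r2" if "y \<in> K" for y using that by (auto simp: K_def closed_annulus_def)
  ultimately obtain y D where y: "y \<in> K" "\<And>c. D \<le> y [:-c, 1:]" "0 \<le> D"
    and D: "\<And>z t. z \<in> K \<Longrightarrow> D < t \<Longrightarrow> \<exists>c. z [:-c, 1:] < t"
    using maximal_diameter[of K r2] by metis
  have zK: "zeta c t \<notin> K" if "D < t" for c t
    using D[of "zeta c t" t] that y(3) by auto
  have yE: "y \<in> ?E" "F y = M" using y(1) by (auto simp: K_def)
  then have yl: "y \<in> line_points v" and yT: "r1 \<le> y [:0, 1:]" "y [:0, 1:] \<le> r2" by (auto simp: closed_annulus_def)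
  obtain N f g where N: "openin (top_of_set (line_points v)) N" "y \<in> N" "N \<subseteq> W"
    and q: "\<And>z. z \<in> N \<Longrightarrow> z f \<noteq> 0 \<and> z g \<noteq> 0 \<and> F z = z f / z g"
    using loc_rationalE[OF F subsetD[OF r(3) yE(1)]] by metis
  have "y = zeta 0 r1 \<or> y = zeta 0 r2"
  proof (rule ccontr)
    assume ny: "\<not> ?thesis"
    show False
    proof (cases "\<exists>c. y [:-c, 1:] = D")
      case False
      then have yD: "D < y [:-c, 1:]" for c using y(2)[of c] by (metis less_le)
      obtain J where J: "finite J" "\<And>z. z \<in> line_points v \<Longrightarrow> (\<And>h. h \<in> J \<Longrightarrow> z h = y h) \<Longrightarrow> z \<in> N"
        using openin_line_finite_determined[OF N(1,2)] by metis
      have "\<forall>h :: 'k poly. \<exists>k A. h = Polynomial.smult k (\<Prod>b\<in>#A. [:-b, 1:])" using obtain_factors by metis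
      then obtain k A where kA: "\<And>h :: 'k poly. h = Polynomial.smult (k h) (\<Prod>b\<in>#A h. [:-b, 1:])" by metis
      define J' where "J' = insert f (insert g (insert [:0, 1:] J))"
      \<comment> \<open>The distances from \<open>y\<close> to the roots of \<open>f\<close>,
        \<open>g\<close>, \<open>T\<close> and the polynomials in \<open>J\<close>. As
        \<open>D\<close> is not attained, some disc has radius above \<open>D\<close> and below all
        these distances. Replacing \<open>y\<close> by it changes none of the relevant values, which
        contradicts the maximality of \<open>D\<close>.\<close>
      define R where "R = (\<lambda>b. y [:-b, 1:]) ` (\<Union>h\<in>J'. set_mset (A h))"
      have fR: "finite R" unfolding R_def J'_def using J(1) by auto
      define m where "m = Min (insert (D + 1) R)"
      have "m \<in> insert (D + 1) R" unfolding m_def by (rule Min_in) (use fR in auto)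
      then have "D < m" using yD by (auto simp: R_def)
      then obtain c where c: "y [:-c, 1:] < m" using D[OF y(1)] by blast
      let ?t = "y [:-c, 1:]"
      have eq: "zeta c ?t h = y h" if "h \<in> J'" for h
      proof -
        have "?t < y [:-b, 1:]" if "b \<in># A h" for b
        proof -
          have "m \<le> y [:-b, 1:]" unfolding m_def using fR that \<open>h \<in> J'\<close>
            by (intro Min_le) (auto simp: R_def)
          then show ?thesis using c by simp
        qed
        then show ?thesis using line_eq_of_roots[OF yl refl, of "A h" c "k h"] kA[of h] by metis
      qed
      have zl: "zeta c ?t \<in> line_points v" using zeta_in_line line_nonneg[OF yl] by blast
      have zN: "zeta c ?t \<in> N" by (rule J(2)[OF zl]) (simp add: eq J'_def)
      have "zeta c ?t \<in> ?E" using eq[of "[:0, 1:]"] zl yT by (simp add: closed_annulus_def J'_def del: zeta_T)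
      moreover have "F (zeta c ?t) = M"
        using q[OF zN] q[OF N(2)] yE(2) eq[of f] eq[of g] by (simp add: J'_def)
      ultimately show False using zK[OF yD] by (simp add: K_def)
    next
      case True
      then obtain c0 where "y [:-c0, 1:] = D" by blast
      then have yz: "y = zeta c0 D" using line_eq_zeta[OF yl] y(2) by blast
      obtain k A where f: "f = Polynomial.smult k (\<Prod>b\<in>#A. [:-b, 1:])" "f \<noteq> 0 \<Longrightarrow> k \<noteq> 0"
        using obtain_factors by blast
      obtain l B where g: "g = Polynomial.smult l (\<Prod>b\<in>#B. [:-b, 1:])" "g \<noteq> 0 \<Longrightarrow> l \<noteq> 0"
        using obtain_factors by blast
      have "f \<noteq> 0" "g \<noteq> 0" using q[OF N(2)] yl by auto
      then have k: "k \<noteq> 0" and l: "l \<noteq> 0" using f g by auto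
      have yT': "y [:0, 1:] = max (v c0) D" using yz y(3) by simp
      have D_less: "D < r2" if "y \<noteq> zeta 0 r2"
      proof (rule ccontr)
        assume "\<not> D < r2"
        then have "D = r2" "v c0 \<le> D" using yT yT' by auto
        then have "zeta c0 D = zeta 0 r2" using zeta_cong[of c0 0 D] by simp
        then show False using that yz by simp
      qed
      let ?P = "\<lambda>b. v (b - c0) \<le> D"
      \<comment> \<open>The roots of numerator and denominator in the closed disc; the difference of
        the two numbers is the slope of \<open>F\<close> towards larger discs.\<close>
      let ?a = "size (filter_mset ?P A)" and ?b = "size (filter_mset ?P B)"
      obtain e1 K1 where e1: "0 < e1" "0 < K1"
        "\<And>t. D \<le> t \<Longrightarrow> t < D + e1 \<Longrightarrow> zeta c0 t f = K1 * t ^ ?a"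
        using zeta_slope_right[OF y(3) k, of c0 A] unfolding f(1)[symmetric] by metis
      obtain e2 K2 where e2: "0 < e2" "0 < K2"
        "\<And>t. D \<le> t \<Longrightarrow> t < D + e2 \<Longrightarrow> zeta c0 t g = K2 * t ^ ?b"
        using zeta_slope_right[OF y(3) l, of c0 B] unfolding g(1)[symmetric] by metis
      have ne: "K1 * D ^ ?a \<noteq> 0" "K2 * D ^ ?b \<noteq> 0"
        using e1(3)[of D] e2(3)[of D] e1(1) e2(1) q[OF N(2)] yz by auto
      have FD: "F y = (K1 * D ^ ?a) / (K2 * D ^ ?b)"
        using e1(3)[of D] e2(3)[of D] e1(1) e2(1) q[OF N(2)] yz by auto
      show False
      proof (cases "?b \<le> ?a")
        case True
        obtain e3 where e3: "0 < e3" "\<And>s. 0 \<le> s \<Longrightarrow> \<bar>s - D\<bar> < e3 \<Longrightarrow> zeta c0 s \<in> N"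
          using zeta_near[OF N(1)] N(2) y(3) yz by metis
        \<comment> \<open>The bound \<open>r2 - D\<close> keeps the larger disc in the annulus. The
          halved bounds keep it in \<open>N\<close> and in the range of both slope formulas.\<close>
        define t where "t = D + min (min (e1 / 2) (e2 / 2)) (min (e3 / 2) (r2 - D))"
        have "D < t" "t \<le> D + e1 / 2" "t \<le> D + e2 / 2" "t \<le> D + e3 / 2" "t \<le> r2"
          using e1(1) e2(1) e3(1) D_less ny unfolding t_def by linarith+
        then have t: "D < t" "t < D + e1" "t < D + e2" "t < D + e3" "t \<le> r2" "0 < t"
          using e1(1) e2(1) e3(1) y(3) by auto
        have zN: "zeta c0 t \<in> N" using e3(2)[of t] t y(3) by auto
        have zE': "zeta c0 t \<in> ?E" using t yT yT' by (intro zE) auto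
        have Ft: "F (zeta c0 t) = (K1 * t ^ ?a) / (K2 * t ^ ?b)"
          using q[OF zN] e1(3)[of t] e2(3)[of t] t by auto
        have pw: "s ^ ?a = s ^ ?b * s ^ (?a - ?b)" for s :: real
          using True by (simp flip: power_add)
        have cancel: "(K1 * (u * w)) / (K2 * u) = K1 / K2 * w" if "u \<noteq> 0" for u w :: real
          using that by simp
        have "D ^ ?b \<noteq> 0" using ne(2) by (simp only: mult_eq_0_iff) blast
        then have "F y = K1 / K2 * D ^ (?a - ?b)"
          unfolding FD pw[of D] by (rule cancel)
        also have "\<dots> \<le> K1 / K2 * t ^ (?a - ?b)"
          using t y(3) e1(2) e2(2) by (intro mult_left_mono power_mono) auto
        also have "\<dots> = F (zeta c0 t)"
          unfolding Ft pw[of t] using t by (simp add: field_simps)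
        finally have "zeta c0 t \<in> K" using M[OF zE'] yE(2) zE' by (simp add: K_def)
        then show False using zK t(1) by blast
      next
        case False
        have Dpos: "0 < D"
        proof (rule ccontr)
          assume "\<not> 0 < D"
          then have "D = 0" using y(3) by simp
          moreover have "0 < ?b" using False by linarith
          ultimately have "D ^ ?b = 0" by (simp only: zero_power)
          then show False using ne(2) by (simp only: mult_zero_right)
        qed
        \<comment> \<open>If \<open>f\<close> had at least as many roots as \<open>g\<close> in
          every open disc of radius \<open>D\<close> inside the closed one, summing would give
          \<open>?b \<le> ?a\<close>. So \<open>g\<close> has more roots in one of them, and
          \<open>F\<close> grows when the radius shrinks there.\<close>
        have "\<exists>c1. v (c1 - c0) \<le> D \<and>
          size (filter_mset (\<lambda>b. v (b - c1) < D) A) < size (filter_mset (\<lambda>b. v (b - c1) < D) B)"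
        proof (rule ccontr)
          assume *: "\<not> ?thesis"
          have "?b \<le> ?a"
          proof (rule size_le_residue_classes[OF _ Dpos])
            fix c assume c: "c \<in># filter_mset ?P B"
            have "?P b" if "v (b - c) < D" for b
              using v_diff_triangle[of b c0 c] that c by auto
            then have **: "filter_mset (\<lambda>b. v (b - c) < D) (filter_mset ?P U) = filter_mset (\<lambda>b. v (b - c) < D) U" for U
              by (auto simp: filter_filter_mset intro!: filter_mset_cong)
            show "size (filter_mset (\<lambda>b. v (b - c) < D) (filter_mset ?P B))
              \<le> size (filter_mset (\<lambda>b. v (b - c) < D) (filter_mset ?P A))"
              unfolding ** using * c by (auto simp: not_less)
          qed
          then show False using False by simp
        qed
        then obtain c1 where c1: "v (c1 - c0) \<le> D"
          "size (filter_mset (\<lambda>b. v (b - c1) < D) A) < size (filter_mset (\<lambda>b. v (b - c1) < D) B)" by blast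
        let ?a1 = "size (filter_mset (\<lambda>b. v (b - c1) < D) A)" and ?b1 = "size (filter_mset (\<lambda>b. v (b - c1) < D) B)"
        have yz1: "y = zeta c1 D" using zeta_cong[OF c1(1)] yz by simp
        then have yT1: "y [:0, 1:] = max (v c1) D" using y(3) by simp
        have low: "r1 \<le> v c1 \<or> r1 < D"
        proof (rule ccontr)
          assume *: "\<not> ?thesis"
          then have "D = r1" "v c1 \<le> D" using yT yT1 by auto
          then have "zeta c1 D = zeta 0 r1" using zeta_cong[of c1 0 D] by simp
          then show False using ny yz1 by simp
        qed
        obtain e1 K1 where e1: "0 < e1" "0 < K1"
          "\<And>t. 0 \<le> t \<Longrightarrow> D - e1 < t \<Longrightarrow> t \<le> D \<Longrightarrow> zeta c1 t f = K1 * t ^ ?a1"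
          using zeta_slope_left[OF Dpos k, of c1 A] unfolding f(1)[symmetric] by metis
        obtain e2 K2 where e2: "0 < e2" "0 < K2"
          "\<And>t. 0 \<le> t \<Longrightarrow> D - e2 < t \<Longrightarrow> t \<le> D \<Longrightarrow> zeta c1 t g = K2 * t ^ ?b1"
          using zeta_slope_left[OF Dpos l, of c1 B] unfolding g(1)[symmetric] by metis
        obtain e3 where e3: "0 < e3" "\<And>s. 0 \<le> s \<Longrightarrow> \<bar>s - D\<bar> < e3 \<Longrightarrow> zeta c1 s \<in> N"
          using zeta_near[OF N(1)] N(2) y(3) yz1 by metis
        \<comment> \<open>Shrinking must keep |T| at least \<open>r1\<close>. If
          \<open>r1 < D\<close>, the radius itself stays at or above \<open>r1\<close>. Otherwise
          \<open>low\<close> gives \<open>r1 \<le> v c1\<close>, and every positive radius will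
          do.\<close>
        define r where "r = (if r1 < D then r1 else 0)"
        have "r < D" using Dpos by (simp add: r_def)
        define t where "t = max (max (D - e1 / 2) (D - e2 / 2)) (max (max (D - e3 / 2) (D / 2)) r)"
        have "D - e1 / 2 \<le> t" "D - e2 / 2 \<le> t" "D - e3 / 2 \<le> t" "D / 2 \<le> t" "r \<le> t" "t < D"
          using e1(1) e2(1) e3(1) Dpos \<open>r < D\<close> unfolding t_def by linarith+
        then have t: "D - e1 < t" "D - e2 < t" "D - e3 < t" "0 < t" "t < D" "r \<le> t"
          using e1(1) e2(1) e3(1) Dpos by auto
        have zN: "zeta c1 t \<in> N" using e3(2)[of t] t by auto
        have zE': "zeta c1 t \<in> ?E" using t yT yT1 low by (intro zE) (auto simp: r_def)
        have FD: "F y = (K1 * D ^ ?a1) / (K2 * D ^ ?b1)"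
          using e1(3)[of D] e2(3)[of D] e1(1) e2(1) q[OF N(2)] yz1 Dpos by auto
        have Ft: "F (zeta c1 t) = (K1 * t ^ ?a1) / (K2 * t ^ ?b1)"
          using q[OF zN] e1(3)[of t] e2(3)[of t] t by auto
        have pw: "s ^ ?b1 = s ^ ?a1 * s ^ (?b1 - ?a1)" for s :: real
          using c1(2) by (simp flip: power_add)
        have "F y = K1 / K2 / D ^ (?b1 - ?a1)"
          unfolding FD pw[of D] using Dpos by (simp add: field_simps)
        also have "\<dots> < K1 / K2 / t ^ (?b1 - ?a1)"
          using t c1(2) e1(2) e2(2) Dpos by (intro divide_strict_left_mono power_strict_mono) auto
        also have "\<dots> = F (zeta c1 t)"
          unfolding Ft pw[of t] using t by (simp add: field_simps)
        finally show False using M[OF zE'] yE(2) by simp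
      qed
    qed
  qed
  then show ?thesis using M[OF x] yE(2) by auto
qed


section \<open>Invertible functions on annuli are monomials in absolute value\<close>

lemma line_power: "y \<in> line_points v \<Longrightarrow> y (f ^ n) = y f ^ n"
  by (induction n) (simp_all add: line_mult)

lemma std_annulus_subset_line: "std_annulus v a b \<subseteq> line_points v"
  by (auto simp: std_annulus_def)

text \<open>Two exponents \<open>m\<close> and \<open>n\<close> are used because the integral power
  of |T| needed later may be negative.\<close>

lemma loc_rational_monomial:
  assumes F: "loc_rational (std_annulus v a b) F" and a: "0 \<le> a"
  shows "loc_rational (std_annulus v a b) (\<lambda>y. F y ^ k * y [:0, 1:] ^ m / y [:0, 1:] ^ n)"
  unfolding loc_rational_def
proof
  fix y assume y: "y \<in> std_annulus v a b"
  obtain N f g where N: "openin (top_of_set (line_points v)) N" "y \<in> N" "N \<subseteq> std_annulus v a b"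
    "\<And>z. z \<in> N \<Longrightarrow> z f \<noteq> 0 \<and> z g \<noteq> 0 \<and> F z = z f / z g"
    using loc_rationalE[OF F y] by metis
  let ?f = "f ^ k * [:0, 1:] ^ m" and ?g = "g ^ k * [:0, 1:] ^ n"
  have "z ?f \<noteq> 0 \<and> z ?g \<noteq> 0 \<and> F z ^ k * z [:0, 1:] ^ m / z [:0, 1:] ^ n = z ?f / z ?g" if z: "z \<in> N" for z
  proof -
    have zl: "z \<in> line_points v" and "a < z [:0, 1:]" using N(3) z by (auto simp: std_annulus_def)
    then have "z [:0, 1:] \<noteq> 0" using a by simp
    then show ?thesis using N(4)[OF z] zl by (simp add: line_mult line_power power_divide)
  qed
  then show "\<exists>N f g. openin (top_of_set (line_points v)) N \<and> y \<in> N \<and> N \<subseteq> std_annulus v a b \<and>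
     (\<forall>z\<in>N. z f \<noteq> 0 \<and> z g \<noteq> 0 \<and> F z ^ k * z [:0, 1:] ^ m / z [:0, 1:] ^ n = z f / z g)"
    using N(1-3) by blast
qed

lemma loc_rational_inverse:
  assumes F: "loc_rational W F"
  shows "loc_rational W (\<lambda>y. inverse (F y))"
  unfolding loc_rational_def
proof
  fix y assume y: "y \<in> W"
  obtain N f g where N: "openin (top_of_set (line_points v)) N" "y \<in> N" "N \<subseteq> W"
    "\<And>z. z \<in> N \<Longrightarrow> z f \<noteq> 0 \<and> z g \<noteq> 0 \<and> F z = z f / z g"
    using loc_rationalE[OF F y] by metis
  have "\<forall>z\<in>N. z g \<noteq> 0 \<and> z f \<noteq> 0 \<and> inverse (F z) = z g / z f" using N(4) by simp
  then show "\<exists>N f g. openin (top_of_set (line_points v)) N \<and> y \<in> N \<and> N \<subseteq> W \<and>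
     (\<forall>z\<in>N. z f \<noteq> 0 \<and> z g \<noteq> 0 \<and> inverse (F z) = z f / z g)"
    using N(1-3) by blast
qed

text \<open>For a rational slope \<beta> = j / k this is the logarithm of the maximum principle for
  F^k |T|^j, divided by k. Both sides are continuous in \<beta>, so the rational slopes
  suffice.\<close>

lemma log_max_principle:
  assumes F: "loc_rational (std_annulus v a b) F" and a: "0 \<le> a"
    and r: "a < r1" "r1 < r2" "r2 < b" and x: "x \<in> closed_annulus r1 r2"
  shows "ln (F x) + \<beta> * ln (x [:0, 1:]) \<le>
    max (ln (F (zeta 0 r1)) + \<beta> * ln r1) (ln (F (zeta 0 r2)) + \<beta> * ln r2)"
proof -
  let ?W = "std_annulus v a b"
  let ?h = "\<lambda>\<beta>. max (ln (F (zeta 0 r1)) + \<beta> * ln r1) (ln (F (zeta 0 r2)) + \<beta> * ln r2)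
      - (ln (F x) + \<beta> * ln (x [:0, 1:]))"
  have EW: "closed_annulus r1 r2 \<subseteq> ?W" using r by (auto simp: closed_annulus_def std_annulus_def)
  have z: "zeta 0 r1 \<in> ?W" "zeta 0 r2 \<in> ?W" using r a by (auto simp: std_annulus_def zeta_in_line)
  have xW: "x \<in> ?W" using x EW by blast
  have rat: "0 \<le> ?h \<beta>" if \<beta>: "\<beta> \<in> \<rat>" for \<beta>
  proof -
    obtain j i :: int where i: "0 < i" "\<beta> = real_of_int j / real_of_int i"
      using \<beta> by (rule Rats_cases')
    define k where "k = nat i"
    have k: "0 < k" and \<beta>: "\<beta> = real_of_int j / real k" using i by (auto simp: k_def)
    define m where "m = nat j"
    define n where "n = nat (- j)"
    have j: "real_of_int j = real m - real n" by (auto simp: m_def n_def)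
    define H where "H = (\<lambda>y. F y ^ k * y [:0, 1:] ^ m / y [:0, 1:] ^ n)"
    have H: "loc_rational ?W H" unfolding H_def by (rule loc_rational_monomial[OF F a])
    have lnH: "ln (H y) = real k * (ln (F y) + \<beta> * ln (y [:0, 1:]))" if y: "y \<in> ?W" for y
    proof -
      have T: "0 < y [:0, 1:]" using y a by (auto simp: std_annulus_def)
      have "ln (H y) = real k * ln (F y) + (real m * ln (y [:0, 1:]) - real n * ln (y [:0, 1:]))"
        unfolding H_def using loc_rational_pos[OF F y] T
        by (simp add: ln_mult ln_div ln_realpow)
      also have "\<dots> = real k * ln (F y) + real_of_int j * ln (y [:0, 1:])" unfolding j by (simp add: algebra_simps)
      also have "\<dots> = real k * (ln (F y) + \<beta> * ln (y [:0, 1:]))" using k by (simp add: \<beta> field_simps)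
      finally show ?thesis .
    qed
    have "H x \<le> max (H (zeta 0 r1)) (H (zeta 0 r2))"
      by (rule max_principle[OF H std_annulus_subset_line _ r(2) EW x]) (use a r in simp)
    moreover have "0 < H x" "0 < H (zeta 0 r1)" "0 < H (zeta 0 r2)" using loc_rational_pos[OF H] z xW by auto
    ultimately have "ln (H x) \<le> max (ln (H (zeta 0 r1))) (ln (H (zeta 0 r2)))"
      unfolding le_max_iff_disj by (simp add: ln_le_cancel_iff)
    then have "real k * (ln (F x) + \<beta> * ln (x [:0, 1:])) \<le>
       max (real k * (ln (F (zeta 0 r1)) + \<beta> * ln r1)) (real k * (ln (F (zeta 0 r2)) + \<beta> * ln r2))"
      using lnH[OF xW] lnH[OF z(1)] lnH[OF z(2)] r a by simp
    then show ?thesis using k unfolding le_max_iff_disj by (auto simp: le_max_iff_disj)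
  qed
  have "continuous_on (closure \<rat>) ?h" by (intro continuous_intros)
  then have "0 \<le> ?h \<beta>"
    by (rule continuous_ge_on_closure[of "\<rat>"]) (use rat in \<open>auto simp: Rats_closure_real\<close>)
  then show ?thesis by simp
qed

text \<open>\<open>B\<close> is the slope for which ln F - B ln |T| has the same value at both
  boundary radii. The maximum principle for \<open>F\<close> bounds the expression from above by
  this common value, and the one for \<open>1 / F\<close> bounds it from below.\<close>

lemma log_linear:
  assumes F: "loc_rational (std_annulus v a b) F" and a: "0 \<le> a"
    and r: "a < r1" "r1 < r2" "r2 < b"
  obtains A B where "\<And>x. x \<in> closed_annulus r1 r2 \<Longrightarrow> ln (F x) = A + B * ln (x [:0, 1:])"
proof -
  let ?F1 = "ln (F (zeta 0 r1))" and ?F2 = "ln (F (zeta 0 r2))"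
  define B where "B = (?F2 - ?F1) / (ln r2 - ln r1)"
  have l: "ln r1 < ln r2" using r a by simp
  have B: "?F1 - B * ln r1 = ?F2 - B * ln r2"
  proof -
    have "B * (ln r2 - ln r1) = ?F2 - ?F1" using l by (simp add: B_def)
    then show ?thesis by (simp add: algebra_simps)
  qed
  show ?thesis
  proof (rule that[of "?F1 - B * ln r1" B])
    fix x assume x: "x \<in> closed_annulus r1 r2"
    have z: "zeta 0 r1 \<in> std_annulus v a b" "zeta 0 r2 \<in> std_annulus v a b" "x \<in> std_annulus v a b"
      using r a x by (auto simp: std_annulus_def zeta_in_line closed_annulus_def)
    have "ln (F x) + (- B) * ln (x [:0, 1:]) \<le> max (?F1 + (- B) * ln r1) (?F2 + (- B) * ln r2)"
      by (rule log_max_principle[OF F a r x])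
    moreover have "ln (inverse (F x)) + B * ln (x [:0, 1:]) \<le>
        max (ln (inverse (F (zeta 0 r1))) + B * ln r1) (ln (inverse (F (zeta 0 r2))) + B * ln r2)"
      by (rule log_max_principle[OF loc_rational_inverse[OF F] a r x])
    ultimately show "ln (F x) = ?F1 - B * ln r1 + B * ln (x [:0, 1:])"
      using B loc_rational_pos[OF F] z by (simp add: ln_inverse)
  qed
qed

text \<open>Each closed subannulus has its own constants from \<open>log_linear\<close>. Those of
  the subannuli containing the fixed one between \<open>s1\<close> and \<open>s2\<close> agree,
  because the values at two different radii determine intercept and slope.\<close>

lemma annulus_monomial:
  assumes F: "loc_rational (std_annulus v a b) F" and a: "0 \<le> a"
  obtains C \<alpha> where "0 < C" "\<And>y. y \<in> std_annulus v a b \<Longrightarrow> F y = C * y [:0, 1:] powr \<alpha>"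
proof (cases "a < b")
  case True
  obtain s1 where s1: "a < s1" "s1 < b" using dense True by blast
  obtain s2 where s2: "s1 < s2" "s2 < b" using dense s1 by blast
  obtain A B where AB: "\<And>x. x \<in> closed_annulus s1 s2 \<Longrightarrow> ln (F x) = A + B * ln (x [:0, 1:])"
    using log_linear[OF F a s1(1) s2] by metis
  show ?thesis
  proof (rule that[of "exp A" B])
    fix y assume y: "y \<in> std_annulus v a b"
    then have yT: "a < y [:0, 1:]" "y [:0, 1:] < b" by (auto simp: std_annulus_def)
    define r1 where "r1 = min s1 (y [:0, 1:])"
    define r2 where "r2 = max s2 (y [:0, 1:])"
    have r: "a < r1" "r1 < r2" "r2 < b" using s1 s2 yT by (auto simp: r1_def r2_def)
    obtain A' B' where AB': "\<And>x. x \<in> closed_annulus r1 r2 \<Longrightarrow> ln (F x) = A' + B' * ln (x [:0, 1:])"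
      using log_linear[OF F a r] by metis
    have z: "zeta 0 s1 \<in> closed_annulus s1 s2" "zeta 0 s2 \<in> closed_annulus s1 s2"
      "zeta 0 s1 \<in> closed_annulus r1 r2" "zeta 0 s2 \<in> closed_annulus r1 r2" "y \<in> closed_annulus r1 r2"
      using s1 s2 a y by (auto simp: closed_annulus_def zeta_in_line r1_def r2_def std_annulus_def)
    have "A + B * ln s1 = A' + B' * ln s1" "A + B * ln s2 = A' + B' * ln s2"
      using AB[OF z(1)] AB[OF z(2)] AB'[OF z(3)] AB'[OF z(4)] s1 s2 a by auto
    then have "(B - B') * (ln s2 - ln s1) = 0" "A + B * ln s1 = A' + B' * ln s1" by (auto simp: algebra_simps)
    moreover have "ln s1 < ln s2" using s1 s2 a by simp
    ultimately have "B = B'" "A = A'" by auto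
    then have "ln (F y) = A + B * ln (y [:0, 1:])" using AB'[OF z(5)] by simp
    then have "F y = exp (A + B * ln (y [:0, 1:]))" using loc_rational_pos[OF F y] by (metis exp_ln)
    then show "F y = exp A * y [:0, 1:] powr B" using yT a by (simp add: powr_def exp_add mult.commute)
  qed simp
next
  case False
  then show ?thesis using that[of 1] by (auto simp: std_annulus_def)
qed

end


section \<open>Completed residue fields and analytic functions\<close>

text \<open>One framework for two kinds of space: \<open>H d\<close> is the set of forms of degree
  \<open>d\<close> for a projective variety, and the set of all polynomials, in every degree, for
  the affine line. The seminorm laws are asked of forms only, the ultrametric one within a single
  degree, because normalized projective points are set to 0 on inhomogeneous polynomials.\<close>

locale graded_berk_space =
  fixes S :: "('a::comm_ring_1, 'k) berk_space" and H :: "nat \<Rightarrow> 'a set"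
  assumes fractions_eq: "fractions S = (\<Union>d. H d \<times> H d)"
    and zero_mem [simp]: "0 \<in> H d" and one_mem [simp]: "1 \<in> H 0"
    and add_mem: "f \<in> H d \<Longrightarrow> g \<in> H d \<Longrightarrow> f + g \<in> H d"
    and uminus_mem: "f \<in> H d \<Longrightarrow> - f \<in> H d"
    and mult_mem: "f \<in> H d \<Longrightarrow> g \<in> H e \<Longrightarrow> f * g \<in> H (d + e)"
    and point_nonneg: "x \<in> points S \<Longrightarrow> 0 \<le> x f"
    and point_0: "x \<in> points S \<Longrightarrow> x 0 = 0"
    and point_1: "x \<in> points S \<Longrightarrow> x 1 = 1"
    and point_mult: "x \<in> points S \<Longrightarrow> f \<in> H d \<Longrightarrow> g \<in> H e \<Longrightarrow> x (f * g) = x f * x g"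
    and point_add: "x \<in> points S \<Longrightarrow> f \<in> H d \<Longrightarrow> g \<in> H d \<Longrightarrow> x (f + g) \<le> max (x f) (x g)"
begin

lemma diff_mem: "f \<in> H d \<Longrightarrow> g \<in> H d \<Longrightarrow> f - g \<in> H d"
  using add_mem[of f d "- g"] uminus_mem by simp

lemma point_uminus:
  assumes x: "x \<in> points S" and f: "f \<in> H d"
  shows "x (- f) = x f"
proof -
  have m: "- 1 \<in> H 0" using uminus_mem one_mem by blast
  have "x (- 1) * x (- 1) = 1" using point_mult[OF x m m] point_1[OF x] by simp
  then have "x (- 1) = 1" using point_nonneg[OF x, of "- 1"] by (simp add: square_eq_1_iff)
  then show ?thesis using point_mult[OF x m f] by simp
qed

section \<open>Ultrametric arithmetic of fractions at a point\<close>

definition fracs_at :: "('a \<Rightarrow> real) \<Rightarrow> ('a \<times> 'a) set" where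
  "fracs_at x = {q \<in> fractions S. x (snd q) \<noteq> 0}"

definition fneg :: "'a \<times> 'a \<Rightarrow> 'a \<times> 'a" where
  "fneg q = (- fst q, snd q)"

lemma fracs_atE:
  assumes "q \<in> fracs_at x"
  obtains d a b where "q = (a, b)" "a \<in> H d" "b \<in> H d" "x b \<noteq> 0"
  using assms by (auto simp: fracs_at_def fractions_eq)

lemma fracs_atI: "a \<in> H d \<Longrightarrow> b \<in> H d \<Longrightarrow> x b \<noteq> 0 \<Longrightarrow> (a, b) \<in> fracs_at x"
  by (auto simp: fracs_at_def fractions_eq)

context
  fixes x assumes x: "x \<in> points S"
begin

lemma zero_frac: "(0, 1) \<in> fracs_at x"
  using point_1[OF x] by (auto intro!: fracs_atI[of _ 0])

lemma fneg_frac: "q \<in> fracs_at x \<Longrightarrow> fneg q \<in> fracs_at x"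
  by (auto elim!: fracs_atE simp: fneg_def intro!: fracs_atI uminus_mem)

lemma fadd_frac:
  assumes "p \<in> fracs_at x" "q \<in> fracs_at x"
  shows "fadd p q \<in> fracs_at x"
proof -
  obtain d a b where p: "p = (a, b)" "a \<in> H d" "b \<in> H d" "x b \<noteq> 0" using assms(1) by (rule fracs_atE)
  obtain e a' b' where q: "q = (a', b')" "a' \<in> H e" "b' \<in> H e" "x b' \<noteq> 0" using assms(2) by (rule fracs_atE)
  have "a * b' + a' * b \<in> H (d + e)" "b * b' \<in> H (d + e)"
    using mult_mem p q by (auto intro!: add_mem) (metis mult.commute mult_mem)
  then show ?thesis using p q point_mult[OF x p(3) q(3)] by (auto simp: fadd_def intro!: fracs_atI)
qed

lemma fdiff_eq: "fdiff p q = fadd p (fneg q)"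
  by (simp add: fdiff_def fadd_def fneg_def)

lemma fdiff_frac: "p \<in> fracs_at x \<Longrightarrow> q \<in> fracs_at x \<Longrightarrow> fdiff p q \<in> fracs_at x"
  unfolding fdiff_eq by (intro fadd_frac fneg_frac)

lemma fnorm_nonneg: "0 \<le> fnorm x q"
  by (simp add: fnorm_def point_nonneg[OF x])

lemma fnorm_fneg: "q \<in> fracs_at x \<Longrightarrow> fnorm x (fneg q) = fnorm x q"
  by (auto elim!: fracs_atE simp: fneg_def fnorm_def point_uminus[OF x])

lemma fnorm_fadd:
  assumes "p \<in> fracs_at x" "q \<in> fracs_at x"
  shows "fnorm x (fadd p q) \<le> max (fnorm x p) (fnorm x q)"
proof -
  obtain d a b where p: "p = (a, b)" "a \<in> H d" "b \<in> H d" "x b \<noteq> 0" using assms(1) by (rule fracs_atE)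
  obtain e a' b' where q: "q = (a', b')" "a' \<in> H e" "b' \<in> H e" "x b' \<noteq> 0" using assms(2) by (rule fracs_atE)
  have pos: "0 < x b" "0 < x b'" using p q point_nonneg[OF x] by (auto simp: less_le)
  have "a' * b \<in> H (d + e)" by (metis add.commute mult_mem p(3) q(2))
  then have "x (a * b' + a' * b) \<le> max (x (a * b')) (x (a' * b))"
    using mult_mem[OF p(2) q(3)] by (intro point_add[OF x])
  also have "\<dots> = max (x a * x b') (x a' * x b)"
    by (simp add: point_mult[OF x p(2) q(3)] point_mult[OF x q(2) p(3)])
  finally show ?thesis using pos unfolding p(1) q(1)
    unfolding le_max_iff_disj fnorm_def fadd_def fst_conv snd_conv point_mult[OF x p(3) q(3)]
    by (auto simp: field_simps)
qed

text \<open>Pairs are never reduced, so the identities between sums and differences of fractions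
  used below hold only after cross-multiplication.\<close>

lemma fnorm_cong:
  assumes "p \<in> fracs_at x" "q \<in> fracs_at x" "fst p * snd q = fst q * snd p"
  shows "fnorm x p = fnorm x q"
proof -
  obtain d a b where p: "p = (a, b)" "a \<in> H d" "b \<in> H d" "x b \<noteq> 0" using assms(1) by (rule fracs_atE)
  obtain e a' b' where q: "q = (a', b')" "a' \<in> H e" "b' \<in> H e" "x b' \<noteq> 0" using assms(2) by (rule fracs_atE)
  have "x a * x b' = x a' * x b"
    using assms(3) p q point_mult[OF x p(2) q(3)] point_mult[OF x q(2) p(3)] by simp
  then show ?thesis using p q by (simp add: fnorm_def field_simps)
qed

lemma fnorm_fdiff_self [simp]: "fnorm x (fdiff p p) = 0"
  by (simp add: fnorm_def fdiff_def point_0[OF x])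

lemma fnorm_fdiff_commute:
  assumes "p \<in> fracs_at x" "q \<in> fracs_at x"
  shows "fnorm x (fdiff p q) = fnorm x (fdiff q p)"
proof -
  have "fnorm x (fdiff p q) = fnorm x (fneg (fdiff p q))" using fnorm_fneg fdiff_frac assms by metis
  also have "fneg (fdiff p q) = fdiff q p" by (simp add: fneg_def fdiff_def mult.commute)
  finally show ?thesis .
qed

lemma fnorm_fdiff_triangle:
  assumes "p \<in> fracs_at x" "q \<in> fracs_at x" "r \<in> fracs_at x"
  shows "fnorm x (fdiff p r) \<le> max (fnorm x (fdiff p q)) (fnorm x (fdiff q r))"
proof -
  have "fnorm x (fdiff p r) = fnorm x (fadd (fdiff p q) (fdiff q r))"
    using assms by (intro fnorm_cong fadd_frac fdiff_frac) (simp_all add: fdiff_def fadd_def algebra_simps)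
  also have "\<dots> \<le> max (fnorm x (fdiff p q)) (fnorm x (fdiff q r))"
    using assms by (intro fnorm_fadd fdiff_frac)
  finally show ?thesis .
qed

lemma fnorm_fdiff_fadd:
  assumes "p \<in> fracs_at x" "q \<in> fracs_at x" "p' \<in> fracs_at x" "q' \<in> fracs_at x"
  shows "fnorm x (fdiff (fadd p q) (fadd p' q')) \<le> max (fnorm x (fdiff p p')) (fnorm x (fdiff q q'))"
proof -
  have "fnorm x (fdiff (fadd p q) (fadd p' q')) = fnorm x (fadd (fdiff p p') (fdiff q q'))"
    using assms by (intro fnorm_cong fadd_frac fdiff_frac) (simp_all add: fdiff_def fadd_def algebra_simps)
  also have "\<dots> \<le> max (fnorm x (fdiff p p')) (fnorm x (fdiff q q'))"
    using assms by (intro fnorm_fadd fdiff_frac)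
  finally show ?thesis .
qed

lemma fnorm_le_max_fdiff:
  assumes "p \<in> fracs_at x" "q \<in> fracs_at x"
  shows "fnorm x p \<le> max (fnorm x (fdiff p q)) (fnorm x q)"
proof -
  have "fnorm x p = fnorm x (fadd (fdiff p q) q)"
    using assms by (intro fnorm_cong fadd_frac fdiff_frac) (simp_all add: fdiff_def fadd_def algebra_simps)
  also have "\<dots> \<le> max (fnorm x (fdiff p q)) (fnorm x q)"
    using assms by (intro fnorm_fadd fdiff_frac)
  finally show ?thesis .
qed

lemma fnorm_diff_le:
  assumes "p \<in> fracs_at x" "q \<in> fracs_at x"
  shows "\<bar>fnorm x p - fnorm x q\<bar> \<le> fnorm x (fdiff p q)"
  using fnorm_le_max_fdiff[OF assms] fnorm_le_max_fdiff[OF assms(2,1)] fnorm_fdiff_commute[OF assms]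
    fnorm_nonneg[of "fdiff p q"] fnorm_nonneg[of p] fnorm_nonneg[of q] by linarith

section \<open>The completed residue field and its norm\<close>

lemma cauchy_fracs_iff:
  "s \<in> cauchy_fracs S x \<longleftrightarrow> (\<forall>i. s i \<in> fracs_at x) \<and>
     (\<forall>e>0. \<exists>N. \<forall>i\<ge>N. \<forall>j\<ge>N. fnorm x (fdiff (s i) (s j)) < e)"
  by (auto simp: cauchy_fracs_def fracs_at_def)

lemma cauchy_fracsD: "s \<in> cauchy_fracs S x \<Longrightarrow> s i \<in> fracs_at x"
  by (simp add: cauchy_fracs_iff)

lemma const_cauchy: "q \<in> fracs_at x \<Longrightarrow> (\<lambda>_. q) \<in> cauchy_fracs S x"
  by (simp add: cauchy_fracs_iff)

lemma fadd_cauchy: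
  assumes s: "s \<in> cauchy_fracs S x" and t: "t \<in> cauchy_fracs S x"
  shows "(\<lambda>i. fadd (s i) (t i)) \<in> cauchy_fracs S x"
  unfolding cauchy_fracs_iff
proof (intro conjI allI impI)
  show "fadd (s i) (t i) \<in> fracs_at x" for i using s t by (intro fadd_frac cauchy_fracsD)
  fix e :: real assume e: "0 < e"
  obtain M where M: "\<And>i j. i \<ge> M \<Longrightarrow> j \<ge> M \<Longrightarrow> fnorm x (fdiff (s i) (s j)) < e"
    using s e unfolding cauchy_fracs_iff by blast
  obtain N where N: "\<And>i j. i \<ge> N \<Longrightarrow> j \<ge> N \<Longrightarrow> fnorm x (fdiff (t i) (t j)) < e"
    using t e unfolding cauchy_fracs_iff by blast
  show "\<exists>N. \<forall>i\<ge>N. \<forall>j\<ge>N. fnorm x (fdiff (fadd (s i) (t i)) (fadd (s j) (t j))) < e"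
  proof (intro exI[of _ "max M N"] allI impI)
    fix i j assume "max M N \<le> i" "max M N \<le> j"
    then show "fnorm x (fdiff (fadd (s i) (t i)) (fadd (s j) (t j))) < e"
      using M[of i j] N[of i j] fnorm_fdiff_fadd[of "s i" "t i" "s j" "t j"] s t cauchy_fracsD by fastforce
  qed
qed

lemma fneg_cauchy:
  assumes s: "s \<in> cauchy_fracs S x"
  shows "(\<lambda>i. fneg (s i)) \<in> cauchy_fracs S x"
proof -
  have "fdiff (fneg p) (fneg q) = fneg (fdiff p q)" for p q by (simp add: fneg_def fdiff_def)
  then show ?thesis using s
    by (simp add: cauchy_fracs_iff fneg_frac fnorm_fneg fdiff_frac)
qed

lemma null_rel_iff:
  "(s, t) \<in> null_rel S x \<longleftrightarrow> s \<in> cauchy_fracs S x \<and> t \<in> cauchy_fracs S x \<and>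
     (\<lambda>i. fnorm x (fdiff (s i) (t i))) \<longlonglongrightarrow> 0"
  by (simp add: null_rel_def)

lemma tendsto_0_max:
  fixes f g h :: "nat \<Rightarrow> real"
  assumes "f \<longlonglongrightarrow> 0" "g \<longlonglongrightarrow> 0" "\<And>i. 0 \<le> h i" "\<And>i. h i \<le> max (f i) (g i)"
  shows "h \<longlonglongrightarrow> 0"
proof (rule tendsto_sandwich[OF _ _ tendsto_const])
  show "(\<lambda>i. max (f i) (g i)) \<longlonglongrightarrow> 0" using tendsto_max[OF assms(1,2)] by simp
qed (use assms in auto)

lemma equiv_null_rel: "equiv (cauchy_fracs S x) (null_rel S x)"
proof (rule equivI)
  show "null_rel S x \<subseteq> cauchy_fracs S x \<times> cauchy_fracs S x" by (auto simp: null_rel_def)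
  show "refl_on (cauchy_fracs S x) (null_rel S x)"
    by (auto simp: refl_on_def null_rel_iff)
  show "sym (null_rel S x)"
  proof (rule symI)
    fix s t assume "(s, t) \<in> null_rel S x"
    then show "(t, s) \<in> null_rel S x"
      using fnorm_fdiff_commute[of "t _" "s _"] by (simp add: null_rel_iff cauchy_fracsD)
  qed
  show "trans (null_rel S x)"
  proof (rule transI)
    fix s t u assume st: "(s, t) \<in> null_rel S x" and tu: "(t, u) \<in> null_rel S x"
    have "(\<lambda>i. fnorm x (fdiff (s i) (u i))) \<longlonglongrightarrow> 0"
      by (rule tendsto_0_max[of "\<lambda>i. fnorm x (fdiff (s i) (t i))" "\<lambda>i. fnorm x (fdiff (t i) (u i))"])
        (use st tu in \<open>auto simp: null_rel_iff fnorm_nonneg intro!: fnorm_fdiff_triangle dest: cauchy_fracsD\<close>)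
    then show "(s, u) \<in> null_rel S x" using st tu by (simp add: null_rel_iff)
  qed
qed

abbreviation cls :: "(nat \<Rightarrow> 'a \<times> 'a) \<Rightarrow> (nat \<Rightarrow> 'a \<times> 'a) set" where
  "cls s \<equiv> null_rel S x `` {s}"

lemma cls_eq_iff: "s \<in> cauchy_fracs S x \<Longrightarrow> t \<in> cauchy_fracs S x \<Longrightarrow> cls s = cls t \<longleftrightarrow> (s, t) \<in> null_rel S x"
  using eq_equiv_class_iff[OF equiv_null_rel] by blast

lemma cls_carrier [simp]: "s \<in> cauchy_fracs S x \<Longrightarrow> cls s \<in> carrier (hfield S x)"
  by (simp add: hfield_def quotientI)

lemma carrierE:
  assumes "A \<in> carrier (hfield S x)"
  obtains s where "s \<in> cauchy_fracs S x" "A = cls s"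
  using assms by (auto simp: hfield_def elim!: quotientE)

lemma fadd_cong:
  assumes "(s, s') \<in> null_rel S x" "(t, t') \<in> null_rel S x"
  shows "((\<lambda>i. fadd (s i) (t i)), (\<lambda>i. fadd (s' i) (t' i))) \<in> null_rel S x"
proof -
  have "(\<lambda>i. fnorm x (fdiff (fadd (s i) (t i)) (fadd (s' i) (t' i)))) \<longlonglongrightarrow> 0"
    by (rule tendsto_0_max[of "\<lambda>i. fnorm x (fdiff (s i) (s' i))" "\<lambda>i. fnorm x (fdiff (t i) (t' i))"])
      (use assms in \<open>auto simp: null_rel_iff fnorm_nonneg intro!: fnorm_fdiff_fadd dest: cauchy_fracsD\<close>)
  then show ?thesis using assms by (simp add: null_rel_iff fadd_cauchy)
qed

lemma add_cls:
  assumes "s \<in> cauchy_fracs S x" "t \<in> cauchy_fracs S x"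
  shows "cls s \<oplus>\<^bsub>hfield S x\<^esub> cls t = cls (\<lambda>i. fadd (s i) (t i))"
proof -
  have "congruent2 (null_rel S x) (null_rel S x) (\<lambda>s t. cls (\<lambda>i. fadd (s i) (t i)))"
    by (rule congruent2I') (use fadd_cong equiv_class_eq[OF equiv_null_rel] in blast)
  then show ?thesis
    using UN_equiv_class2[OF equiv_null_rel equiv_null_rel _ assms] by (simp add: hfield_def)
qed

lemma zero_cls: "\<zero>\<^bsub>hfield S x\<^esub> = cls (\<lambda>_. (0, 1))"
  by (simp add: hfield_def hfrac_def)

lemma fadd_assoc: "fadd (fadd p q) r = fadd p (fadd q r)"
  and fadd_commute: "fadd p q = fadd q p"
  and fadd_zero: "fadd (0, 1) p = p"
  by (simp_all add: fadd_def algebra_simps)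

lemma fneg_null:
  assumes s: "s \<in> cauchy_fracs S x"
  shows "((\<lambda>i. fadd (fneg (s i)) (s i)), (\<lambda>_. (0, 1))) \<in> null_rel S x"
proof -
  have "fnorm x (fdiff (fadd (fneg p) p) (0, 1)) = 0" for p
    by (simp add: fnorm_def fdiff_def fadd_def fneg_def point_0[OF x])
  then show ?thesis using s by (simp add: null_rel_iff fadd_cauchy fneg_cauchy const_cauchy zero_frac)
qed

text \<open>The approximation condition in \<open>analytic_functions\<close> uses the subtraction of
  this group. Uniqueness of additive inverses is what identifies it with the termwise difference of
  Cauchy sequences.\<close>

lemma abelian_group_hfield: "abelian_group (hfield S x)"
proof (rule abelian_groupI)
  note z = const_cauchy[OF zero_frac]
  show "\<zero>\<^bsub>hfield S x\<^esub> \<in> carrier (hfield S x)" by (simp add: zero_cls z)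
  fix A assume "A \<in> carrier (hfield S x)"
  then obtain s where s: "s \<in> cauchy_fracs S x" "A = cls s" by (rule carrierE)
  show "\<zero>\<^bsub>hfield S x\<^esub> \<oplus>\<^bsub>hfield S x\<^esub> A = A"
    by (simp add: zero_cls s add_cls z fadd_zero)
  have "cls (\<lambda>i. fneg (s i)) \<oplus>\<^bsub>hfield S x\<^esub> A = \<zero>\<^bsub>hfield S x\<^esub>"
    using fneg_null[OF s(1)] s by (simp add: add_cls zero_cls fneg_cauchy cls_eq_iff fadd_cauchy z)
  then show "\<exists>B\<in>carrier (hfield S x). B \<oplus>\<^bsub>hfield S x\<^esub> A = \<zero>\<^bsub>hfield S x\<^esub>"
    using s fneg_cauchy by (intro bexI[of _ "cls (\<lambda>i. fneg (s i))"]) auto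
  fix B assume "B \<in> carrier (hfield S x)"
  then obtain t where t: "t \<in> cauchy_fracs S x" "B = cls t" by (rule carrierE)
  show "A \<oplus>\<^bsub>hfield S x\<^esub> B \<in> carrier (hfield S x)" using s t by (simp add: add_cls fadd_cauchy)
  show "A \<oplus>\<^bsub>hfield S x\<^esub> B = B \<oplus>\<^bsub>hfield S x\<^esub> A" using s t by (simp add: add_cls fadd_commute)
  fix C assume "C \<in> carrier (hfield S x)"
  then obtain u where u: "u \<in> cauchy_fracs S x" "C = cls u" by (rule carrierE)
  show "A \<oplus>\<^bsub>hfield S x\<^esub> B \<oplus>\<^bsub>hfield S x\<^esub> C = A \<oplus>\<^bsub>hfield S x\<^esub> (B \<oplus>\<^bsub>hfield S x\<^esub> C)"
    using s t u by (simp add: add_cls fadd_cauchy fadd_assoc)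
qed

lemma minus_cls:
  assumes s: "s \<in> cauchy_fracs S x" and t: "t \<in> cauchy_fracs S x"
  shows "cls s \<ominus>\<^bsub>hfield S x\<^esub> cls t = cls (\<lambda>i. fdiff (s i) (t i))"
proof -
  interpret abelian_group "hfield S x" by (rule abelian_group_hfield)
  have "cls (\<lambda>i. fneg (t i)) \<oplus>\<^bsub>hfield S x\<^esub> cls t = \<zero>\<^bsub>hfield S x\<^esub>"
    using fneg_null[OF t] t by (simp add: add_cls zero_cls fneg_cauchy cls_eq_iff fadd_cauchy const_cauchy zero_frac)
  then have "\<ominus>\<^bsub>hfield S x\<^esub> cls t = cls (\<lambda>i. fneg (t i))"
    using t fneg_cauchy by (intro minus_equality) auto
  then show ?thesis using s t by (simp add: a_minus_def add_cls fneg_cauchy fdiff_eq)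
qed

lemma fnorm_convergent:
  assumes s: "s \<in> cauchy_fracs S x"
  obtains r where "(\<lambda>i. fnorm x (s i)) \<longlonglongrightarrow> r"
proof -
  have "Cauchy (\<lambda>i. fnorm x (s i))"
    unfolding Cauchy_def dist_real_def
  proof (intro allI impI)
    fix e :: real assume "0 < e"
    then obtain N where N: "\<And>i j. i \<ge> N \<Longrightarrow> j \<ge> N \<Longrightarrow> fnorm x (fdiff (s i) (s j)) < e"
      using s unfolding cauchy_fracs_iff by blast
    have "\<bar>fnorm x (s i) - fnorm x (s j)\<bar> < e" if "i \<ge> N" "j \<ge> N" for i j
      using fnorm_diff_le[OF cauchy_fracsD[OF s] cauchy_fracsD[OF s], of i j] N[OF that] by linarith
    then show "\<exists>M. \<forall>m\<ge>M. \<forall>n\<ge>M. \<bar>fnorm x (s m) - fnorm x (s n)\<bar> < e" by blast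
  qed
  then show ?thesis using that by (auto simp: Cauchy_convergent_iff convergent_def)
qed

text \<open>Equivalent Cauchy sequences have the same limiting norm, so the description in
  \<open>hnorm\<close> denotes a unique number.\<close>

lemma hnorm_cls:
  assumes s: "s \<in> cauchy_fracs S x" and r: "(\<lambda>i. fnorm x (s i)) \<longlonglongrightarrow> r"
  shows "hnorm x (cls s) = r"
  unfolding hnorm_def
proof (rule the_equality)
  have "s \<in> cls s" using equiv_class_self[OF equiv_null_rel s] .
  then show "\<exists>s\<in>cls s. (\<lambda>i. fnorm x (s i)) \<longlonglongrightarrow> r" using r by blast
  fix r' assume "\<exists>t\<in>cls s. (\<lambda>i. fnorm x (t i)) \<longlonglongrightarrow> r'"
  then obtain t where t: "(s, t) \<in> null_rel S x" "(\<lambda>i. fnorm x (t i)) \<longlonglongrightarrow> r'" by auto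
  have "(\<lambda>i. fnorm x (t i) - fnorm x (s i)) \<longlonglongrightarrow> 0"
  proof (rule tendsto_rabs_zero_cancel, rule tendsto_sandwich[OF _ _ tendsto_const])
    show "(\<lambda>i. fnorm x (fdiff (s i) (t i))) \<longlonglongrightarrow> 0" using t by (simp add: null_rel_iff)
    show "\<forall>\<^sub>F i in sequentially. \<bar>fnorm x (t i) - fnorm x (s i)\<bar> \<le> fnorm x (fdiff (s i) (t i))"
      using t fnorm_diff_le[of "s _" "t _"] by (auto simp: null_rel_iff cauchy_fracsD abs_minus_commute intro!: always_eventually)
  qed simp
  then have "r' - r = 0" using tendsto_diff[OF t(2) r] LIMSEQ_unique by blast
  then show "r' = r" by simp
qed

lemma hfrac_cls: "hfrac S x q = cls (\<lambda>_. q)"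
  by (simp add: hfrac_def)

lemma hfrac_carrier: "q \<in> fracs_at x \<Longrightarrow> hfrac S x q \<in> carrier (hfield S x)"
  by (simp add: hfrac_cls const_cauchy)

lemma hnorm_hfrac: "q \<in> fracs_at x \<Longrightarrow> hnorm x (hfrac S x q) = fnorm x q"
  unfolding hfrac_cls by (rule hnorm_cls[OF const_cauchy]) auto

lemma hnorm_hfrac_minus_self: "q \<in> fracs_at x \<Longrightarrow> hnorm x (hfrac S x q \<ominus>\<^bsub>hfield S x\<^esub> hfrac S x q) = 0"
  unfolding hfrac_cls minus_cls[OF const_cauchy const_cauchy]
  by (rule hnorm_cls[OF const_cauchy[OF fdiff_frac]]) auto

text \<open>The strict inequality between the limits holds for almost all terms of a Cauchy sequence
  representing \<open>A\<close>. For such a term the two longest sides of an ultrametric triangle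
  are equal.\<close>

lemma hnorm_eq_fnorm:
  assumes A: "A \<in> carrier (hfield S x)" and q: "q \<in> fracs_at x"
    and less: "hnorm x (A \<ominus>\<^bsub>hfield S x\<^esub> hfrac S x q) < max (hnorm x A) (fnorm x q)"
  shows "hnorm x A = fnorm x q"
proof -
  obtain s where s: "s \<in> cauchy_fracs S x" "A = cls s" using A by (rule carrierE)
  obtain r where r: "(\<lambda>i. fnorm x (s i)) \<longlonglongrightarrow> r" using fnorm_convergent[OF s(1)] .
  have d: "(\<lambda>i. fdiff (s i) q) \<in> cauchy_fracs S x"
    unfolding fdiff_eq using fadd_cauchy[OF s(1) const_cauchy[OF fneg_frac[OF q]]] .
  obtain u where u: "(\<lambda>i. fnorm x (fdiff (s i) q)) \<longlonglongrightarrow> u" using fnorm_convergent[OF d] .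
  have A': "hnorm x A = r" using hnorm_cls[OF s(1) r] s(2) by simp
  have "hnorm x (A \<ominus>\<^bsub>hfield S x\<^esub> hfrac S x q) = u"
    unfolding s(2) hfrac_cls minus_cls[OF s(1) const_cauchy[OF q]] by (rule hnorm_cls[OF d u])
  then have ur: "u < max r (fnorm x q)" using less A' by simp
  have "(\<lambda>i. max (fnorm x (s i)) (fnorm x q)) \<longlonglongrightarrow> max r (fnorm x q)"
    using r by (intro tendsto_max) auto
  from tendsto_diff[OF this u] have "eventually (\<lambda>i. 0 < max (fnorm x (s i)) (fnorm x q) - fnorm x (fdiff (s i) q)) sequentially"
    by (rule order_tendstoD) (use ur in simp)
  then have "eventually (\<lambda>i. fnorm x (s i) = fnorm x q) sequentially"
  proof eventually_elim
    case (elim i)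
    then show ?case
      using fnorm_le_max_fdiff[OF cauchy_fracsD[OF s(1)] q, of i] fnorm_le_max_fdiff[OF q cauchy_fracsD[OF s(1)], of i]
        fnorm_fdiff_commute[OF cauchy_fracsD[OF s(1)] q, of i] by linarith
  qed
  then have "(\<lambda>i. fnorm x (s i)) \<longlonglongrightarrow> fnorm x q" by (rule tendsto_eventually)
  then show ?thesis using A' r LIMSEQ_unique by blast
qed

end

end


section \<open>Absolute values of analytic functions and their transport through charts\<close>

context nonarch_field
begin

lemma points_affine_line [simp]: "points (affine_line v) = line_points v"
  and fractions_affine_line [simp]: "fractions (affine_line v) = UNIV"
  by (simp_all add: affine_line_def)

sublocale line: graded_berk_space "affine_line v" "\<lambda>_. UNIV"
  by unfold_locales (auto simp: line_nonneg line_mult line_add_le)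

text \<open>A rational function that approximates \<open>g\<close> with error below |g(y)| / 2 has
  not just nearly but exactly the same absolute value as \<open>g\<close> near
  \<open>y\<close>.\<close>

lemma loc_rational_hnorm:
  assumes W: "openin (top_of_set (line_points v)) W"
    and g: "g \<in> carrier (analytic_functions (affine_line v) W)"
    and pos: "\<And>y. y \<in> W \<Longrightarrow> 0 < hnorm y (g y)"
  shows "loc_rational W (\<lambda>y. hnorm y (g y))"
  unfolding loc_rational_def
proof
  fix y assume y: "y \<in> W"
  let ?L = "affine_line v"
  define e where "e = hnorm y (g y) / 2"
  have e: "0 < e" "e < hnorm y (g y)" using pos[OF y] by (auto simp: e_def)
  have gc: "g z \<in> carrier (hfield ?L z)" if "z \<in> W" for z
    using g that by (auto simp: analytic_functions_def)
  obtain N where N: "openin (top_of_set (line_points v)) N" "y \<in> N" "N \<subseteq> W"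
    and q: "\<forall>e>0. \<exists>q\<in>fractions ?L. \<forall>z\<in>N. z (snd q) \<noteq> 0 \<and> hnorm z (g z \<ominus>\<^bsub>hfield ?L z\<^esub> hfrac ?L z q) < e"
    using g y by (auto simp: analytic_functions_def)
  obtain q where q: "\<And>z. z \<in> N \<Longrightarrow> z (snd q) \<noteq> 0"
    "\<And>z. z \<in> N \<Longrightarrow> hnorm z (g z \<ominus>\<^bsub>hfield ?L z\<^esub> hfrac ?L z q) < e"
    using q e(1) by blast
  have Nl: "z \<in> points ?L" if "z \<in> N" for z using openin_lineD[OF N(1) that] by simp
  have qf: "q \<in> line.fracs_at z" if "z \<in> N" for z using q(1)[OF that] by (simp add: line.fracs_at_def)
  have eq: "hnorm z (g z) = z (fst q) / z (snd q)" if z: "z \<in> N" and "e < max (hnorm z (g z)) (fnorm z q)" for z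
    using line.hnorm_eq_fnorm[OF Nl[OF z] gc qf[OF z]] N(3) z q(2)[OF z] that(2) by (auto simp: fnorm_def)
  \<comment> \<open>Where |q| exceeds the error \<open>e\<close>, the criterion
    \<open>hnorm_eq_fnorm\<close> applies. The point \<open>y\<close> qualifies because
    \<open>e\<close> is smaller than |g(y)| = |q(y)|.\<close>
  define N' where "N' = N \<inter> {z. e * z (snd q) < z (fst q)}"
  have "open {z :: 'k poly \<Rightarrow> real. e * z (snd q) < z (fst q)}"
    by (intro open_Collect_less continuous_intros continuous_on_product_coordinates)
  then have "openin (top_of_set (line_points v)) N'" unfolding N'_def
    using N(1) by (metis (no_types, lifting) Int_assoc openin_open open_Int)
  moreover have sndpos: "0 < z (snd q)" if "z \<in> N" for z
    using q(1)[OF that] line_nonneg[of z "snd q"] Nl[OF that] by simp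
  have "hnorm y (g y) = y (fst q) / y (snd q)" using eq[OF N(2)] e(2) by (simp add: less_max_iff_disj)
  then have "e < y (fst q) / y (snd q)" using e(2) by simp
  then have "e * y (snd q) < y (fst q)" using sndpos[OF N(2)] by (simp add: pos_less_divide_eq)
  then have "y \<in> N'" using N(2) by (simp add: N'_def)
  moreover have "z (fst q) \<noteq> 0 \<and> z (snd q) \<noteq> 0 \<and> hnorm z (g z) = z (fst q) / z (snd q)" if z: "z \<in> N'" for z
  proof -
    have zN: "z \<in> N" and l: "e * z (snd q) < z (fst q)" using z by (auto simp: N'_def)
    have "e < fnorm z q" using l sndpos[OF zN] by (simp add: fnorm_def field_simps)
    then show ?thesis using eq[OF zN] l sndpos[OF zN] e(1) by (auto simp: less_max_iff_disj) (metis less_asym mult_pos_pos)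
  qed
  ultimately show "\<exists>N f h. openin (top_of_set (line_points v)) N \<and> y \<in> N \<and> N \<subseteq> W \<and>
     (\<forall>z\<in>N. z f \<noteq> 0 \<and> z h \<noteq> 0 \<and> hnorm z (g z) = z f / z h)"
    using N(3) by (intro exI[of _ N'] exI[of _ "fst q"] exI[of _ "snd q"]) (auto simp: N'_def)
qed

end

context graded_berk_space
begin

lemma frac_analytic:
  assumes W: "openin (top_of_set (points S)) W" and q: "q \<in> fractions S" "\<And>x. x \<in> W \<Longrightarrow> x (snd q) \<noteq> 0"
  shows "(\<lambda>x\<in>W. hfrac S x q) \<in> carrier (analytic_functions S W)"
proof -
  have xS: "x \<in> points S" if "x \<in> W" for x using W that openin_imp_subset by blast
  have f: "q \<in> fracs_at x" if "x \<in> W" for x using q that by (simp add: fracs_at_def)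
  have "(\<lambda>x\<in>W. hfrac S x q) \<in> (\<Pi>\<^sub>E x\<in>W. carrier (hfield S x))"
    using hfrac_carrier[OF xS f] by auto
  moreover have "\<forall>x\<in>W. \<exists>N. openin (top_of_set (points S)) N \<and> x \<in> N \<and> N \<subseteq> W \<and>
            (\<forall>e>0. \<exists>q'\<in>fractions S. \<forall>y\<in>N. y (snd q') \<noteq> 0 \<and>
               hnorm y ((\<lambda>x\<in>W. hfrac S x q) y \<ominus>\<^bsub>hfield S y\<^esub> hfrac S y q') < e)"
    using W q hnorm_hfrac_minus_self[OF xS f]
    by (intro ballI exI[of _ W] conjI allI impI bexI[of _ q]) auto
  ultimately show ?thesis by (simp add: analytic_functions_def)
qed

end

locale graded_berk_space_over = nonarch_field v + graded_berk_space S H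
  for v :: "'k::alg_closed_field \<Rightarrow> real" and S :: "('a::comm_ring_1, 'k) berk_space" and H :: "nat \<Rightarrow> 'a set"
begin

text \<open>The quotient f / h is analytic on the preimage of \<open>W\<close>. The isomorphism of
  function rings is onto, so it comes from an analytic function \<open>g\<close> on
  \<open>W\<close>, and preservation of \<open>hnorm\<close> identifies |g| with |f / h|, which is
  positive.\<close>

lemma chart_loc_rational:
  assumes iso: "analytic_iso S U (affine_line v) U' \<phi>" and W: "openin (top_of_set (line_points v)) W" "W \<subseteq> U'"
    and q: "f \<in> H d" "h \<in> H d" "\<And>x. x \<in> U \<Longrightarrow> \<phi> x \<in> W \<Longrightarrow> x f \<noteq> 0 \<and> x h \<noteq> 0"
  obtains F where "loc_rational W F" "\<And>x. x \<in> U \<Longrightarrow> \<phi> x \<in> W \<Longrightarrow> F (\<phi> x) = x f / x h"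
proof -
  let ?V = "{x \<in> U. \<phi> x \<in> W}" and ?L = "affine_line v"
  have W': "openin (top_of_set U') W" using W iso
    by (metis (no_types, lifting) analytic_iso_def openin_imp_subset openin_subset_trans points_affine_line)
  have U: "openin (top_of_set (points S)) U" using iso by (simp add: analytic_iso_def)
  obtain \<psi> where hom: "homeomorphism U U' \<phi> \<psi>" using iso unfolding analytic_iso_def by blast
  have "continuous_on U \<phi>" "\<phi> ` U = U'" using hom by (auto simp: homeomorphism_def)
  then have "openin (top_of_set U) (U \<inter> \<phi> -` W)" using W' continuous_on_open[of U \<phi>] by blast
  moreover have "U \<inter> \<phi> -` W = ?V" by auto
  ultimately have V: "openin (top_of_set (points S)) ?V" using U openin_trans by metis
  obtain \<Phi> where Phi: "\<Phi> \<in> ring_iso (analytic_functions ?L W) (analytic_functions S ?V)"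
    "\<And>f x. f \<in> carrier (analytic_functions ?L W) \<Longrightarrow> x \<in> U \<Longrightarrow> \<phi> x \<in> W \<Longrightarrow> hnorm x (\<Phi> f x) = hnorm (\<phi> x) (f (\<phi> x))"
  proof -
    obtain \<Phi> where "\<forall>W. openin (top_of_set U') W \<longrightarrow>
        \<Phi> W \<in> ring_iso (analytic_functions ?L W) (analytic_functions S {x \<in> U. \<phi> x \<in> W}) \<and>
        (\<forall>c. \<Phi> W (\<lambda>y\<in>W. hfrac ?L y (scalar ?L c, 1))
               = (\<lambda>x\<in>{x \<in> U. \<phi> x \<in> W}. hfrac S x (scalar S c, 1))) \<and>
        (\<forall>f\<in>carrier (analytic_functions ?L W).
           (\<forall>x\<in>U. \<phi> x \<in> W \<longrightarrow> hnorm x (\<Phi> W f x) = hnorm (\<phi> x) (f (\<phi> x))) \<and>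
           (\<forall>W0. openin (top_of_set U') W0 \<and> W0 \<subseteq> W \<longrightarrow>
              \<Phi> W0 (restrict f W0) = restrict (\<Phi> W f) {x \<in> U. \<phi> x \<in> W0}))"
      using iso unfolding analytic_iso_def by blast
    from this[rule_format, OF W'] show ?thesis by (intro that[of "\<Phi> W"]) blast+
  qed
  have "(\<lambda>x\<in>?V. hfrac S x (f, h)) \<in> carrier (analytic_functions S ?V)"
    by (rule frac_analytic[OF V]) (use q fractions_eq in auto)
  moreover have im: "\<Phi> ` carrier (analytic_functions ?L W) = carrier (analytic_functions S ?V)"
    using Phi(1) by (simp add: ring_iso_def bij_betw_def)
  ultimately have "(\<lambda>x\<in>?V. hfrac S x (f, h)) \<in> \<Phi> ` carrier (analytic_functions ?L W)" by (simp only: im)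
  then obtain g where g: "g \<in> carrier (analytic_functions ?L W)" "\<Phi> g = (\<lambda>x\<in>?V. hfrac S x (f, h))"
    by (elim imageE) (simp only: that)
  have val: "hnorm (\<phi> x) (g (\<phi> x)) = x f / x h" if x: "x \<in> U" "\<phi> x \<in> W" for x
  proof -
    have xS: "x \<in> points S" using U x openin_imp_subset by blast
    have "(f, h) \<in> fracs_at x" using q x by (auto intro: fracs_atI)
    then have "hnorm x (hfrac S x (f, h)) = x f / x h" using hnorm_hfrac[OF xS] by (simp add: fnorm_def)
    then show ?thesis using Phi(2)[OF g(1) x] g(2) x by simp
  qed
  have "0 < hnorm y (g y)" if y: "y \<in> W" for y
  proof -
    obtain x where x: "x \<in> U" "y = \<phi> x" using hom y W(2) by (auto simp: homeomorphism_def)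
    have "x \<in> points S" using U x openin_imp_subset by blast
    then have "0 < x f / x h" using point_nonneg[of x f] point_nonneg[of x h] q(3)[of x] x y by (simp add: zero_less_divide_iff less_le)
    then show ?thesis using val x y by simp
  qed
  then have "loc_rational W (\<lambda>y. hnorm y (g y))" by (rule loc_rational_hnorm[OF W(1) g(1)])
  then show ?thesis using val that by blast
qed

end


section \<open>Homogeneous ideals\<close>

context nonarch_field
begin

text \<open>A diagonal argument: at step \<open>n\<close> the sequence \<open>b\<close> moves by
  \<open>w ^ n\<close>, where |w| < 1, if it is closer than that to \<open>e n\<close>. All later
  moves are strictly smaller, so the limit keeps its distance from every \<open>e n\<close>.\<close>

lemma uncountable_field: "uncountable (UNIV :: 'k set)"
proof
  assume "countable (UNIV :: 'k set)"
  then obtain e :: "nat \<Rightarrow> 'k" where e: "range e = UNIV"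
    using uncountable_def[of "UNIV :: 'k set"] by auto
  obtain p where p: "1 < v p" using exists_gt_1 by blast
  define w where "w = inverse p"
  have p0: "p \<noteq> 0" using p by auto
  then have w0: "w \<noteq> 0" by (simp add: w_def)
  have w: "0 < v w" "v w < 1" using p w0 p0 by (auto simp: w_def v_inverse inverse_less_1_iff simp del: v_pos_iff)
  define b where "b = rec_nat (0 :: 'k) (\<lambda>n y. if v (e n - y) < v (w ^ n) then y + w ^ n else y)"
  have b_Suc: "b (Suc n) = (if v (e n - b n) < v (w ^ n) then b n + w ^ n else b n)" for n
    by (simp add: b_def)
  have step: "v (b (Suc n) - b n) \<le> v w ^ n" for n by (simp add: b_Suc v_power)
  have avoid: "v w ^ n \<le> v (e n - b (Suc n))" for n
  proof (cases "v (e n - b n) < v (w ^ n)")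
    case True
    have "v (w ^ n) \<le> max (v (e n - b n)) (v (e n - b (Suc n)))"
      using v_diff_le[of "e n - b n" "e n - b (Suc n)"] True by (simp add: b_Suc)
    then show ?thesis using True by (simp add: v_power)
  qed (simp add: b_Suc v_power)
  have far: "v (b (n + k) - b n) \<le> v w ^ n" for n k
  proof (induction k)
    case (Suc k)
    have "v (b (Suc (n + k)) - b (n + k)) \<le> v w ^ n"
    proof -
      have "v w ^ (n + k) \<le> v w ^ n" by (rule power_decreasing) (use w in auto)
      then show ?thesis using step[of "n + k"] by linarith
    qed
    then show ?case using v_diff_triangle[of "b (n + Suc k)" "b n" "b (n + k)"] Suc by simp
  qed (use w in simp)
  have far': "v (b m - b n) \<le> v w ^ N" if "N \<le> m" "N \<le> n" for m n N
    using v_diff_triangle[of "b m" "b n" "b N"] far[of N "m - N"] far[of N "n - N"] that v_minus_commute[of "b N" "b n"]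
    by simp
  have "\<forall>d>0. \<exists>N. \<forall>i\<ge>N. \<forall>j\<ge>N. v (b i - b j) < d"
  proof (intro allI impI)
    fix d :: real assume d: "0 < d"
    obtain N where "v w ^ N < d" using real_arch_pow_inv[OF d w(2)] by blast
    then show "\<exists>N. \<forall>i\<ge>N. \<forall>j\<ge>N. v (b i - b j) < d" using far' by (meson le_less_trans)
  qed
  then obtain l where l: "(\<lambda>i. v (b i - l)) \<longlonglongrightarrow> 0" using complete unfolding complete_abs_def by blast
  obtain n where n: "l = e n" using e by (metis rangeE UNIV_I)
  obtain M where M: "\<And>i. i \<ge> M \<Longrightarrow> v (b i - l) < v w ^ Suc n"
    using order_tendstoD(2)[OF l, of "v w ^ Suc n"] w by (auto simp: eventually_sequentially)
  define i where "i = max M (Suc n)"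
  have "v (b i - b (Suc n)) \<le> v w ^ Suc n" using far'[of "Suc n" i "Suc n"] by (simp add: i_def)
  moreover have "v (b i - l) < v w ^ Suc n" using M[of i] by (simp add: i_def)
  ultimately have "v (e n - b (Suc n)) \<le> v w ^ Suc n"
    using v_diff_triangle[of l "b (Suc n)" "b i"] v_minus_commute[of l "b i"] n by auto
  moreover have "v w ^ Suc n < v w ^ n" using w by simp
  ultimately show False using avoid[of n] by linarith
qed

end

section \<open>Evaluation and grading of polynomials\<close>

definition mmonom :: "(nat \<Rightarrow> 'k) \<Rightarrow> (nat \<Rightarrow>\<^sub>0 nat) \<Rightarrow> 'k::comm_ring_1" where
  "mmonom a m = (\<Prod>i\<in>Poly_Mapping.keys m. a i ^ Poly_Mapping.lookup m i)"

lemma mmonom_superset: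
  assumes "finite A" "Poly_Mapping.keys m \<subseteq> A"
  shows "mmonom a m = (\<Prod>i\<in>A. a i ^ Poly_Mapping.lookup m i)"
  unfolding mmonom_def using assms by (intro prod.mono_neutral_left) (auto simp: in_keys_iff)

lemma mmonom_0 [simp]: "mmonom a 0 = 1"
  by (simp add: mmonom_def)

lemma mmonom_single [simp]: "mmonom a (Poly_Mapping.single i (Suc 0)) = a i"
  unfolding mmonom_def by simp

lemma mmonom_add: "mmonom a (m + m') = mmonom a m * mmonom a m'"
proof -
  let ?A = "Poly_Mapping.keys m \<union> Poly_Mapping.keys m'"
  have "mmonom a (m + m') = (\<Prod>i\<in>?A. a i ^ Poly_Mapping.lookup (m + m') i)"
    using keys_add[of m m'] by (intro mmonom_superset) auto
  also have "\<dots> = mmonom a m * mmonom a m'"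
    by (simp add: mmonom_superset[of ?A] lookup_add power_add prod.distrib)
  finally show ?thesis .
qed

lemma meval_superset:
  assumes "finite A" "Poly_Mapping.keys p \<subseteq> A"
  shows "meval a p = (\<Sum>m\<in>A. Poly_Mapping.lookup p m * mmonom a m)"
  unfolding meval_def mmonom_def[symmetric] using assms
  by (intro sum.mono_neutral_left) (auto simp: in_keys_iff)

lemma meval_0 [simp]: "meval a 0 = 0"
  by (simp add: meval_def)

lemma meval_single [simp]: "meval a (Poly_Mapping.single m c) = c * mmonom a m"
  by (simp add: meval_superset[of "{m}"])

lemma meval_add [simp]: "meval a (p + q) = meval a p + meval a q"
proof -
  let ?A = "Poly_Mapping.keys p \<union> Poly_Mapping.keys q"
  have "meval a (p + q) = (\<Sum>m\<in>?A. Poly_Mapping.lookup (p + q) m * mmonom a m)"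
    using keys_add[of p q] by (intro meval_superset) auto
  also have "\<dots> = meval a p + meval a q"
    by (simp add: meval_superset[of ?A] lookup_add distrib_right sum.distrib)
  finally show ?thesis .
qed

lemma meval_uminus [simp]: "meval a (- p) = - meval a p"
  using meval_add[of a p "- p"] by (simp add: eq_neg_iff_add_eq_0 add.commute)

lemma meval_diff [simp]: "meval a (p - q) = meval a p - meval a q"
  using meval_add[of a p "- q"] by simp

lemma meval_sum: "meval a (sum f A) = (\<Sum>x\<in>A. meval a (f x))"
  by (induction A rule: infinite_finite_induct) auto

lemma sum_monomials: "(\<Sum>m\<in>Poly_Mapping.keys p. Poly_Mapping.single m (Poly_Mapping.lookup p m)) = p"
  by (rule poly_mapping_eqI)
    (simp add: lookup_sum lookup_single when_def in_keys_iff)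

lemma meval_mult [simp]: "meval a (p * q) = meval a p * meval a q"
proof -
  have 1: "meval a (Poly_Mapping.single m c * q) = c * mmonom a m * meval a q" for m c
  proof -
    have "Poly_Mapping.single m c * q = (\<Sum>m'\<in>Poly_Mapping.keys q. Poly_Mapping.single (m + m') (c * Poly_Mapping.lookup q m'))"
      by (subst sum_monomials[of q, symmetric]) (simp add: sum_distrib_left mult_single)
    then show ?thesis
      by (simp add: meval_sum mmonom_add meval_def[of a q] mmonom_def[symmetric] sum_distrib_left mult_ac)
  qed
  have "p * q = (\<Sum>m\<in>Poly_Mapping.keys p. Poly_Mapping.single m (Poly_Mapping.lookup p m) * q)"
    by (subst sum_monomials[of p, symmetric]) (simp add: sum_distrib_right)
  then show ?thesis
    by (simp add: meval_sum 1 meval_def[of a p] mmonom_def[symmetric] sum_distrib_right)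
qed

lemma meval_mconst [simp]: "meval a (mconst c) = c"
  by (simp add: mconst_def)

lemma meval_mvar [simp]: "meval a (mvar i) = a i"
  by (simp add: mvar_def)

lemma meval_1 [simp]: "meval a 1 = 1"
  by (metis mconst_def meval_mconst single_one)

lemma meval_power [simp]: "meval a (p ^ k) = meval a p ^ k"
  by (induction k) auto

lemma mconst_0 [simp]: "mconst 0 = 0" and mconst_1 [simp]: "mconst 1 = 1"
  by (simp_all add: mconst_def)

lemma mconst_mult: "mconst (a * b) = mconst a * mconst b"
  by (simp add: mconst_def mult_single)

lemma mconst_diff: "mconst (a - b) = mconst a - mconst b"
  by (simp add: mconst_def single_diff)

lemma mconst_add: "mconst (a + b) = mconst a + mconst b"
  by (simp add: mconst_def single_add)

lemma homog_0 [simp]: "0 \<in> homog n d"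
  by (simp add: homog_def)

lemma homog_mconst [simp]: "mconst c \<in> homog n 0"
  by (simp add: homog_def mconst_def)

lemma homog_1 [simp]: "1 \<in> homog n 0"
  by (metis homog_mconst mconst_1)

lemma homog_mvar: "i \<le> n \<Longrightarrow> mvar i \<in> homog n 1"
  by (auto simp: homog_def mvar_def lookup_single when_def)

lemma homog_add: "f \<in> homog n d \<Longrightarrow> g \<in> homog n d \<Longrightarrow> f + g \<in> homog n d"
  using keys_add[of f g] by (auto simp: homog_def)

lemma homog_uminus: "f \<in> homog n d \<Longrightarrow> - f \<in> homog n d"
  by (simp add: homog_def)

lemma homog_diff: "f \<in> homog n d \<Longrightarrow> g \<in> homog n d \<Longrightarrow> f - g \<in> homog n d"
  using homog_add[of f n d "- g"] homog_uminus[of g n d] by simp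

lemma homog_mult:
  assumes "f \<in> homog n d" "g \<in> homog n e"
  shows "f * g \<in> homog n (d + e)"
  unfolding homog_def mem_Collect_eq
proof
  fix m assume "m \<in> Poly_Mapping.keys (f * g)"
  then obtain a b where m: "m = a + b" "a \<in> Poly_Mapping.keys f" "b \<in> Poly_Mapping.keys g"
    using keys_mult[of f g] by auto
  then show "Poly_Mapping.keys m \<subseteq> {..n} \<and> (\<Sum>i\<le>n. Poly_Mapping.lookup m i) = d + e"
    using assms keys_add[of a b] by (auto simp: homog_def lookup_add sum.distrib) blast+
qed

lemma homog_power: "f \<in> homog n d \<Longrightarrow> f ^ k \<in> homog n (k * d)"
  by (induction k) (auto dest: homog_mult[of f n d])

lemma homog_mconst_mult: "f \<in> homog n d \<Longrightarrow> mconst c * f \<in> homog n d"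
  using homog_mult[of "mconst c" n 0 f d] by simp

lemma homog_sum: "(\<And>x. x \<in> A \<Longrightarrow> f x \<in> homog n d) \<Longrightarrow> sum f A \<in> homog n d"
  by (induction A rule: infinite_finite_induct) (auto intro: homog_add)

lemma homog_degree_unique: "f \<in> homog n d \<Longrightarrow> f \<in> homog n e \<Longrightarrow> f \<noteq> 0 \<Longrightarrow> d = e"
  by (auto simp: homog_def)

text \<open>A homogeneous ideal is represented by its homogeneous elements, so closure under
  addition is asked only within one degree.\<close>

locale homog_ideal =
  fixes n :: nat and J :: "'k::field mpoly set"
  assumes sub: "J \<subseteq> (\<Union>d. homog n d)"
    and zero: "0 \<in> J"
    and add: "f \<in> homog n d \<Longrightarrow> g \<in> homog n d \<Longrightarrow> f \<in> J \<Longrightarrow> g \<in> J \<Longrightarrow> f + g \<in> J"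
    and mult: "f \<in> J \<Longrightarrow> g \<in> homog n d \<Longrightarrow> f * g \<in> J"
begin

lemma mult': "f \<in> J \<Longrightarrow> g \<in> homog n d \<Longrightarrow> g * f \<in> J"
  using mult by (simp add: mult.commute)

lemma uminus: "f \<in> J \<Longrightarrow> - f \<in> J"
proof -
  assume f: "f \<in> J"
  have "(- 1 :: 'k mpoly) \<in> homog n 0" by (intro homog_uminus homog_1)
  from mult[OF f this] show ?thesis by simp
qed

lemma diff: "f \<in> homog n d \<Longrightarrow> g \<in> homog n d \<Longrightarrow> f \<in> J \<Longrightarrow> g \<in> J \<Longrightarrow> f - g \<in> J"
  using add[of f d "- g"] uminus[of g] homog_uminus[of g n d] by simp

lemma sum:
  "(\<And>x. x \<in> A \<Longrightarrow> f x \<in> homog n d) \<Longrightarrow> (\<And>x. x \<in> A \<Longrightarrow> f x \<in> J) \<Longrightarrow> sum f A \<in> J"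
proof (induction A rule: infinite_finite_induct)
  case (insert x A)
  then show ?case using homog_sum[of A f n d] by (auto intro!: add[of _ d])
qed (auto simp: zero)

lemma mem_if_diff_mem:
  assumes "f \<in> homog n d" "g \<in> homog n d" "f - g \<in> J" "g \<in> J"
  shows "f \<in> J"
  using add[of "f - g" d g] assms homog_diff by fastforce

text \<open>The hypothesis says that \<open>J\<close> contains the ideal of the point \<open>a\<close>.\<close>

lemma reduce_monomial:
  assumes i: "i \<le> n" and T: "\<And>j. j \<le> n \<Longrightarrow> mvar j - mconst (a j) * mvar i \<in> J"
    and m: "Poly_Mapping.keys m \<subseteq> {..n}" "(\<Sum>i\<le>n. Poly_Mapping.lookup m i) = d"
  shows "Poly_Mapping.single m (1 :: 'k) \<in> homog n d \<and> Poly_Mapping.single m 1 - mconst (mmonom a m) * mvar i ^ d \<in> J"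
  using m
proof (induction d arbitrary: m)
  case 0
  have "m = 0"
  proof (rule poly_mapping_eqI)
    fix k show "Poly_Mapping.lookup m k = Poly_Mapping.lookup 0 k"
      using 0 by (cases "k \<le> n") (auto simp: in_keys_iff subset_iff)
  qed
  then show ?case by (simp add: zero)
next
  case (Suc d)
  have "\<exists>j\<le>n. Poly_Mapping.lookup m j \<noteq> 0"
    using Suc.prems(2) by (metis atMost_iff nat.distinct(1) sum.neutral)
  then obtain j where j: "j \<le> n" "Poly_Mapping.lookup m j \<noteq> 0" by blast
  define m' where "m' = m - Poly_Mapping.single j 1"
  have m: "m = Poly_Mapping.single j 1 + m'"
    by (rule poly_mapping_eqI) (use j in \<open>auto simp: m'_def lookup_add lookup_minus lookup_single when_def\<close>)
  have "Poly_Mapping.keys m' \<subseteq> Poly_Mapping.keys m"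
    by (auto simp: m'_def in_keys_iff lookup_minus)
  then have k: "Poly_Mapping.keys m' \<subseteq> {..n}" using Suc.prems by blast
  have "(\<Sum>i\<le>n. Poly_Mapping.lookup m i) = 1 + (\<Sum>i\<le>n. Poly_Mapping.lookup m' i)"
    using j by (simp add: m lookup_add sum.distrib lookup_single when_def sum.delta)
  then have "(\<Sum>i\<le>n. Poly_Mapping.lookup m' i) = d" using Suc.prems by linarith
  from Suc.IH[OF k this] have IH: "Poly_Mapping.single m' (1 :: 'k) \<in> homog n d" "Poly_Mapping.single m' 1 - mconst (mmonom a m') * mvar i ^ d \<in> J"
    by simp_all
  have sm: "Poly_Mapping.single m 1 = mvar j * Poly_Mapping.single m' (1 :: 'k)"
    by (simp add: m mvar_def mult_single)
  have Ti: "(mvar i :: 'k mpoly) ^ d \<in> homog n d" using homog_power[OF homog_mvar[OF i], of d] by simp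
  have eq: "Poly_Mapping.single m 1 - mconst (mmonom a m) * mvar i ^ Suc d =
    mvar j * (Poly_Mapping.single m' 1 - mconst (mmonom a m') * mvar i ^ d) +
    (mvar j - mconst (a j) * mvar i) * (mconst (mmonom a m') * mvar i ^ d)"
    unfolding sm by (simp add: m mmonom_add mconst_mult algebra_simps)
  have h1: "mconst (mmonom a m') * mvar i ^ d \<in> homog n d" using Ti by (rule homog_mconst_mult)
  have h2: "(mvar j :: 'k mpoly) \<in> homog n 1" using j by (intro homog_mvar)
  have h3: "mvar j - mconst (a j) * mvar i \<in> homog n 1"
    by (intro homog_diff[OF h2] homog_mconst_mult homog_mvar i)
  have "Poly_Mapping.single m (1 :: 'k) \<in> homog n (Suc d)"
    unfolding sm using homog_mult[OF h2 IH(1)] by simp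
  moreover have "Poly_Mapping.single m 1 - mconst (mmonom a m) * mvar i ^ Suc d \<in> J"
    unfolding eq
  proof (rule add[of _ "1 + d"])
    show "mvar j * (Poly_Mapping.single m' 1 - mconst (mmonom a m') * mvar i ^ d) \<in> homog n (1 + d)"
      by (intro homog_mult h2 homog_diff IH(1) h1)
    show "(mvar j - mconst (a j) * mvar i) * (mconst (mmonom a m') * mvar i ^ d) \<in> homog n (1 + d)"
      by (intro homog_mult h3 h1)
  qed (use mult'[OF IH(2) h2] mult[OF T[OF j(1)] h1] in auto)
  ultimately show ?case by blast
qed

text \<open>Turns evaluation at \<open>a\<close> into arithmetic modulo \<open>J\<close>. It yields
  the zero in the Nullstellensatz, the homogeneity of evaluation in \<open>meval_normalized\<close>,
  and the values of seminorms that kill the ideal of a point.\<close>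

lemma reduce:
  assumes i: "i \<le> n" and T: "\<And>j. j \<le> n \<Longrightarrow> mvar j - mconst (a j) * mvar i \<in> J"
    and f: "f \<in> homog n d"
  shows "f - mconst (meval a f) * mvar i ^ d \<in> J"
proof -
  have Ti: "(mvar i :: 'k mpoly) ^ d \<in> homog n d" using homog_power[OF homog_mvar[OF i], of d] by simp
  have mc: "mconst (sum g A) = (\<Sum>x\<in>A. mconst (g x))" for g :: "(nat \<Rightarrow>\<^sub>0 nat) \<Rightarrow> 'k" and A
    by (induction A rule: infinite_finite_induct) (auto simp: mconst_add)
  have 1: "mconst c * Poly_Mapping.single m 1 = Poly_Mapping.single m c" for m and c :: 'k
    by (simp add: mconst_def mult_single)
  have "f - mconst (meval a f) * mvar i ^ d =
    (\<Sum>m\<in>Poly_Mapping.keys f. Poly_Mapping.single m (Poly_Mapping.lookup f m)) -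
    (\<Sum>m\<in>Poly_Mapping.keys f. mconst (Poly_Mapping.lookup f m) * mconst (mmonom a m) * mvar i ^ d)"
    by (simp add: sum_monomials meval_def mmonom_def[symmetric] mc mconst_mult sum_distrib_right)
  also have "\<dots> = (\<Sum>m\<in>Poly_Mapping.keys f. mconst (Poly_Mapping.lookup f m) *
      (Poly_Mapping.single m 1 - mconst (mmonom a m) * mvar i ^ d))"
    by (simp add: sum_subtractf[symmetric] right_diff_distrib 1 mult.assoc)
  also have "\<dots> \<in> J"
  proof (rule sum[of _ _ d])
    fix m assume "m \<in> Poly_Mapping.keys f"
    then have "Poly_Mapping.keys m \<subseteq> {..n}" "(\<Sum>i\<le>n. Poly_Mapping.lookup m i) = d" using f by (auto simp: homog_def)
    from reduce_monomial[OF i T this]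
    show "mconst (Poly_Mapping.lookup f m) * (Poly_Mapping.single m 1 - mconst (mmonom a m) * mvar i ^ d) \<in> homog n d"
      "mconst (Poly_Mapping.lookup f m) * (Poly_Mapping.single m 1 - mconst (mmonom a m) * mvar i ^ d) \<in> J"
      using Ti by (auto intro!: homog_mconst_mult homog_diff mult'[of _ _ 0])
  qed
  finally show ?thesis .
qed

end


locale homog_prime_ideal = homog_ideal +
  assumes prime: "f \<in> homog n d \<Longrightarrow> g \<in> homog n e \<Longrightarrow> f * g \<in> J \<Longrightarrow> f \<in> J \<or> g \<in> J"
begin

lemma prime_power: "f \<in> homog n d \<Longrightarrow> 1 \<notin> J \<Longrightarrow> f ^ k \<in> J \<Longrightarrow> f \<in> J"
  by (induction k) (auto dest: prime[OF _ homog_power])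

end

text \<open>This is G^N p(h / G) with denominators cleared. Coefficients beyond \<open>N\<close> are
  cut off, hence the degree bounds in the lemmas about it.\<close>

definition homogenization :: "nat \<Rightarrow> 'k::field mpoly \<Rightarrow> 'k mpoly \<Rightarrow> 'k poly \<Rightarrow> 'k mpoly" where
  "homogenization N h G p = (\<Sum>i\<le>N. mconst (poly.coeff p i) * h ^ i * G ^ (N - i))"

lemma homogenization_add:
  "homogenization N h G (p + q) = homogenization N h G p + homogenization N h G q"
  by (simp add: homogenization_def mconst_add algebra_simps sum.distrib)

lemma homogenization_smult:
  "homogenization N h G (Polynomial.smult c p) = mconst c * homogenization N h G p"
  by (simp add: homogenization_def mconst_mult sum_distrib_left mult_ac)

lemma homogenization_sum:
  "homogenization N h G (sum f A) = (\<Sum>x\<in>A. homogenization N h G (f x))"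
proof (induction A rule: infinite_finite_induct)
  case (insert x A)
  then show ?case by (simp add: homogenization_add)
qed (simp_all add: homogenization_def)

lemma homogenization_pCons: "homogenization (Suc N) h G (pCons 0 p) = h * homogenization N h G p"
  unfolding homogenization_def
  by (subst sum.atMost_Suc_shift) (simp add: sum_distrib_left mult_ac)

lemma homogenization_Suc:
  assumes "Polynomial.degree p \<le> N"
  shows "homogenization (Suc N) h G p = G * homogenization N h G p"
proof -
  have "poly.coeff p (Suc N) = 0" using assms by (simp add: coeff_eq_0)
  then show ?thesis unfolding homogenization_def
    by (simp add: sum_distrib_left Suc_diff_le mult_ac)
qed

lemma homogenization_degree_add:
  "Polynomial.degree p \<le> N \<Longrightarrow> homogenization (k + N) h G p = G ^ k * homogenization N h G p"
  by (induction k) (simp_all add: homogenization_Suc mult_ac)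

lemma homogenization_linear:
  assumes "Polynomial.degree p \<le> N"
  shows "homogenization (Suc N) h G ([:-c, 1:] * p) = (h - mconst c * G) * homogenization N h G p"
proof -
  have "[:-c, 1:] * p = pCons 0 p + Polynomial.smult (- c) p" by simp
  then have "homogenization (Suc N) h G ([:-c, 1:] * p) =
      h * homogenization N h G p + mconst (- c) * (G * homogenization N h G p)"
    by (simp only: homogenization_add homogenization_smult homogenization_pCons homogenization_Suc[OF assms])
  moreover have "mconst (- c) = - mconst c" using mconst_diff[of 0 c] by simp
  ultimately show ?thesis by (simp add: algebra_simps)
qed

lemma homogenization_linear_prod:
  fixes h G :: "'k::field mpoly"
  shows "homogenization (size B) h G (\<Prod>b\<in>#B. [:-b, 1:]) = (\<Prod>b\<in>#B. h - mconst b * G)"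
proof (induction B)
  case (add b B)
  have "Polynomial.degree (\<Prod>b\<in>#B. [:-b, 1:] :: 'k poly) \<le> size B"
  proof (induction B)
    case (add x B)
    then show ?case using degree_mult_le[of "[:-x, 1:]" "\<Prod>b\<in>#B. [:-b, 1:]"] by (simp del: mult_pCons_left)
  qed simp
  from homogenization_linear[OF this, of h G b] add show ?case by (simp del: mult_pCons_left)
qed (simp add: homogenization_def)

lemma finite_monomials: "finite {m :: nat \<Rightarrow>\<^sub>0 nat. Poly_Mapping.keys m \<subseteq> {..n} \<and> (\<Sum>i\<le>n. Poly_Mapping.lookup m i) = d}"
  (is "finite ?M")
proof (rule finite_imageD)
  show "finite ((\<lambda>m. restrict (Poly_Mapping.lookup m) {..n}) ` ?M)"
  proof (rule finite_subset)
    show "finite (PiE {..n} (\<lambda>_. {..d}))" by (intro finite_PiE) auto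
    show "(\<lambda>m. restrict (Poly_Mapping.lookup m) {..n}) ` ?M \<subseteq> PiE {..n} (\<lambda>_. {..d})"
    proof (intro image_subsetI)
      fix m assume "m \<in> ?M"
      then have "Poly_Mapping.lookup m k \<le> d" if "k \<le> n" for k
        using member_le_sum[of k "{..n}" "Poly_Mapping.lookup m"] that by simp
      then show "restrict (Poly_Mapping.lookup m) {..n} \<in> PiE {..n} (\<lambda>_. {..d})"
        unfolding restrict_PiE_iff by simp
    qed
  qed
  show "inj_on (\<lambda>m. restrict (Poly_Mapping.lookup m) {..n}) ?M"
  proof (rule inj_onI, rule poly_mapping_eqI)
    fix m m' :: "nat \<Rightarrow>\<^sub>0 nat" and k
    assume *: "m \<in> ?M" "m' \<in> ?M" "restrict (Poly_Mapping.lookup m) {..n} = restrict (Poly_Mapping.lookup m') {..n}"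
    show "Poly_Mapping.lookup m k = Poly_Mapping.lookup m' k"
    proof (cases "k \<le> n")
      case True
      then show ?thesis using fun_cong[OF *(3), of k] by simp
    next
      case False
      then have "k \<notin> Poly_Mapping.keys m" "k \<notin> Poly_Mapping.keys m'" using *(1,2) by auto
      then show ?thesis by (simp add: in_keys_iff)
    qed
  qed
qed

text \<open>The forms of degree \<open>d\<close> lie in the span of finitely many monomials.
  Injectivity makes the infinite index set give an infinite set of forms, and turns a relation
  between forms into one between indices.\<close>

lemma homog_linear_dependence:
  fixes s :: "'b \<Rightarrow> 'k::field mpoly"
  assumes inf: "infinite I" and inj: "inj_on s I" and s: "\<And>c. c \<in> I \<Longrightarrow> s c \<in> homog n d"
  obtains T l c0 where "finite T" "T \<subseteq> I" "c0 \<in> T" "l c0 \<noteq> 0" "(\<Sum>c\<in>T. mconst (l c) * s c) = 0"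
proof -
  interpret V: vector_space "\<lambda>c (p :: 'k mpoly). mconst c * p"
    by unfold_locales (simp_all add: mconst_add mconst_mult algebra_simps)
  define B where "B = (\<lambda>m. Poly_Mapping.single m (1 :: 'k)) `
    {m :: nat \<Rightarrow>\<^sub>0 nat. Poly_Mapping.keys m \<subseteq> {..n} \<and> (\<Sum>i\<le>n. Poly_Mapping.lookup m i) = d}"
  have fB: "finite B" unfolding B_def using finite_monomials by blast
  have span: "s c \<in> V.span B" if c: "c \<in> I" for c
  proof -
    have "(\<Sum>m\<in>Poly_Mapping.keys (s c). mconst (Poly_Mapping.lookup (s c) m) * Poly_Mapping.single m 1) \<in> V.span B"
    proof (intro V.span_sum V.span_scale V.span_base)
      fix m assume "m \<in> Poly_Mapping.keys (s c)"
      then show "Poly_Mapping.single m 1 \<in> B" using s[OF c] by (auto simp: B_def homog_def)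
    qed
    then show ?thesis by (simp add: mconst_def mult_single sum_monomials)
  qed
  have "V.dependent (s ` I)"
  proof (rule ccontr)
    assume "\<not> V.dependent (s ` I)"
    then have "finite (s ` I)" using V.independent_span_bound[OF fB] span by blast
    then show False using inf inj finite_imageD by blast
  qed
  then obtain t u w where t: "finite t" "t \<subseteq> s ` I" "(\<Sum>w\<in>t. mconst (u w) * w) = 0" "w \<in> t" "u w \<noteq> 0"
    unfolding V.dependent_explicit by blast
  define T where "T = {c \<in> I. s c \<in> t}"
  have sT: "s ` T = t" using t(2) by (auto simp: T_def)
  have injT: "inj_on s T" using inj by (rule inj_on_subset) (auto simp: T_def)
  have "finite T" using t(1) sT injT finite_imageD by blast
  moreover obtain c0 where "c0 \<in> T" "w = s c0" using t(4) sT by blast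
  moreover have "(\<Sum>c\<in>T. mconst (u (s c)) * s c) = 0"
    using t(3) sum.reindex[OF injT, of "\<lambda>w. mconst (u w) * w"] sT by simp
  ultimately show ?thesis using t(5) by (intro that[of T c0 "\<lambda>c. u (s c)"]) (auto simp: T_def)
qed

text \<open>An ideal that is maximal among those without powers of \<open>G\<close> is prime; Zorn's
  lemma is applied to homogeneous ideals. The last conclusion says that every form outside
  \<open>M\<close> becomes a unit modulo \<open>M\<close> once \<open>G\<close> is inverted.\<close>

lemma maximal_avoiding:
  fixes Q :: "'k::field mpoly set"
  assumes Q: "homog_prime_ideal n Q" and G: "G \<in> homog n e" "G \<notin> Q" and one: "1 \<notin> Q"
  obtains M where "homog_prime_ideal n M" "Q \<subseteq> M" "\<And>m. G ^ m \<notin> M"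
    "\<And>p d. p \<in> homog n d \<Longrightarrow> p \<notin> M \<Longrightarrow>
       \<exists>m s d'. s \<in> homog n d' \<and> d' + d = m * e \<and> G ^ m - p * s \<in> M"
proof -
  interpret Q: homog_prime_ideal n Q by (rule Q)
  define \<J> where "\<J> = {J. homog_ideal n J \<and> Q \<subseteq> J \<and> (\<forall>m. G ^ m \<notin> J)}"
  have "Q \<in> \<J>" unfolding \<J>_def using Q.prime_power[OF G(1) one] G(2) Q.homog_ideal_axioms by blast
  have "\<exists>M\<in>\<J>. \<forall>Y\<in>\<J>. M \<subseteq> Y \<longrightarrow> Y = M"
  proof (rule subset_Zorn_nonempty)
    show "\<J> \<noteq> {}" using \<open>Q \<in> \<J>\<close> by blast
    fix \<C> assume \<C>: "\<C> \<noteq> {}" "subset.chain \<J> \<C>"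
    have CJ: "homog_ideal n J \<and> Q \<subseteq> J \<and> (\<forall>m. G ^ m \<notin> J)" if "J \<in> \<C>" for J
      using \<C>(2) that by (auto simp: subset.chain_def \<J>_def)
    have "homog_ideal n (\<Union>\<C>)"
    proof
      show "\<Union>\<C> \<subseteq> (\<Union>d. homog n d)" using CJ homog_ideal.sub by blast
      show "0 \<in> \<Union>\<C>" using CJ homog_ideal.zero \<C>(1) by blast
      show "f * g \<in> \<Union>\<C>" if "f \<in> \<Union>\<C>" "g \<in> homog n d" for f g d
        using that CJ homog_ideal.mult by blast
      fix f g d assume fg: "f \<in> homog n d" "g \<in> homog n d" "f \<in> \<Union>\<C>" "g \<in> \<Union>\<C>"
      then obtain A B where "A \<in> \<C>" "B \<in> \<C>" "f \<in> A" "g \<in> B" by blast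
      moreover from this have "A \<subseteq> B \<or> B \<subseteq> A" using \<C>(2) by (auto simp: subset.chain_def)
      ultimately show "f + g \<in> \<Union>\<C>" using CJ homog_ideal.add fg by blast
    qed
    then show "\<Union>\<C> \<in> \<J>" unfolding \<J>_def using CJ \<C>(1) by blast
  qed
  then obtain M where M: "M \<in> \<J>" "\<And>Y. Y \<in> \<J> \<Longrightarrow> M \<subseteq> Y \<Longrightarrow> Y = M" by blast
  then have MI: "homog_ideal n M" and QM: "Q \<subseteq> M" and GM: "\<And>m. G ^ m \<notin> M" by (auto simp: \<J>_def)
  interpret M: homog_ideal n M by (rule MI)
  have Gm: "G ^ m \<in> homog n (m * e)" for m using homog_power[OF G(1)] .
  have inv: "\<exists>m s d'. s \<in> homog n d' \<and> d' + d = m * e \<and> G ^ m - p * s \<in> M"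
    if p: "p \<in> homog n d" "p \<notin> M" for p d
  proof (rule ccontr)
    assume neg: "\<not> ?thesis"
    \<comment> \<open>The homogeneous elements of the ideal generated by \<open>M\<close> and
      \<open>p\<close>. The set \<open>M\<close> is added separately because its forms of degree
      below \<open>d\<close> are not of the shape on the right.\<close>
    define N where "N = M \<union> {f + p * s | f s d'. f \<in> M \<and> s \<in> homog n d' \<and> f \<in> homog n (d + d')}"
    have hom: "f + p * s \<in> homog n (d + d')" if "f \<in> homog n (d + d')" "s \<in> homog n d'" for f s d'
      using that homog_mult[OF p(1)] by (intro homog_add) auto
    have NE: "\<exists>f s d'. x = f + p * s \<and> f \<in> M \<and> s \<in> homog n d' \<and> f \<in> homog n (d + d')"
      if "x \<in> N" "x \<notin> M" for x using that unfolding N_def by blast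
    have NI: "f + p * s \<in> N" if "f \<in> M" "s \<in> homog n d'" "f \<in> homog n (d + d')" for f s d'
      using that unfolding N_def by blast
    have "homog_ideal n N"
    proof
      show "N \<subseteq> (\<Union>d. homog n d)" unfolding N_def using M.sub hom by blast
      show "0 \<in> N" unfolding N_def using M.zero by blast
      show "x * g \<in> N" if x: "x \<in> N" and g: "g \<in> homog n k" for x g k
      proof (cases "x \<in> M")
        case True then show ?thesis using M.mult[OF _ g] by (auto simp: N_def)
      next
        case False
        then obtain f s d' where f: "x = f + p * s" "f \<in> M" "s \<in> homog n d'" "f \<in> homog n (d + d')"
          using NE x by blast
        have "f * g + p * (s * g) \<in> N"
          by (rule NI[of _ _ "d' + k"]) (use f g M.mult homog_mult[of f n "d + d'" g k] homog_mult in \<open>auto simp: add.assoc\<close>)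
        then show ?thesis using f by (simp add: algebra_simps)
      qed
      fix x y k assume xy: "x \<in> homog n k" "y \<in> homog n k" "x \<in> N" "y \<in> N"
      have rep: "\<exists>f s. z = f + p * s \<and> f \<in> M \<and> s \<in> homog n d' \<and> f \<in> homog n (d + d')"
        if z: "z \<in> N" "z \<in> homog n (d + d')" for z d'
      proof (cases "z \<in> M")
        case True
        then show ?thesis using z by (intro exI[of _ z] exI[of _ 0]) auto
      next
        case False
        then obtain f s d'' where f: "z = f + p * s" "f \<in> M" "s \<in> homog n d''" "f \<in> homog n (d + d'')"
          using NE z by blast
        have "z \<noteq> 0" using False M.zero by blast
        then have "d + d'' = d + d'" using homog_degree_unique[OF hom[OF f(4,3)]] z f(1) by metis
        then show ?thesis using f by auto
      qed
      show "x + y \<in> N"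
      proof (cases "x \<in> M \<and> y \<in> M")
        case True
        then show ?thesis using M.add[OF xy(1,2)] by (auto simp: N_def)
      next
        case False
        have "\<exists>d'. k = d + d'"
        proof -
          obtain z where z: "z \<in> N" "z \<notin> M" "z \<in> homog n k" using False xy by blast
          then obtain f s d' where f: "z = f + p * s" "s \<in> homog n d'" "f \<in> homog n (d + d')" using NE by blast
          have "z \<noteq> 0" using z M.zero by blast
          then show ?thesis using homog_degree_unique[OF hom[OF f(3,2)], of k] z f(1) by metis
        qed
        then obtain d' where k: "k = d + d'" by blast
        obtain f s where f: "x = f + p * s" "f \<in> M" "s \<in> homog n d'" "f \<in> homog n (d + d')"
          using rep[OF xy(3), of d'] xy(1) k by blast
        obtain f' s' where f': "y = f' + p * s'" "f' \<in> M" "s' \<in> homog n d'" "f' \<in> homog n (d + d')"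
          using rep[OF xy(4), of d'] xy(2) k by blast
        have "(f + f') + p * (s + s') \<in> N"
          using f f' by (intro NI[of _ _ d'] M.add homog_add)
        then show ?thesis using f f' by (simp add: algebra_simps)
      qed
    qed
    moreover have "G ^ m \<notin> N" for m
    proof
      assume "G ^ m \<in> N"
      then obtain f s d' where f: "G ^ m = f + p * s" "f \<in> M" "s \<in> homog n d'" "f \<in> homog n (d + d')"
        using NE GM by blast
      have "G ^ m \<noteq> 0" using GM M.zero by metis
      then have "d + d' = m * e" using homog_degree_unique[OF hom[OF f(4,3)]] Gm f(1) by metis
      moreover have "G ^ m - p * s \<in> M" using f by simp
      ultimately show False using neg f(3) by (metis add.commute)
    qed
    moreover have "M \<subseteq> N" by (auto simp: N_def)
    ultimately have "N = M" using M(2) QM by (auto simp: \<J>_def)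
    moreover have "0 + p * 1 \<in> N" by (rule NI[of _ _ 0]) (auto simp: M.zero)
    ultimately show False using p by simp
  qed
  have "homog_prime_ideal n M"
  proof
    fix f d g k assume f: "f \<in> homog n d" and g: "g \<in> homog n k" and fg: "f * g \<in> M"
    show "f \<in> M \<or> g \<in> M"
    proof (rule ccontr)
      assume neg: "\<not> ?thesis"
      obtain m s d' where s: "s \<in> homog n d'" "d' + d = m * e" "G ^ m - f * s \<in> M" using inv[OF f] neg by blast
      obtain m' s' k' where s': "s' \<in> homog n k'" "k' + k = m' * e" "G ^ m' - g * s' \<in> M" using inv[OF g] neg by blast
      have fs: "f * s \<in> homog n (m * e)" using homog_mult[OF f s(1)] s(2) by (simp add: add.commute)
      \<comment> \<open>Modulo \<open>M\<close>, both \<open>f\<close> and \<open>g\<close> divide a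
        power of \<open>G\<close>. Multiplying the two relations puts a power of \<open>G\<close>
        into the ideal as soon as \<open>f * g\<close> lies in it.\<close>
      have "G ^ (m + m') = (G ^ m - f * s) * G ^ m' + ((G ^ m' - g * s') * (f * s) + (f * g) * (s * s'))"
        by (simp add: algebra_simps power_add)
      also have "\<dots> \<in> M"
      proof (rule M.add[of _ "m * e + m' * e"])
        have gs: "g * s' \<in> homog n (m' * e)" using homog_mult[OF g s'(1)] s'(2) by (simp add: add.commute)
        have a: "(G ^ m' - g * s') * (f * s) \<in> homog n (m * e + m' * e)"
          using homog_mult[OF homog_diff[OF Gm gs] fs] by (simp add: add.commute)
        have "(f * s) * (g * s') \<in> homog n (m * e + m' * e)" by (rule homog_mult[OF fs gs])
        then have b: "f * g * (s * s') \<in> homog n (m * e + m' * e)" by (simp add: mult_ac)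
        show "(G ^ m - f * s) * G ^ m' \<in> homog n (m * e + m' * e)"
          by (rule homog_mult[OF homog_diff[OF Gm fs] Gm])
        show "(G ^ m' - g * s') * (f * s) + f * g * (s * s') \<in> homog n (m * e + m' * e)"
          by (rule homog_add[OF a b])
        show "(G ^ m - f * s) * G ^ m' \<in> M" by (rule M.mult[OF s(3) Gm])
        show "(G ^ m' - g * s') * (f * s) + f * g * (s * s') \<in> M"
          by (rule M.add[OF a b M.mult[OF s'(3) fs] M.mult[OF fg homog_mult[OF s(1) s'(1)]]])
      qed
      finally show False using GM by blast
    qed
  qed
  then show ?thesis using that QM GM inv by blast
qed


section \<open>A projective Nullstellensatz over uncountable fields\<close>

lemma (in homog_ideal) mconst_mult_memD:
  assumes "mconst c * p \<in> J" "c \<noteq> 0"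
  shows "p \<in> J"
proof -
  have "mconst (inverse c) * (mconst c * p) = mconst (inverse c * c) * p"
    by (simp only: mconst_mult mult.assoc)
  also have "\<dots> = p" using assms(2) by simp
  finally show ?thesis using mult'[OF assms(1) homog_mconst, of "inverse c"] by (simp only:)
qed

context nonarch_field
begin

text \<open>
  If no \<open>h - c * G\<close> were in \<open>M\<close>, all of them would have inverses modulo \<open>M\<close> up to a power of \<open>G\<close>.
  For uncountably many \<open>c\<close> these would lie in one finite-dimensional space of forms, and clearing
  denominators in a linear relation among them would give a polynomial relation between \<open>h\<close> and \<open>G\<close>
  modulo the prime ideal \<open>M\<close>, which splits into linear factors.
\<close>

lemma maximal_avoiding_residue:
  fixes M :: "'k mpoly set"
  assumes M: "homog_prime_ideal n M" and G: "G \<in> homog n e" "\<And>m. G ^ m \<notin> M"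
    and inv: "\<And>p d. p \<in> homog n d \<Longrightarrow> p \<notin> M \<Longrightarrow>
       \<exists>m s d'. s \<in> homog n d' \<and> d' + d = m * e \<and> G ^ m - p * s \<in> M"
    and h: "h \<in> homog n e"
  shows "\<exists>c. h - mconst c * G \<in> M"
proof (rule ccontr)
  interpret M: homog_prime_ideal n M by (rule M)
  let ?D = "\<lambda>c. h - mconst c * G"
  assume neg: "\<not> ?thesis"
  have D: "?D c \<in> homog n e" for c using h G by (intro homog_diff homog_mconst_mult)
  have "\<forall>c. \<exists>m s d'. s \<in> homog n d' \<and> d' + e = m * e \<and> G ^ m - ?D c * s \<in> M" using inv[OF D] neg by blast
  then obtain m s d' where s: "\<And>c. s c \<in> homog n (d' c)" "\<And>c. d' c + e = m c * e" "\<And>c. G ^ m c - ?D c * s c \<in> M"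
    by metis
  \<comment> \<open>There are uncountably many \<open>c\<close> but only countably many exponents,
    so infinitely many \<open>c\<close> share one exponent and their \<open>s c\<close> share one
    degree.\<close>
  have "\<exists>k. infinite {c. m c = k}"
  proof (rule ccontr)
    assume "\<not> ?thesis"
    then have "countable {c. m c = k}" for k by (simp add: countable_finite)
    then have "countable (\<Union>k. {c. m c = k})" by (intro countable_UN) auto
    moreover have "(\<Union>k. {c. m c = k}) = UNIV" by auto
    ultimately show False using uncountable_field by simp
  qed
  then obtain k where k: "infinite {c. m c = k}" by blast
  let ?I = "{c. m c = k}"
  have sk: "s c \<in> homog n (k * e - e)" if "c \<in> ?I" for c
  proof -
    have "d' c = k * e - e" using s(2)[of c] that by auto
    then show ?thesis using s(1)[of c] by simp
  qed
  have Gk: "G ^ j \<in> homog n (j * e)" for j using homog_power[OF G(1)] .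
  have ke: "k * e = e + (k * e - e)" if "c \<in> ?I" for c using s(2)[of c] that by auto
  have Ds: "?D c * s c \<in> homog n (k * e)" if "c \<in> ?I" for c
    using homog_mult[OF D sk[OF that]] ke[OF that] by simp
  have sM: "s c \<notin> M" if "c \<in> ?I" for c
  proof
    assume sc: "s c \<in> M"
    have "?D c * s c \<in> M" using M.mult'[OF sc D] .
    then have "G ^ k \<in> M" using M.mem_if_diff_mem[OF Gk Ds[OF that]] s(3)[of c] that by simp
    then show False using G(2) by blast
  qed
  \<comment> \<open>If \<open>c\<close> and \<open>c'\<close> had the same \<open>s c\<close>, the
    difference of their two relations would put (c - c') G s(c) into the prime ideal, although
    neither \<open>G\<close> nor \<open>s c\<close> lies in it.\<close>
  have inj: "inj_on s ?I"
  proof (rule inj_onI, rule ccontr)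
    fix c c' assume c: "c \<in> ?I" "c' \<in> ?I" "s c = s c'" "c \<noteq> c'"
    have "(G ^ k - ?D c * s c) - (G ^ k - ?D c' * s c') \<in> M"
      using M.diff[OF homog_diff[OF Gk Ds[OF c(1)]] homog_diff[OF Gk Ds[OF c(2)]]] s(3)[of c] s(3)[of c'] c(1,2)
      by simp
    also have "(G ^ k - ?D c * s c) - (G ^ k - ?D c' * s c') = mconst (c - c') * (G * s c)"
      unfolding c(3)[symmetric] by (simp add: mconst_diff algebra_simps)
    finally have "G * s c \<in> M" by (rule M.mconst_mult_memD) (use c(4) in simp)
    then show False using M.prime[OF G(1) sk[OF c(1)]] G(2)[of 1] sM[OF c(1)] by simp
  qed
  obtain T l c0 where T: "finite T" "T \<subseteq> ?I" "c0 \<in> T" "l c0 \<noteq> 0" "(\<Sum>c\<in>T. mconst (l c) * s c) = 0"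
    by (rule homog_linear_dependence[OF k inj sk])
  define N where "N = card T - 1"
  have "0 < card T" using T by (auto simp: card_gt_0_iff)
  then have cT: "card T = Suc N" by (simp add: N_def)
  \<comment> \<open>Modulo \<open>M\<close>, \<open>s c\<close> stands for G^k / (h - c G), so the
    linear relation reads sum l(c) / (h - c G) = 0. The product \<open>P c\<close> is the cofactor
    of h - c G in the common denominator.\<close>
  define P where "P = (\<lambda>c. \<Prod>c'\<in>T - {c}. ?D c')"
  have Ph: "P c \<in> homog n (N * e)" if "c \<in> T" for c
  proof -
    have "(\<Prod>c'\<in>A. ?D c') \<in> homog n (card A * e)" if "finite A" for A
      using that by (induction A rule: finite_induct) (auto simp: add.commute intro!: homog_mult D)
    from this[of "T - {c}"] show ?thesis using T that cT by (simp add: P_def)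
  qed
  have DP: "?D c * P c = (\<Prod>c'\<in>T. ?D c')" if "c \<in> T" for c
    unfolding P_def using T(1) that by (simp add: prod.remove)
  have mem: "(\<Sum>c\<in>T. mconst (l c) * ((G ^ k - ?D c * s c) * P c)) \<in> M"
  proof (rule M.sum[of _ _ "k * e + N * e"])
    fix c assume c: "c \<in> T"
    then have cI: "c \<in> ?I" using T by blast
    have 1: "(G ^ k - ?D c * s c) * P c \<in> homog n (k * e + N * e)"
      by (intro homog_mult homog_diff Gk Ds[OF cI] Ph[OF c])
    then show "mconst (l c) * ((G ^ k - ?D c * s c) * P c) \<in> homog n (k * e + N * e)" by (rule homog_mconst_mult)
    have "(G ^ k - ?D c * s c) * P c \<in> M" using M.mult[OF _ Ph[OF c]] s(3)[of c] cI by simp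
    then show "mconst (l c) * ((G ^ k - ?D c * s c) * P c) \<in> M" by (rule M.mult'[OF _ homog_mconst])
  qed
  have alg: "a * ((g - d * w) * u) = g * (a * u) - (a * w) * (d * u)" for a g d w u :: "'k mpoly"
    by (simp add: algebra_simps)
  have "(\<Sum>c\<in>T. mconst (l c) * ((G ^ k - ?D c * s c) * P c)) =
     G ^ k * (\<Sum>c\<in>T. mconst (l c) * P c) - (\<Sum>c\<in>T. mconst (l c) * s c) * (\<Prod>c'\<in>T. ?D c')"
    unfolding sum_distrib_left sum_distrib_right sum_subtractf[symmetric]
    by (rule sum.cong) (simp_all only: alg DP)
  then have GP: "G ^ k * (\<Sum>c\<in>T. mconst (l c) * P c) \<in> M" using mem T(5) by (simp only:) simp
  \<comment> \<open>The numerator of that sum as a polynomial in h / G. At \<open>c0\<close> only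
    the term of \<open>c0\<close> survives, so it is not zero.\<close>
  define \<psi> where "\<psi> = (\<Sum>c\<in>T. Polynomial.smult (l c) (\<Prod>c'\<in>T - {c}. [:-c', 1:]))"
  have Pc: "P c = homogenization N h G (\<Prod>c'\<in>T - {c}. [:-c', 1:])" if "c \<in> T" for c
    using homogenization_linear_prod[of "mset_set (T - {c})" h G] that T(1) cT
    by (simp add: P_def prod_unfold_prod_mset)
  have \<psi>: "(\<Sum>c\<in>T. mconst (l c) * P c) = homogenization N h G \<psi>"
    unfolding \<psi>_def homogenization_sum homogenization_smult by (rule sum.cong) (simp_all add: Pc)
  have "poly \<psi> c0 = l c0 * (\<Prod>c'\<in>T - {c0}. c0 - c')"
  proof -
    have "poly \<psi> c0 = (\<Sum>c\<in>T. if c = c0 then l c0 * (\<Prod>c'\<in>T - {c0}. c0 - c') else 0)"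
      unfolding \<psi>_def poly_sum
    proof (rule sum.cong)
      fix c assume c: "c \<in> T"
      have "(\<Prod>c'\<in>T - {c}. c0 - c') = 0" if "c \<noteq> c0" using that T(1,3) by (intro prod_zero) auto
      then show "poly (Polynomial.smult (l c) (\<Prod>c'\<in>T - {c}. [:-c', 1:])) c0 =
        (if c = c0 then l c0 * (\<Prod>c'\<in>T - {c0}. c0 - c') else 0)"
        by (auto simp: poly_prod)
    qed simp
    then show ?thesis using T by simp
  qed
  moreover have "(\<Prod>c'\<in>T - {c0}. c0 - c') \<noteq> 0" using T(1) by (auto simp: prod_zero_iff)
  ultimately have "\<psi> \<noteq> 0" using T(4) by auto
  then obtain B where B: "size B = Polynomial.degree \<psi>" "\<psi> = Polynomial.smult (Polynomial.lead_coeff \<psi>) (\<Prod>b\<in>#B. [:-b, 1:])"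
    using alg_closed_imp_factorization by blast
  have "Polynomial.degree \<psi> \<le> N" unfolding \<psi>_def
  proof (rule degree_sum_le[OF T(1)])
    fix c assume c: "c \<in> T"
    have "Polynomial.degree (\<Prod>c'\<in>A. [:-c', 1:] :: 'k poly) \<le> card A" if "finite A" for A
      using degree_prod_sum_le[OF that, of "\<lambda>c'. [:-c', 1:] :: 'k poly"] by simp
    from this[of "T - {c}"] have "Polynomial.degree (\<Prod>c'\<in>T - {c}. [:-c', 1:] :: 'k poly) \<le> N"
      using T(1) c cT by simp
    then show "Polynomial.degree (Polynomial.smult (l c) (\<Prod>c'\<in>T - {c}. [:-c', 1:])) \<le> N"
      using degree_smult_le order_trans by blast
  qed
  then have BN: "size B \<le> N" using B(1) by simp
  have dB: "Polynomial.degree (\<Prod>b\<in>#B. [:-b, 1:] :: 'k poly) \<le> size B"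
    using B \<open>\<psi> \<noteq> 0\<close> by (metis degree_smult_eq leading_coeff_0_iff order_refl)
  let ?k = "Polynomial.lead_coeff \<psi>"
  have "homogenization N h G \<psi> = mconst ?k * (G ^ (N - size B) * (\<Prod>b\<in>#B. ?D b))"
    using homogenization_degree_add[OF dB, of "N - size B" h G] BN homogenization_linear_prod[of B h G]
    by (subst B(2)) (simp add: homogenization_smult)
  then have 0: "G ^ k * (mconst ?k * (G ^ (N - size B) * (\<Prod>b\<in>#B. ?D b))) \<in> M" using GP \<psi> by simp
  have prodh: "(\<Prod>b\<in>#A. ?D b) \<in> homog n (size A * e)" for A
    by (induction A) (auto simp: add.commute intro!: homog_mult D)
  have "(\<Prod>b\<in>#B. ?D b) \<in> M"
  proof -
    have 1: "G ^ (N - size B) * (\<Prod>b\<in>#B. ?D b) \<in> homog n ((N - size B) * e + size B * e)"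
      by (intro homog_mult Gk prodh)
    have "mconst ?k * (G ^ (N - size B) * (\<Prod>b\<in>#B. ?D b)) \<in> M"
      using M.prime[OF Gk homog_mconst_mult[OF 1] 0] G(2) by blast
    then have "G ^ (N - size B) * (\<Prod>b\<in>#B. ?D b) \<in> M"
      by (rule M.mconst_mult_memD) (use \<open>\<psi> \<noteq> 0\<close> in simp)
    then show ?thesis using M.prime[OF Gk prodh] G(2) by blast
  qed
  moreover have "(\<Prod>b\<in>#A. ?D b) \<notin> M" for A
  proof (induction A)
    case empty show ?case using G(2)[of 0] by simp
  next
    case (add b A)
    then show ?case using M.prime[OF D[of b] prodh[of A]] neg by auto
  qed
  ultimately show False by blast
qed

text \<open>Avoiding the powers of \<open>G = g * mvar i\<close> keeps both \<open>g\<close> and the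
  coordinate \<open>mvar i\<close> out of \<open>M\<close>. Each \<open>mvar j\<close> is then a
  scalar multiple of \<open>mvar i\<close> modulo \<open>M\<close>, and these scalars are the
  coordinates of the zero.\<close>

lemma projective_nullstellensatz:
  fixes Q :: "'k mpoly set"
  assumes Q: "homog_prime_ideal n Q" and i: "i \<le> n" "mvar i \<notin> Q" and g: "g \<in> homog n d" "g \<notin> Q"
  obtains a where "a \<in> hcoords n" "\<And>f. f \<in> Q \<Longrightarrow> meval a f = 0" "meval a g \<noteq> 0"
proof -
  interpret Q: homog_prime_ideal n Q by (rule Q)
  have one: "1 \<notin> Q" using Q.mult[OF _ g(1), of 1] g(2) by auto
  have Ti: "(mvar i :: 'k mpoly) \<in> homog n 1" using i homog_mvar by blast
  define G where "G = g * mvar i"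
  have G: "G \<in> homog n (d + 1)" unfolding G_def by (rule homog_mult[OF g(1) Ti])
  have GQ: "G \<notin> Q" unfolding G_def using Q.prime[OF g(1) Ti] g(2) i(2) by blast
  obtain M where M: "homog_prime_ideal n M" "Q \<subseteq> M" "\<And>m. G ^ m \<notin> M"
    and inv: "\<And>p d'. p \<in> homog n d' \<Longrightarrow> p \<notin> M \<Longrightarrow>
       \<exists>m s d''. s \<in> homog n d'' \<and> d'' + d' = m * (d + 1) \<and> G ^ m - p * s \<in> M"
    using maximal_avoiding[OF Q G GQ one] by metis
  interpret M: homog_prime_ideal n M by (rule M(1))
  have GM: "G \<notin> M" using M(3)[of 1] by simp
  have gM: "g \<notin> M" using M.mult[OF _ Ti, of g] GM by (auto simp: G_def)
  have TM: "mvar i \<notin> M" using M.mult'[OF _ g(1), of "mvar i"] GM by (auto simp: G_def)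
  have oneM: "1 \<notin> M" using M(3)[of 0] by simp
  have "\<exists>c. mvar j - mconst c * mvar i \<in> M" if j: "j \<le> n" for j
  proof -
    have Tj: "(mvar j :: 'k mpoly) \<in> homog n 1" using j homog_mvar by blast
    \<comment> \<open>The residue lemma compares forms of the degree of \<open>G\<close>, so
      \<open>mvar j\<close> is first multiplied by \<open>g\<close>, which is cancelled afterwards
      by primality.\<close>
    obtain c where "g * mvar j - mconst c * G \<in> M"
      using maximal_avoiding_residue[OF M(1) G M(3) inv homog_mult[OF g(1) Tj]] by blast
    then have "g * (mvar j - mconst c * mvar i) \<in> M" by (simp add: G_def algebra_simps)
    then have "mvar j - mconst c * mvar i \<in> M"
      using M.prime[OF g(1) homog_diff[OF Tj homog_mconst_mult[OF Ti]]] gM by blast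
    then show ?thesis by blast
  qed
  then obtain b where b: "\<And>j. j \<le> n \<Longrightarrow> mvar j - mconst (b j) * mvar i \<in> M" by metis
  define a where "a = (\<lambda>j. if j = i then 1 else if j \<le> n then b j else 0)"
  have a: "mvar j - mconst (a j) * mvar i \<in> M" if "j \<le> n" for j
    using b[OF that] that by (auto simp: a_def M.zero)
  have Tp: "(mvar i :: 'k mpoly) ^ k \<in> homog n k" for k using homog_power[OF Ti, of k] by simp
  have TpM: "mvar i ^ k \<notin> M" for k using M.prime_power[OF Ti oneM] TM by blast
  show ?thesis
  proof (rule that[of a])
    show "a \<in> hcoords n" using i by (auto simp: hcoords_def a_def intro!: exI[of _ i])
    fix f assume f: "f \<in> Q"
    then obtain k where k: "f \<in> homog n k" using Q.sub by blast
    have "f - mconst (meval a f) * mvar i ^ k \<in> M" by (rule M.reduce[OF i(1) a k])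
    moreover have "f \<in> M" using f M(2) by blast
    ultimately have "f - (f - mconst (meval a f) * mvar i ^ k) \<in> M"
      using M.diff[OF k homog_diff[OF k homog_mconst_mult[OF Tp]]] by blast
    then have "mconst (meval a f) * mvar i ^ k \<in> M" by simp
    then show "meval a f = 0" using M.mconst_mult_memD TpM[of k] by blast
  next
    have "g - mconst (meval a g) * mvar i ^ d \<in> M" by (rule M.reduce[OF i(1) a g(1)])
    then show "meval a g \<noteq> 0" using gM by auto
  qed
qed


section \<open>Irreducible closed sets given by prime ideals and by points\<close>

definition zero_locus :: "nat \<Rightarrow> 'k mpoly set \<Rightarrow> (nat \<Rightarrow> 'k) set" where
  "zero_locus n Q = {a \<in> hcoords n. \<forall>f\<in>Q. meval a f = 0}"

text \<open>Equations \<open>f\<close> and \<open>g\<close> that separate the locus from two closed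
  subsets lie outside \<open>Q\<close>, so their product does too. The Nullstellensatz gives a point
  of the locus where the product is nonzero, hence a point in neither subset.\<close>

lemma proj_irreducible_zero_locus:
  assumes Q: "homog_prime_ideal n Q" and i: "i \<le> n" "mvar i \<notin> Q"
  shows "proj_irreducible n (zero_locus n Q)"
proof -
  interpret Q: homog_prime_ideal n Q by (rule Q)
  have nz: "\<exists>a\<in>zero_locus n Q. meval a g \<noteq> 0" if "g \<in> homog n d" "g \<notin> Q" for g d
    by (rule projective_nullstellensatz[OF Q i that]) (auto simp: zero_locus_def)
  have "proj_closed n (zero_locus n Q)"
    unfolding proj_closed_def zero_locus_def using Q.sub by blast
  moreover have "zero_locus n Q \<noteq> {}" using nz[OF homog_mvar[OF i(1)] i(2)] by blast
  moreover have "zero_locus n Q = A \<or> zero_locus n Q = B"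
    if AB: "proj_closed n A" "proj_closed n B" "zero_locus n Q = A \<union> B" for A B
  proof (rule ccontr)
    assume neg: "\<not> ?thesis"
    obtain F where F: "F \<subseteq> (\<Union>d. homog n d)" "A = {a \<in> hcoords n. \<forall>f\<in>F. meval a f = 0}"
      using AB(1) unfolding proj_closed_def by blast
    obtain G where G: "G \<subseteq> (\<Union>d. homog n d)" "B = {a \<in> hcoords n. \<forall>f\<in>G. meval a f = 0}"
      using AB(2) unfolding proj_closed_def by blast
    obtain a where a: "a \<in> zero_locus n Q" "a \<notin> A" using neg AB(3) by blast
    obtain b where b: "b \<in> zero_locus n Q" "b \<notin> B" using neg AB(3) by blast
    obtain f d where f: "f \<in> F" "f \<in> homog n d" "meval a f \<noteq> 0" using a F by (auto simp: zero_locus_def)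
    obtain g e where g: "g \<in> G" "g \<in> homog n e" "meval b g \<noteq> 0" using b G by (auto simp: zero_locus_def)
    have "f \<notin> Q" "g \<notin> Q" using a b f g by (auto simp: zero_locus_def)
    then have "f * g \<notin> Q" using Q.prime[OF f(2) g(2)] by blast
    then obtain c where c: "c \<in> zero_locus n Q" "meval c (f * g) \<noteq> 0" using nz[OF homog_mult[OF f(2) g(2)]] by blast
    then have "c \<notin> A" "c \<notin> B" using f(1) g(1) F G by auto
    then show False using c AB(3) by blast
  qed
  ultimately show ?thesis unfolding proj_irreducible_def by blast
qed

text \<open>The punctured line through \<open>p\<close>, described by the vanishing of 2x2 minors,
  which makes it visibly closed.\<close>

definition proj_point :: "nat \<Rightarrow> (nat \<Rightarrow> 'k) \<Rightarrow> (nat \<Rightarrow> 'k) set" where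
  "proj_point n p = {a \<in> hcoords n. \<forall>i\<le>n. \<forall>j\<le>n. p i * a j = p j * a i}"

lemma homog_ideal_vanishing:
  fixes a :: "nat \<Rightarrow> 'k"
  shows "homog_ideal n {f \<in> (\<Union>d. homog n d). meval a f = 0}"
  by unfold_locales (auto intro: homog_add homog_mult homog_0)

text \<open>Follows from \<open>reduce\<close> for the ideal of all forms vanishing at
  \<open>a\<close>: modulo it, coordinate \<open>j\<close> is \<open>p j / p i\<close> times
  coordinate \<open>i\<close>.\<close>

lemma meval_normalized:
  fixes p a :: "nat \<Rightarrow> 'k"
  assumes p: "p i \<noteq> 0" "i \<le> n" and a: "\<And>j. j \<le> n \<Longrightarrow> p i * a j = p j * a i" and f: "f \<in> homog n d"
  shows "meval a f = meval (\<lambda>j. p j / p i) f * a i ^ d"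
proof -
  interpret J: homog_ideal n "{f \<in> (\<Union>d. homog n d). meval a f = 0}" by (rule homog_ideal_vanishing)
  have "mvar j - mconst (p j / p i) * mvar i \<in> {f \<in> (\<Union>d. homog n d). meval a f = 0}" if j: "j \<le> n" for j
  proof -
    have "(mvar j - mconst (p j / p i) * mvar i :: 'k mpoly) \<in> homog n 1"
      by (intro homog_diff homog_mconst_mult homog_mvar j p)
    moreover have "a j - p j / p i * a i = 0" using a[OF j] p by (simp add: field_simps)
    ultimately show ?thesis by auto
  qed
  from J.reduce[OF p(2) this f] show ?thesis by simp
qed

text \<open>By homogeneity a closed set containing \<open>p\<close> contains the whole punctured
  line, so in a decomposition the part that contains \<open>p\<close> is everything.\<close>

lemma proj_irreducible_point:
  assumes p: "p \<in> hcoords n"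
  shows "proj_irreducible n (proj_point n p)" "p \<in> proj_point n p"
proof -
  show pp: "p \<in> proj_point n p" using p by (simp add: proj_point_def mult.commute)
  obtain i where i: "i \<le> n" "p i \<noteq> 0" using p by (auto simp: hcoords_def)
  have ai: "a i \<noteq> 0" if a: "a \<in> proj_point n p" for a
  proof
    assume "a i = 0"
    have "p i * a j = p j * a i" if "j \<le> n" for j using a that i(1) by (simp add: proj_point_def)
    then have "a j = 0" if "j \<le> n" for j using i(2) \<open>a i = 0\<close> that by auto
    then show False using a by (auto simp: proj_point_def hcoords_def)
  qed
  have van: "meval a f = 0" if a: "a \<in> proj_point n p" and b: "b \<in> proj_point n p" and f: "f \<in> homog n d" "meval b f = 0" for a b f d
  proof -
    have "meval b f = meval (\<lambda>j. p j / p i) f * b i ^ d"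
      using b i f by (intro meval_normalized) (auto simp: proj_point_def)
    then have "meval (\<lambda>j. p j / p i) f = 0" using f(2) ai[OF b] by simp
    moreover have "meval a f = meval (\<lambda>j. p j / p i) f * a i ^ d"
      using a i f by (intro meval_normalized) (auto simp: proj_point_def)
    ultimately show ?thesis by simp
  qed
  let ?F = "{mconst (p i) * mvar j - mconst (p j) * mvar i | i j. i \<le> n \<and> j \<le> n}"
  have "?F \<subseteq> (\<Union>d. homog n d)"
  proof
    fix f assume "f \<in> ?F"
    then have "f \<in> homog n 1" by (auto intro!: homog_diff homog_mconst_mult homog_mvar[unfolded One_nat_def])
    then show "f \<in> (\<Union>d. homog n d)" by blast
  qed
  moreover have "proj_point n p = {a \<in> hcoords n. \<forall>f\<in>?F. meval a f = 0}"
  proof -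
    have "(\<forall>f\<in>?F. meval a f = 0) \<longleftrightarrow> (\<forall>i\<le>n. \<forall>j\<le>n. p i * a j = p j * a i)" (is "?L \<longleftrightarrow> ?R") for a
    proof
      assume L: ?L
      show ?R
      proof (intro allI impI)
        fix i j assume "i \<le> n" "j \<le> n"
        then have "mconst (p i) * mvar j - mconst (p j) * mvar i \<in> ?F" by blast
        then have "meval a (mconst (p i) * mvar j - mconst (p j) * mvar i) = 0" using L by blast
        then show "p i * a j = p j * a i" by simp
      qed
    qed auto
    then show ?thesis unfolding proj_point_def by simp
  qed
  ultimately have "proj_closed n (proj_point n p)" unfolding proj_closed_def by blast
  moreover have "proj_point n p = A \<or> proj_point n p = B"
    if AB: "proj_closed n A" "proj_closed n B" "proj_point n p = A \<union> B" for A B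
  proof -
    have "proj_point n p \<subseteq> Y" if Y: "proj_closed n Y" "p \<in> Y" for Y
    proof
      fix a assume a: "a \<in> proj_point n p"
      obtain F where F: "F \<subseteq> (\<Union>d. homog n d)" "Y = {a \<in> hcoords n. \<forall>f\<in>F. meval a f = 0}"
        using Y(1) unfolding proj_closed_def by blast
      have "meval a f = 0" if "f \<in> F" for f using van[OF a pp, of f] F Y(2) that by blast
      then show "a \<in> Y" using a F(2) by (auto simp: proj_point_def)
    qed
    then show ?thesis using AB pp by blast
  qed
  ultimately show "proj_irreducible n (proj_point n p)" unfolding proj_irreducible_def using pp by blast
qed

text \<open>Zorn's lemma gives a maximal family whose finite intersections meet \<open>A\<close> in
  infinite sets. If neither \<open>Y\<close> nor its complement could be added, two finite
  intersections with finite traces on them would combine to one with finite trace on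
  \<open>A\<close>.\<close>

lemma nonprincipal_ultrafilter:
  assumes "infinite (A :: 'b set)"
  obtains \<U> :: "'b set set" where "\<And>F. finite F \<Longrightarrow> F \<subseteq> \<U> \<Longrightarrow> infinite (A \<inter> \<Inter>F)" "\<And>Y. Y \<in> \<U> \<or> - Y \<in> \<U>"
proof -
  define \<F> where "\<F> = {\<U>. \<forall>F. finite F \<and> F \<subseteq> \<U> \<longrightarrow> infinite (A \<inter> \<Inter>F)}"
  have "\<exists>M\<in>\<F>. \<forall>Y\<in>\<F>. M \<subseteq> Y \<longrightarrow> Y = M"
  proof (rule subset_Zorn_nonempty)
    show "\<F> \<noteq> {}" using assms by (auto simp: \<F>_def intro!: exI[of _ "{}"])
    fix \<C> assume \<C>: "\<C> \<noteq> {}" "subset.chain \<F> \<C>"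
    have "infinite (A \<inter> \<Inter>F)" if F: "finite F" "F \<subseteq> \<Union>\<C>" for F
    proof -
      obtain B where "B \<in> \<C>" "F \<subseteq> B"
        using finite_subset_Union_chain[OF F \<C>] .
      then show ?thesis using \<C>(2) F(1) by (auto simp: subset.chain_def \<F>_def)
    qed
    then show "\<Union>\<C> \<in> \<F>" by (auto simp: \<F>_def)
  qed
  then obtain M where M: "M \<in> \<F>" "\<And>Y. Y \<in> \<F> \<Longrightarrow> M \<subseteq> Y \<Longrightarrow> Y = M" by blast
  have inf: "infinite (A \<inter> \<Inter>F)" if "finite F" "F \<subseteq> M" for F using M(1) that by (auto simp: \<F>_def)
  have ex: "\<exists>F. finite F \<and> F \<subseteq> M \<and> finite (A \<inter> \<Inter>F \<inter> Y)" if Y: "Y \<notin> M" for Y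
  proof -
    have "insert Y M \<notin> \<F>" using M(2)[of "insert Y M"] Y by blast
    then obtain F where F: "finite F" "F \<subseteq> insert Y M" "finite (A \<inter> \<Inter>F)" by (auto simp: \<F>_def)
    have "finite (A \<inter> \<Inter>(F - {Y}) \<inter> Y)" using F(3) by (rule finite_subset[rotated]) auto
    then show ?thesis using F by (intro exI[of _ "F - {Y}"]) auto
  qed
  have "Y \<in> M \<or> - Y \<in> M" for Y
  proof (rule ccontr)
    assume "\<not> ?thesis"
    then obtain F F' where F: "finite F" "F \<subseteq> M" "finite (A \<inter> \<Inter>F \<inter> Y)"
      and F': "finite F'" "F' \<subseteq> M" "finite (A \<inter> \<Inter>F' \<inter> - Y)" using ex by meson
    have "finite ((A \<inter> \<Inter>F \<inter> Y) \<union> (A \<inter> \<Inter>F' \<inter> - Y))" using F(3) F'(3) by blast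
    then have "finite (A \<inter> \<Inter>(F \<union> F'))" by (rule finite_subset[rotated]) auto
    then show False using inf[of "F \<union> F'"] F F' by blast
  qed
  then show ?thesis using that inf by blast
qed

end


section \<open>Zeros of forms on the analytification of a curve\<close>

lemma compact_imp_closed_fun:
  fixes K :: "('a \<Rightarrow> 'b::metric_space) set"
  assumes "compact K"
  shows "closed K"
proof -
  have "Hausdorff_space (product_topology (\<lambda>_::'a. euclidean :: 'b topology) UNIV)"
    by (simp add: Hausdorff_space_product_topology Hausdorff_space_euclidean)
  then have "closedin (product_topology (\<lambda>_::'a. euclidean :: 'b topology) UNIV) K"
    using assms by (intro compactin_imp_closedin) (simp_all add: euclidean_product_topology compactin_euclidean_iff)
  then show ?thesis by (simp add: euclidean_product_topology)
qed

lemma (in graded_berk_space) point_eq_if_diff_zero: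
  assumes x: "x \<in> points S" and f: "f \<in> H d" and g: "g \<in> H d" and z: "x (f - g) = 0"
  shows "x f = x g"
proof -
  have "x f \<le> max (x (f - g)) (x g)" using point_add[OF x diff_mem[OF f g] g] by simp
  moreover have "x g \<le> max (x (f - g)) (x f)"
    using point_add[OF x uminus_mem[OF diff_mem[OF f g]] f] point_uminus[OF x diff_mem[OF f g]] by simp
  ultimately show ?thesis using z point_nonneg[OF x] by (metis antisym max_def)
qed

context nonarch_field
begin

lemma points_analytification [simp]: "points (analytification v n Z) = proj_points v n Z"
  and fractions_analytification [simp]: "fractions (analytification v n Z) = (\<Union>d. homog n d \<times> homog n d)"
  by (simp_all add: analytification_def)

sublocale proj: graded_berk_space "analytification v n Z" "homog n" for n Z
proof
  have const: "x (mconst c) = v c" if "x \<in> proj_points v n Z" for x c using that by (simp add: proj_points_def)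
  show "x 0 = 0" if "x \<in> points (analytification v n Z)" for x using const[of x 0] that by simp
  show "x 1 = 1" if "x \<in> points (analytification v n Z)" for x using const[of x 1] that by simp
qed (auto simp: proj_points_def intro: homog_add homog_uminus homog_mult)

lemma proj_const: "x \<in> proj_points v n Z \<Longrightarrow> x (mconst c) = v c"
  and proj_hideal: "x \<in> proj_points v n Z \<Longrightarrow> f \<in> hideal n Z \<Longrightarrow> x f = 0"
  and proj_not_homog: "x \<in> proj_points v n Z \<Longrightarrow> f \<notin> (\<Union>d. homog n d) \<Longrightarrow> x f = 0"
  and proj_Max: "x \<in> proj_points v n Z \<Longrightarrow> Max ((\<lambda>i. x (mvar i)) ` {..n}) = 1"
  by (simp_all add: proj_points_def)

lemma proj_coord_le: "x \<in> proj_points v n Z \<Longrightarrow> i \<le> n \<Longrightarrow> x (mvar i) \<le> 1"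
  using proj_Max[of x n Z] Max_ge[of "(\<lambda>i. x (mvar i)) ` {..n}" "x (mvar i)"] by simp

lemma proj_coord_eq_1: "x \<in> proj_points v n Z \<Longrightarrow> \<exists>i\<le>n. x (mvar i) = 1"
  using proj_Max[of x n Z] Max_in[of "(\<lambda>i. x (mvar i)) ` {..n}"] by fastforce

lemma homog_ideal_kernel:
  assumes x: "x \<in> proj_points v n Z"
  shows "homog_ideal n {f \<in> (\<Union>d. homog n d). x f = 0}"
proof
  have x': "x \<in> points (analytification v n Z)" using x by simp
  show "0 \<in> {f \<in> (\<Union>d. homog n d). x f = 0}" using proj.point_0[OF x'] by auto
  show "f + g \<in> {f \<in> (\<Union>d. homog n d). x f = 0}"
    if "f \<in> homog n d" "g \<in> homog n d" "f \<in> {f \<in> (\<Union>d. homog n d). x f = 0}" "g \<in> {f \<in> (\<Union>d. homog n d). x f = 0}" for f g d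
    using that proj.point_add[OF x' that(1,2)] proj.point_nonneg[OF x', of "f + g"] homog_add[OF that(1,2)] by auto
  show "f * g \<in> {f \<in> (\<Union>d. homog n d). x f = 0}"
    if "f \<in> {f \<in> (\<Union>d. homog n d). x f = 0}" "g \<in> homog n d" for f g d
    using that proj.point_mult[OF x' _ that(2)] homog_mult[OF _ that(2)] by fastforce
qed auto

text \<open>\<open>Q\<close> consists of the forms that vanish at almost all zeros of
  \<open>f\<close>, in the sense of the ultrafilter. A chain from a point through a larger zero
  locus of \<open>Q\<close> to \<open>Z\<close> contradicts dimension one, so this locus is a point,
  and the finitely many linear forms cutting it out lie in \<open>Q\<close>. Hence infinitely many
  seminorms kill all of them, whereas at most one normalized seminorm can do so.\<close>

lemma finite_zeros:
  assumes C: "proj_irreducible n Z" "proj_dim n Z 1" and f: "f \<in> homog n d" "f \<notin> hideal n Z"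
  shows "finite {x \<in> proj_points v n Z. x f = 0}"
proof (rule ccontr)
  define A where "A = {x \<in> proj_points v n Z. x f = 0}"
  assume "infinite {x \<in> proj_points v n Z. x f = 0}"
  then have "infinite A" by (simp add: A_def)
  then obtain U where inf: "\<And>F. finite F \<Longrightarrow> F \<subseteq> U \<Longrightarrow> infinite (A \<inter> \<Inter>F)" and em: "\<And>Y. Y \<in> U \<or> - Y \<in> U"
    using nonprincipal_ultrafilter[of A] by metis
  \<comment> \<open>A set containing the trace on \<open>A\<close> of a finite intersection belongs
    to \<open>U\<close>; otherwise its complement would, leaving an empty intersection with
    \<open>A\<close>.\<close>
  have up: "Y \<in> U" if "finite F" "F \<subseteq> U" "A \<inter> \<Inter>F \<subseteq> Y" for F Y
  proof (rule ccontr)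
    assume "Y \<notin> U"
    then have "infinite (A \<inter> \<Inter>(insert (- Y) F))" using em that by (intro inf) auto
    moreover have "A \<inter> \<Inter>(insert (- Y) F) = {}" using that by auto
    ultimately show False by simp
  qed
  have Ap: "x \<in> proj_points v n Z" if "x \<in> A" for x using that by (simp add: A_def)
  let ?V = "\<lambda>g :: 'k mpoly. {x. x g = (0::real)}"
  define Q where "Q = {g \<in> (\<Union>d. homog n d). ?V g \<in> U}"
  have QI: "g \<in> Q" if "g \<in> homog n e" "?V g \<in> U" for g e using that by (auto simp: Q_def)
  note pm = proj.point_mult[unfolded points_analytification] and pn = proj.point_nonneg[unfolded points_analytification]
    and pa = proj.point_add[unfolded points_analytification] and p0 = proj.point_0[unfolded points_analytification]
    and p1 = proj.point_1[unfolded points_analytification]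
  have Q: "homog_prime_ideal n Q"
  proof
    show "Q \<subseteq> (\<Union>d. homog n d)" by (auto simp: Q_def)
    show "0 \<in> Q" using up[of "{}" "?V 0"] Ap p0 by (intro QI[of _ 0]) auto
    fix g h :: "'k mpoly" and e assume g: "g \<in> homog n e" and h: "h \<in> homog n e" and gQ: "g \<in> Q" and hQ: "h \<in> Q"
    have "A \<inter> \<Inter>{?V g, ?V h} \<subseteq> ?V (g + h)"
    proof
      fix x assume x: "x \<in> A \<inter> \<Inter>{?V g, ?V h}"
      then show "x \<in> ?V (g + h)" using pa[OF Ap g h, of x] pn[OF Ap, of x "g + h"] by auto
    qed
    then show "g + h \<in> Q" using gQ hQ homog_add[OF g h] up[of "{?V g, ?V h}" "?V (g + h)"] by (auto simp: Q_def)
  next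
    fix g h :: "'k mpoly" and e assume gQ: "g \<in> Q" and h: "h \<in> homog n e"
    obtain k where g: "g \<in> homog n k" using gQ by (auto simp: Q_def)
    have "A \<inter> \<Inter>{?V g} \<subseteq> ?V (g * h)"
    proof
      fix x assume "x \<in> A \<inter> \<Inter>{?V g}"
      then show "x \<in> ?V (g * h)" using pm[OF Ap g h, of x] by auto
    qed
    then show "g * h \<in> Q" using gQ homog_mult[OF g h] up[of "{?V g}" "?V (g * h)"] by (auto simp: Q_def)
  next
    fix g :: "'k mpoly" and k and h :: "'k mpoly" and e assume g: "g \<in> homog n k" and h: "h \<in> homog n e" and gh: "g * h \<in> Q"
    show "g \<in> Q \<or> h \<in> Q"
    proof (rule ccontr)
      assume "\<not> ?thesis"
      then have "?V g \<notin> U" "?V h \<notin> U" using g h QI by auto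
      then have "- ?V g \<in> U" "- ?V h \<in> U" using em by auto
      then have "infinite (A \<inter> \<Inter>{- ?V g, - ?V h, ?V (g * h)})" using gh by (intro inf) (auto simp: Q_def)
      then obtain x where "x \<in> A \<inter> \<Inter>{- ?V g, - ?V h, ?V (g * h)}" by (metis ex_in_conv finite.emptyI)
      then show False using pm[OF Ap g h, of x] by auto
    qed
  qed
  interpret Q: homog_prime_ideal n Q by (rule Q)
  \<comment> \<open>Otherwise some point of \<open>A\<close> would kill all coordinates, against the
    normalization.\<close>
  have "\<exists>i\<le>n. mvar i \<notin> Q"
  proof (rule ccontr)
    assume "\<not> ?thesis"
    then have "infinite (A \<inter> \<Inter>((\<lambda>i. ?V (mvar i)) ` {..n}))" by (intro inf) (auto simp: Q_def)
    then obtain x where "x \<in> A \<inter> \<Inter>((\<lambda>i. ?V (mvar i)) ` {..n})" by (metis ex_in_conv finite.emptyI)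
    then show False using proj_coord_eq_1[OF Ap, of x] by auto
  qed
  then obtain i where i: "i \<le> n" "mvar i \<notin> Q" by blast
  have irr: "proj_irreducible n (zero_locus n Q)" by (rule proj_irreducible_zero_locus[OF Q i])
  have hQ: "hideal n Z \<subseteq> Q"
  proof
    fix g assume g: "g \<in> hideal n Z"
    then have "?V g \<in> U" using up[of "{}" "?V g"] proj_hideal[OF Ap g] by auto
    then show "g \<in> Q" using g by (auto simp: Q_def hideal_def)
  qed
  have "zero_locus n Q \<subseteq> Z"
  proof
    fix a assume a: "a \<in> zero_locus n Q"
    have "proj_closed n Z" using C(1) by (simp add: proj_irreducible_def)
    then obtain F where F: "F \<subseteq> (\<Union>d. homog n d)" "Z = {a \<in> hcoords n. \<forall>f\<in>F. meval a f = 0}"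
      unfolding proj_closed_def by blast
    then have "F \<subseteq> Q" using hQ by (auto simp: hideal_def)
    then show "a \<in> Z" using a F by (auto simp: zero_locus_def)
  qed
  moreover have "zero_locus n Q \<noteq> Z"
  proof -
    obtain a where a: "a \<in> Z" "meval a f \<noteq> 0" using f by (auto simp: hideal_def)
    have "?V f \<in> U" using up[of "{}" "?V f"] by (auto simp: A_def)
    then have "f \<in> Q" using f(1) QI by blast
    then show ?thesis using a by (auto simp: zero_locus_def)
  qed
  ultimately have QZ: "zero_locus n Q \<subset> Z" by blast
  have "zero_locus n Q \<noteq> {}" using irr by (simp add: proj_irreducible_def)
  then obtain p where p: "p \<in> zero_locus n Q" by blast
  then have ph: "p \<in> hcoords n" by (simp add: zero_locus_def)
  note ppt = proj_irreducible_point[OF ph]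
  obtain i1 where i1: "i1 \<le> n" "p i1 \<noteq> 0" using ph by (auto simp: hcoords_def)
  have sub: "proj_point n p \<subseteq> zero_locus n Q"
  proof
    fix a assume a: "a \<in> proj_point n p"
    have "meval a g = 0" if g: "g \<in> Q" for g
    proof -
      obtain k where k: "g \<in> homog n k" using g Q.sub by blast
      have "meval p g = meval (\<lambda>j. p j / p i1) g * p i1 ^ k"
        using i1 k by (intro meval_normalized) auto
      moreover have "meval p g = 0" using p g by (simp add: zero_locus_def)
      ultimately have "meval (\<lambda>j. p j / p i1) g = 0" using i1 by simp
      moreover have "meval a g = meval (\<lambda>j. p j / p i1) g * a i1 ^ k"
        using a i1 k by (intro meval_normalized) (auto simp: proj_point_def)
      ultimately show ?thesis by simp
    qed
    then show "a \<in> zero_locus n Q" using a by (simp add: zero_locus_def proj_point_def)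
  qed
  have eq: "proj_point n p = zero_locus n Q"
  proof (rule ccontr)
    assume "\<not> ?thesis"
    then have "proj_point n p \<subset> zero_locus n Q" using sub by blast
    then have "proj_chain n Z (Suc 1) (\<lambda>i. if i = 0 then proj_point n p else if i = 1 then zero_locus n Q else Z)"
      using ppt irr C(1) QZ by (auto simp: proj_chain_def less_Suc_eq)
    then show False using C(2) unfolding proj_dim_def by blast
  qed
  define b where "b = (\<lambda>j. p j / p i1)"
  let ?g = "\<lambda>j. mvar j - mconst (b j) * mvar i1"
  have gh: "?g j \<in> homog n 1" if "j \<le> n" for j by (intro homog_diff homog_mconst_mult homog_mvar that i1)
  have gQ: "?g j \<in> Q" if j: "j \<le> n" for j
  proof (rule ccontr)
    assume "?g j \<notin> Q"
    then obtain a where "a \<in> hcoords n" "\<And>f. f \<in> Q \<Longrightarrow> meval a f = 0" "meval a (?g j) \<noteq> 0"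
      using projective_nullstellensatz[OF Q i gh[OF j]] by blast
    then have "a \<in> proj_point n p" "a j - b j * a i1 \<noteq> 0" unfolding eq by (auto simp: zero_locus_def)
    then show False using i1 j by (auto simp: proj_point_def b_def field_simps)
  qed
  let ?B = "A \<inter> \<Inter>((\<lambda>j. ?V (?g j)) ` {..n})"
  have infB: "infinite ?B" using gQ by (intro inf) (auto simp: Q_def)
  \<comment> \<open>The linear forms reduce every form to a multiple of a power of coordinate
    \<open>i1\<close>, so \<open>x (mvar i1)\<close> is the only freedom left. The normalization
    fixes it next.\<close>
  have val: "x h = v (meval b h) * x (mvar i1) ^ k" if x: "x \<in> ?B" and h: "h \<in> homog n k" for x h k
  proof -
    have xp: "x \<in> proj_points v n Z" using x Ap by blast
    interpret K: homog_ideal n "{f \<in> (\<Union>d. homog n d). x f = 0}" by (rule homog_ideal_kernel[OF xp])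
    have "?g j \<in> {f \<in> (\<Union>d. homog n d). x f = 0}" if "j \<le> n" for j using gh[OF that] x that by auto
    from K.reduce[OF i1(1) this h] have "x (h - mconst (meval b h) * mvar i1 ^ k) = 0" by simp
    moreover have T: "(mvar i1 :: 'k mpoly) ^ k' \<in> homog n k'" for k' using homog_power[OF homog_mvar[OF i1(1)], of k'] by simp
    ultimately have "x h = x (mconst (meval b h) * mvar i1 ^ k)"
      using proj.point_eq_if_diff_zero[OF _ h homog_mconst_mult[OF T]] xp by simp
    also have "\<dots> = v (meval b h) * x (mvar i1 ^ k)"
      using pm[OF xp homog_mconst T] proj_const[OF xp] by simp
    also have "x (mvar i1 ^ k) = x (mvar i1) ^ k"
    proof (induction k)
      case (Suc k)
      then show ?case using pm[OF xp homog_mvar[OF i1(1)] T] by simp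
    qed (use p1[OF xp] in simp)
    finally show ?thesis .
  qed
  have "x = y" if x: "x \<in> ?B" and y: "y \<in> ?B" for x y
  proof -
    have le: "y (mvar i1) \<le> x (mvar i1)" if x: "x \<in> ?B" and y: "y \<in> ?B" for x y
    proof -
      obtain j where j: "j \<le> n" "x (mvar j) = 1" using proj_coord_eq_1[OF Ap] x by blast
      have "v (b j) * y (mvar i1) \<le> v (b j) * x (mvar i1)"
        using val[OF x homog_mvar[OF j(1)]] val[OF y homog_mvar[OF j(1)]] j proj_coord_le[OF Ap j(1), of y] y by simp
      moreover have "v (b j) \<noteq> 0" using val[OF x homog_mvar[OF j(1)]] j by auto
      ultimately show ?thesis by (simp add: mult_le_cancel_left less_le)
    qed
    have "x h = y h" for h
    proof (cases "h \<in> (\<Union>d. homog n d)")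
      case True
      then obtain k where "h \<in> homog n k" by blast
      then show ?thesis using val[OF x] val[OF y] le[OF x y] le[OF y x] by simp
    next
      case False
      then show ?thesis using proj_not_homog[OF Ap, of x h] proj_not_homog[OF Ap, of y h] x y by simp
    qed
    then show ?thesis by blast
  qed
  then have "?B \<subseteq> {SOME x. x \<in> ?B}" using someI[of "\<lambda>x. x \<in> ?B"] by blast
  then show False using infB finite_subset by blast
qed


end

section \<open>Preimages under the retraction\<close>

text \<open>The library has this for normed spaces only.\<close>

lemma simply_connected_imp_connected':
  fixes S :: "'b::topological_space set"
  assumes "simply_connected S"
  shows "connected S"
proof -
  have "path_component_of (top_of_set S) a b" if ab: "a \<in> S" "b \<in> S" for a b
  proof -
    have c: "path (\<lambda>_. c)" for c :: 'b by (simp add: path_def)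
    have "homotopic_loops S (\<lambda>_. a) (\<lambda>_. b)"
      using assms ab c unfolding simply_connected_def
      by (auto simp: pathfinish_def pathstart_def path_image_def)
    then have "homotopic_with (\<lambda>_. True) (top_of_set {0..1::real}) (top_of_set S) (\<lambda>_. a) (\<lambda>_. b)"
      unfolding homotopic_loops_def by (rule homotopic_with_mono) auto
    moreover have "top_of_set {0..1::real} \<noteq> trivial_topology"
      using null_topspace_iff_trivial[of "top_of_set {0..1::real}"] by simp
    ultimately show ?thesis using homotopic_constant_maps[of "top_of_set {0..1::real}" "top_of_set S" a b] by simp
  qed
  then have "path_connected_space (top_of_set S)"
    by (simp add: path_connected_space_iff_path_component)
  then have "connected_space (top_of_set S)" by (rule path_connected_imp_connected_space)
  then show ?thesis by (simp add: connectedin_def flip: connectedin_iff_connected)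
qed

lemma finite_real_if_no_chain_of_three:
  fixes B :: "real set"
  assumes "\<And>a b c. a \<in> B \<Longrightarrow> b \<in> B \<Longrightarrow> c \<in> B \<Longrightarrow> a < b \<Longrightarrow> b < c \<Longrightarrow> False"
  shows "finite B"
proof (rule ccontr)
  assume "infinite B"
  then obtain T where T: "T \<subseteq> B" "finite T" "card T = 3" using infinite_arbitrarily_large by blast
  then obtain x y z where "T = {x, y, z}" "x \<noteq> y" "y \<noteq> z" "x \<noteq> z" by (auto simp: card_3_iff)
  then show False using T(1) assms by (metis insert_subset linorder_neqE_linordered_idom)
qed

lemma frontier_of_Int_open:
  assumes "openin E D" "D \<subseteq> V \<or> D \<inter> V = {}"
  shows "D \<inter> E frontier_of V = {}"
proof -
  have "D \<inter> E closure_of V = {}" if "D \<inter> V = {}" using assms(1) that openin_Int_closure_of_eq_empty by blast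
  moreover have "D \<subseteq> E interior_of V" if "D \<subseteq> V" using that assms(1) by (simp add: interior_of_maximal)
  ultimately show ?thesis using assms(2) by (auto simp: frontier_of_def)
qed

lemma open_nbhd_meets_frontier:
  assumes "openin E N" "x \<in> N" "x \<in> E frontier_of V"
  shows "\<exists>z\<in>N. z \<in> V" "\<exists>z\<in>N. z \<notin> V"
  using frontier_of_Int_open[OF assms(1), of V] assms(2,3) by blast+

lemma (in nonarch_field) continuous_on_chart_T:
  assumes "homeomorphism A U \<phi> \<psi>"
  shows "continuous_on A (\<lambda>x. \<phi> x h :: real)"
  using assms continuous_on_product_then_coordinatewise[of A \<phi> h] by (simp add: homeomorphism_def)

lemma openin_chart_preimage:
  fixes f :: "'b::topological_space \<Rightarrow> real"
  assumes "continuous_on A f" "openin (top_of_set S) A" "open B"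
  shows "openin (top_of_set S) {x \<in> A. f x \<in> B}"
proof -
  have "openin (top_of_set A) (A \<inter> f -` B)" using assms continuous_openin_preimage_gen by blast
  moreover have "A \<inter> f -` B = {x \<in> A. f x \<in> B}" by auto
  ultimately show ?thesis using openin_trans[OF _ assms(2)] by metis
qed

context nonarch_field
begin

text \<open>The retraction of a point depends only on its radius |T|, so inside \<open>A\<close> the
  set \<open>V\<close> is the preimage of a set \<open>J\<close> of radii. The radius is locally
  constant off the skeleton; hence boundary points of \<open>V\<close> lie on the skeleton, over
  boundary points of \<open>J\<close>.\<close>

lemma annulus_frontier_finite:
  assumes iso: "analytic_iso S A (affine_line v) (std_annulus v r1 r2) \<phi>" and r: "0 < r1"
    and \<Sigma>: "openin (top_of_set \<Sigma>) W" "connected W" "\<Sigma> \<subseteq> points S" "\<Sigma> \<inter> A = {x \<in> A. \<phi> x \<in> std_skeleton v r1 r2}"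
    and V: "V \<inter> A = {x \<in> A. inv_into A \<phi> (sup_point v (\<phi> x [:0, 1:])) \<in> W}"
  shows "finite (A \<inter> top_of_set (points S) frontier_of V)"
proof -
  let ?X = "top_of_set (points S)" and ?U = "std_annulus v r1 r2"
  have A: "openin ?X A" using iso by (simp add: analytic_iso_def)
  obtain \<psi> where hom: "homeomorphism A ?U \<phi> \<psi>" using iso unfolding analytic_iso_def by blast
  have \<psi>: "continuous_on ?U \<psi>" "\<psi> ` ?U = A" "\<phi> ` A = ?U" "\<And>x. x \<in> A \<Longrightarrow> \<psi> (\<phi> x) = x" "\<And>y. y \<in> ?U \<Longrightarrow> \<phi> (\<psi> y) = y"
    using hom by (auto simp: homeomorphism_def)
  define g where "g = (\<lambda>\<rho>. \<psi> (zeta 0 \<rho>))"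
  define t where "t = (\<lambda>x. \<phi> x [:0, 1:])"
  have z: "zeta 0 \<rho> \<in> ?U" if "r1 < \<rho>" "\<rho> < r2" for \<rho> using that r by (simp add: std_annulus_def zeta_in_line)
  have gA: "g \<rho> \<in> A" and tg: "t (g \<rho>) = \<rho>" if "r1 < \<rho>" "\<rho> < r2" for \<rho>
    using z[OF that] \<psi> that r by (auto simp: g_def t_def)
  have gcont: "continuous_on {r1<..<r2} g" unfolding g_def
  proof (rule continuous_on_compose2[OF \<psi>(1)])
    show "continuous_on {r1<..<r2} (zeta 0)" by (rule continuous_on_subset[OF continuous_on_zeta]) (use r in auto)
  qed (use z in auto)
  have tcont: "continuous_on A t" unfolding t_def by (rule continuous_on_chart_T[OF hom])
  have tA: "r1 < t x" "t x < r2" if "x \<in> A" for x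
    using that \<psi>(3) by (auto simp: t_def std_annulus_def)
  have inv: "inv_into A \<phi> (zeta 0 \<rho>) = g \<rho>" if "r1 < \<rho>" "\<rho> < r2" for \<rho>
  proof (rule inv_into_f_eq)
    show "inj_on \<phi> A" using \<psi>(4) by (metis inj_onI)
  qed (use gA[OF that] z[OF that] \<psi>(5) in \<open>auto simp: g_def\<close>)
  have V': "x \<in> V \<longleftrightarrow> g (t x) \<in> W" if x: "x \<in> A" for x
  proof -
    have "x \<in> V \<longleftrightarrow> x \<in> V \<inter> A" using x by simp
    also have "\<dots> \<longleftrightarrow> inv_into A \<phi> (sup_point v (t x)) \<in> W" unfolding V t_def using x by simp
    also have "inv_into A \<phi> (sup_point v (t x)) = g (t x)"
      unfolding sup_point_eq_zeta by (rule inv[OF tA[OF x]])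
    finally show ?thesis .
  qed
  define J where "J = {\<rho> \<in> {r1<..<r2}. g \<rho> \<in> W}"
  have g\<Sigma>: "g \<rho> \<in> \<Sigma>" if "r1 < \<rho>" "\<rho> < r2" for \<rho>
  proof -
    have "\<phi> (g \<rho>) \<in> std_skeleton v r1 r2"
      using \<psi>(5)[OF z[OF that]] that by (auto simp: g_def std_skeleton_def sup_point_eq_zeta)
    then show ?thesis using \<Sigma>(4) gA[OF that] by blast
  qed
  have skel: "x = g (t x)" if x: "x \<in> \<Sigma>" "x \<in> A" for x
  proof -
    have "\<phi> x \<in> std_skeleton v r1 r2" using x \<Sigma>(4) by blast
    then obtain \<rho> where \<rho>: "r1 < \<rho>" "\<rho> < r2" "\<phi> x = zeta 0 \<rho>"
      by (auto simp: std_skeleton_def sup_point_eq_zeta)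
    then have "t x = \<rho>" using r by (simp add: t_def)
    then show ?thesis using \<rho> \<psi>(4)[OF x(2)] by (simp add: g_def)
  qed
  obtain O' where O': "open O'" "W = \<Sigma> \<inter> O'" using \<Sigma>(1) by (auto simp: openin_open)
  have "J = {r1<..<r2} \<inter> g -` O'" using O'(2) g\<Sigma> by (auto simp: J_def)
  then have Jopen: "open J" using continuous_open_preimage[OF gcont open_greaterThanLessThan O'(1)] by simp
  \<comment> \<open>The part of \<open>W\<close> over \<open>{a<..<b}\<close> is open in
    \<open>W\<close> and also closed, as \<open>a\<close> and \<open>b\<close> are not in
    \<open>J\<close> and the arc over \<open>{a..b}\<close> is compact. Connectedness puts all of
    \<open>W\<close> there. Without such \<open>a\<close> and \<open>b\<close>, \<open>J\<close> may
    be disconnected, since \<open>W\<close> can leave the annulus at both ends.\<close>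
  have trap: "J \<subseteq> {a<..<b}" if ab: "a \<in> {r1<..<r2}" "b \<in> {r1<..<r2}" "a \<notin> J" "b \<notin> J" "J \<inter> {a<..<b} \<noteq> {}" for a b
  proof -
    let ?W = "W \<inter> {x \<in> A. t x \<in> {a<..<b}}"
    have "openin ?X {x \<in> A. t x \<in> {a<..<b}}" by (rule openin_chart_preimage[OF tcont A]) simp
    then obtain T where T: "open T" "{x \<in> A. t x \<in> {a<..<b}} = points S \<inter> T" by (auto simp: openin_open)
    have "W \<subseteq> points S" using \<Sigma> openin_imp_subset by blast
    then have "?W = W \<inter> T" using T(2) by blast
    then have 1: "openin (top_of_set W) ?W" using T(1) by (auto simp: openin_open)
    have "{a..b} \<subseteq> {r1<..<r2}" using ab(1,2) by auto
    then have "compact (g ` {a..b})" using gcont by (intro compact_continuous_image) (auto intro: continuous_on_subset)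
    then have "closed (g ` {a..b})" by (rule compact_imp_closed_fun)
    moreover have "?W = W \<inter> g ` {a..b}"
    proof
      show "?W \<subseteq> W \<inter> g ` {a..b}"
      proof
        fix x assume x: "x \<in> ?W"
        then have "x = g (t x)" using skel O'(2) by blast
        then show "x \<in> W \<inter> g ` {a..b}" using x by auto
      qed
      show "W \<inter> g ` {a..b} \<subseteq> ?W"
      proof
        fix x assume x: "x \<in> W \<inter> g ` {a..b}"
        then obtain \<rho> where \<rho>: "\<rho> \<in> {a..b}" "x = g \<rho>" by blast
        have \<rho>r: "r1 < \<rho>" "\<rho> < r2" using \<rho> ab by auto
        then have "\<rho> \<in> J" using x \<rho> by (simp add: J_def)
        then have "\<rho> \<noteq> a" "\<rho> \<noteq> b" using ab by auto
        then show "x \<in> ?W" using x \<rho> gA[OF \<rho>r] tg[OF \<rho>r] by auto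
      qed
    qed
    ultimately have 2: "closedin (top_of_set W) ?W" by (auto simp: closedin_closed)
    obtain \<rho> where \<rho>: "\<rho> \<in> J" "a < \<rho>" "\<rho> < b" using ab(5) by auto
    then have "g \<rho> \<in> ?W" using gA tg by (auto simp: J_def)
    then have W: "?W = W" using \<Sigma>(2) 1 2 unfolding connected_clopen by blast
    show ?thesis
    proof
      fix \<rho> assume \<rho>: "\<rho> \<in> J"
      then have "g \<rho> \<in> ?W" unfolding W by (simp add: J_def)
      then show "\<rho> \<in> {a<..<b}" using \<rho> tg[of \<rho>] by (auto simp: J_def)
    qed
  qed
  let ?B = "(closure J - J) \<inter> {r1<..<r2}"
  have cl: "\<exists>u\<in>J. \<bar>u - x\<bar> < e" if "x \<in> closure J" "0 < e" for x e
    using that by (auto simp: closure_approachable dist_real_def)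
  have "finite ?B"
  proof (rule finite_real_if_no_chain_of_three)
    fix a b c assume a: "a \<in> ?B" and b: "b \<in> ?B" and c: "c \<in> ?B" and abc: "a < b" "b < c"
    obtain u where u: "u \<in> J" "\<bar>u - b\<bar> < min (b - a) (c - b)" using cl[of b "min (b - a) (c - b)"] b abc by auto
    then have "u \<noteq> b" using b by auto
    \<comment> \<open>\<open>J\<close> comes close to \<open>b\<close> from one side, so
      \<open>trap\<close> confines it to that side, and the outer boundary radius on the other side
      cannot be approached.\<close>
    then consider "u \<in> J \<inter> {a<..<b}" | "u \<in> J \<inter> {b<..<c}" using u by (fastforce simp: abs_if split: if_splits)
    then show False
    proof cases
      case 1
      then have "J \<subseteq> {a<..<b}" using a b by (intro trap) auto
      moreover obtain u where "u \<in> J" "\<bar>u - c\<bar> < c - b" using cl[of c "c - b"] c abc by auto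
      ultimately show False by (force simp: subset_iff abs_less_iff)
    next
      case 2
      then have "J \<subseteq> {b<..<c}" using b c by (intro trap) auto
      moreover obtain u where "u \<in> J" "\<bar>u - a\<bar> < b - a" using cl[of a "b - a"] a abc by auto
      ultimately show False by (force simp: subset_iff abs_less_iff)
    qed
  qed
  moreover have "A \<inter> ?X frontier_of V \<subseteq> g ` ?B"
  proof
    fix x assume x: "x \<in> A \<inter> ?X frontier_of V"
    then have xA: "x \<in> A" and xf: "x \<in> ?X frontier_of V" by auto
    let ?\<rho> = "t x"
    have \<rho>: "r1 < ?\<rho>" "?\<rho> < r2" using tA[OF xA] .
    have nbhd: "(\<exists>z\<in>A. t z \<in> B \<and> z \<in> V) \<and> (\<exists>z\<in>A. t z \<in> B \<and> z \<notin> V)" if "open B" "?\<rho> \<in> B" for B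
      using open_nbhd_meets_frontier[OF openin_chart_preimage[OF tcont A that(1)] _ xf] xA that(2) by blast
    have "?\<rho> \<notin> J"
    proof
      assume "?\<rho> \<in> J"
      then obtain z where "z \<in> A" "t z \<in> J" "z \<notin> V" using nbhd[OF Jopen] by blast
      then show False using V' by (auto simp: J_def)
    qed
    moreover have "?\<rho> \<in> closure J"
    proof (rule ccontr)
      assume "?\<rho> \<notin> closure J"
      then obtain z where z: "z \<in> A" "t z \<notin> closure J" "z \<in> V" using nbhd[of "- closure J"] by auto
      then have "t z \<in> J" using V' tA by (auto simp: J_def)
      then show False using z(2) closure_subset by blast
    qed
    moreover have "\<phi> x = zeta 0 ?\<rho>"
    proof (rule ccontr)
      assume ne: "\<phi> x \<noteq> zeta 0 ?\<rho>"
      have line: "\<phi> w \<in> line_points v" if "w \<in> A" for w using that \<psi>(3) by (auto simp: std_annulus_def)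
      \<comment> \<open>Off the skeleton some \<open>c\<close> is nearer to the point than 0 is. On
        the open set |T - c| < |c| the radius is constantly |c|, so a point of \<open>V\<close> in
        it already puts the radius into \<open>J\<close>.\<close>
      obtain c where c: "\<phi> x [:-c, 1:] < ?\<rho>"
        using line_eq_zeta_0[OF line[OF xA]] ne unfolding t_def by (metis not_le)
      have tz: "t w = v c" if "w \<in> A" "\<phi> w [:-c, 1:] < v c" for w
        using line_linear_triangle[OF line[OF that(1)], of 0 c] line_linear_triangle2[OF line[OF that(1)], of c 0] that(2)
        by (simp add: t_def)
      have vc: "v c = ?\<rho>"
        using line_linear_triangle[OF line[OF xA], of 0 c] line_linear_triangle2[OF line[OF xA], of c 0] c
        by (simp add: t_def)
      have N: "openin ?X {w \<in> A. \<phi> w [:-c, 1:] \<in> {..<v c}}"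
        by (rule openin_chart_preimage[OF continuous_on_chart_T[OF hom] A]) simp
      obtain w where "w \<in> A" "\<phi> w [:-c, 1:] < v c" "w \<in> V"
        using open_nbhd_meets_frontier(1)[OF N _ xf] xA c vc by auto
      then have "?\<rho> \<in> J" using tz V' vc \<rho> by (auto simp: J_def)
      then show False using \<open>?\<rho> \<notin> J\<close> by blast
    qed
    then have "x = g ?\<rho>" using \<psi>(4)[OF xA] by (simp add: g_def)
    ultimately show "x \<in> g ` ?B" using \<rho> by auto
  qed
  ultimately show ?thesis by (meson finite_imageI finite_subset)
qed

text \<open>On a disc component the retraction is constant, so the component lies in
  \<open>V\<close> or misses it and, being open, contains no boundary point. Finitely many vertices
  and annuli remain.\<close>

lemma retraction_preimage_frontier_finite:
  assumes V: "retraction_preimage v S V0 P W V"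
  shows "finite (top_of_set (points S) frontier_of V)"
proof -
  let ?X = "top_of_set (points S)" and ?\<Sigma> = "skeleton v S V0 P" and ?\<tau> = "retraction_map v S V0 P"
  have dec: "semistable_decomposition v S V0 P" and W: "openin (top_of_set ?\<Sigma>) W" "connected W"
    and Veq: "V = {x \<in> points S. ?\<tau> x \<in> W}"
    using V by (auto simp: retraction_preimage_def simply_connected_imp_connected')
  have part: "partition_on (points S - V0) P" and fin: "finite V0" "finite {C \<in> P. is_open_annulus v S C}"
    and types: "\<And>C. C \<in> P \<Longrightarrow> is_open_disc v S C \<or> is_open_annulus v S C"
    and V0S: "V0 \<subseteq> points S"
    using dec by (auto simp: semistable_decomposition_def type2_point_def)
  have Popen: "openin ?X C" if "C \<in> P" for C
    using types[OF that] by (auto simp: is_open_disc_def is_open_annulus_def is_annulus_chart_def analytic_iso_def)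
  have disj: "C = D" if "C \<in> P" "D \<in> P" "x \<in> C" "x \<in> D" for C D x
    using part that unfolding partition_on_def disjoint_def by blast
  have PS: "C \<subseteq> points S - V0" if "C \<in> P" for C using part that by (auto simp: partition_on_def)
  have the: "(THE C. C \<in> P \<and> x \<in> C) = D" if "D \<in> P" "x \<in> D" for D x
    using that disj by (intro the_equality) blast+
  have skelA: "annulus_skeleton v S A \<subseteq> A" for A
    by (auto simp: annulus_skeleton_def split: prod.splits)
  have \<Sigma>A: "?\<Sigma> \<inter> A = annulus_skeleton v S A" if "A \<in> P" "is_open_annulus v S A" for A
    using that skelA PS disj unfolding skeleton_def by blast
  have disc: "C \<inter> ?X frontier_of V = {}" if C: "C \<in> P" "\<not> is_open_annulus v S C" for C
  proof (rule frontier_of_Int_open[OF Popen[OF C(1)]])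
    have "?\<tau> x = (THE p. p \<in> V0 \<and> p \<in> ?X frontier_of C)" if x: "x \<in> C" for x
    proof -
      have "x \<notin> ?\<Sigma>" using x C skelA PS disj unfolding skeleton_def by blast
      then show ?thesis using C(2) the[OF C(1) x] by (simp add: retraction_map_def)
    qed
    then show "C \<subseteq> V \<or> C \<inter> V = {}" using PS[OF C(1)] unfolding Veq by auto
  qed
  have annulus: "finite (A \<inter> ?X frontier_of V)" if A: "A \<in> P" "is_open_annulus v S A" for A
  proof -
    obtain \<phi> r1 r2 where c: "annulus_chart v S A = (\<phi>, r1, r2)" by (metis prod_cases3)
    have "is_annulus_chart v S A (annulus_chart v S A)"
      using A(2) unfolding annulus_chart_def is_open_annulus_def by (rule someI_ex)
    then have chart: "0 < r1" "analytic_iso S A (affine_line v) (std_annulus v r1 r2) \<phi>"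
      unfolding c by (auto simp: is_annulus_chart_def)
    have sk: "annulus_skeleton v S A = {x \<in> A. \<phi> x \<in> std_skeleton v r1 r2}" by (simp add: annulus_skeleton_def c)
    \<comment> \<open>On the skeleton the retraction is the identity by definition, and the annulus
      formula gives the identity there as well, because \<open>zeta 0 \<rho>\<close> has radius
      \<rho>.\<close>
    have \<tau>: "?\<tau> x = inv_into A \<phi> (sup_point v (\<phi> x [:0, 1:]))" if x: "x \<in> A" for x
    proof (cases "x \<in> ?\<Sigma>")
      case True
      then have "\<phi> x \<in> std_skeleton v r1 r2" using \<Sigma>A[OF A] x sk by blast
      then obtain \<rho> where \<rho>: "r1 < \<rho>" "\<phi> x = zeta 0 \<rho>" by (auto simp: std_skeleton_def sup_point_eq_zeta)
      then have "sup_point v (\<phi> x [:0, 1:]) = \<phi> x" using chart(1) by (simp add: sup_point_eq_zeta)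
      moreover have "inj_on \<phi> A" using chart(2) unfolding analytic_iso_def homeomorphism_def by (metis inj_onI)
      ultimately show ?thesis using True x by (simp add: retraction_map_def)
    next
      case False
      then show ?thesis using A the[OF A(1) x] by (simp add: retraction_map_def annulus_retraction_def c)
    qed
    have \<Sigma>S: "?\<Sigma> \<subseteq> points S" using V0S skelA PS unfolding skeleton_def by blast
    have VA: "V \<inter> A = {x \<in> A. inv_into A \<phi> (sup_point v (\<phi> x [:0, 1:])) \<in> W}"
      using \<tau> PS[OF A(1)] unfolding Veq by auto
    have "?\<Sigma> \<inter> A = {x \<in> A. \<phi> x \<in> std_skeleton v r1 r2}" using \<Sigma>A[OF A] sk by simp
    from annulus_frontier_finite[OF chart(2,1) W \<Sigma>S this VA] show ?thesis .
  qed
  have "?X frontier_of V \<subseteq> V0 \<union> (\<Union>A\<in>{C \<in> P. is_open_annulus v S C}. A \<inter> ?X frontier_of V)"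
  proof
    fix x assume x: "x \<in> ?X frontier_of V"
    then have xS: "x \<in> points S" using frontier_of_subset_topspace by fastforce
    show "x \<in> V0 \<union> (\<Union>A\<in>{C \<in> P. is_open_annulus v S C}. A \<inter> ?X frontier_of V)"
    proof (cases "x \<in> V0")
      case False
      then obtain C where "C \<in> P" "x \<in> C" using part xS by (auto simp: partition_on_def)
      then show ?thesis using disc x by blast
    qed simp
  qed
  moreover have "finite (V0 \<union> (\<Union>A\<in>{C \<in> P. is_open_annulus v S C}. A \<inter> ?X frontier_of V))"
    using fin annulus by (intro finite_UnI finite_UN_I) simp_all
  ultimately show ?thesis by (rule finite_subset)
qed

end


section \<open>Ends of discs and annuli\<close>

text \<open>Spells out that \<open>x\<close> is not a cluster point of an end of \<open>U\<close>:
  near \<open>x\<close> there is no point of \<open>U\<close> whose radius is close to the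
  end.\<close>

lemma inf_nhds_eq_bot_obtain:
  assumes "inf (nhds x) (inf (filtercomap t G) (principal U)) = bot"
  obtains O' B where "open O'" "x \<in> O'" "eventually B G" "\<And>y. y \<in> O' \<Longrightarrow> y \<in> U \<Longrightarrow> \<not> B (t y)"
proof -
  have "eventually (\<lambda>_. False) (inf (nhds x) (inf (filtercomap t G) (principal U)))" using assms by simp
  then obtain P Q where PQ: "eventually P (nhds x)" "eventually Q (inf (filtercomap t G) (principal U))"
    "\<And>y. P y \<Longrightarrow> Q y \<Longrightarrow> False" unfolding eventually_inf by blast
  obtain B where B: "eventually B G" "\<And>y. B (t y) \<Longrightarrow> y \<in> U \<Longrightarrow> Q y"
    using PQ(2) unfolding eventually_inf_principal eventually_filtercomap by blast
  obtain O' where "open O'" "x \<in> O'" "\<And>y. y \<in> O' \<Longrightarrow> P y" using PQ(1) unfolding eventually_nhds by blast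
  then show ?thesis using that PQ(3) B by blast
qed

lemma tendsto_Max_atMost:
  fixes g :: "nat \<Rightarrow> 'b \<Rightarrow> real"
  assumes "\<And>j. j \<le> n \<Longrightarrow> (g j \<longlongrightarrow> R j) F"
  shows "((\<lambda>x. Max ((\<lambda>j. g j x) ` {..n})) \<longlongrightarrow> Max (R ` {..n})) F"
  using assms
proof (induction n)
  case (Suc n)
  have "((\<lambda>x. max (g (Suc n) x) (Max ((\<lambda>j. g j x) ` {..n}))) \<longlongrightarrow> max (R (Suc n)) (Max (R ` {..n}))) F"
    using Suc by (intro tendsto_max) auto
  then show ?case by (simp add: atMost_Suc)
qed simp

context nonarch_field
begin

lemma openin_std_annulus: "openin (top_of_set (line_points v)) (std_annulus v a b)"
proof -
  have "open ({y :: 'k poly \<Rightarrow> real. a < y [:0, 1:]} \<inter> {y. y [:0, 1:] < b})"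
    by (intro open_Int open_Collect_less continuous_intros continuous_on_product_coordinates)
  moreover have "std_annulus v a b = line_points v \<inter> ({y. a < y [:0, 1:]} \<inter> {y. y [:0, 1:] < b})"
    by (auto simp: std_annulus_def)
  ultimately show ?thesis by (auto simp: openin_open)
qed

text \<open>\<open>G\<close> stands for a filter at one of the ends of the interval of radii of the annulus.\<close>

lemma end_limit:
  fixes U :: "('k mpoly \<Rightarrow> real) set"
  assumes Z: "proj_irreducible n Z" "proj_dim n Z 1"
    and iso: "analytic_iso (analytification v n Z) U (affine_line v) (std_annulus v a b) \<phi>"
    and s: "((\<lambda>x. x) \<longlongrightarrow> s) G" "0 < s"
    and G: "\<And>R. finite R \<Longrightarrow> R \<subseteq> {a<..<b} \<Longrightarrow>
      \<exists>lo hi. 0 \<le> lo \<and> a \<le> lo \<and> hi \<le> b \<and> {lo<..<hi} \<inter> R = {} \<and> eventually (\<lambda>r. lo < r \<and> r < hi) G"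
    and f: "f \<in> homog n d"
  shows "\<exists>L. ((\<lambda>x. x f) \<longlongrightarrow> L) (inf (filtercomap (\<lambda>x. \<phi> x [:0, 1:]) G) (principal U))"
    (is "\<exists>L. (_ \<longlongrightarrow> L) ?F")
proof -
  let ?S = "analytification v n Z" and ?t = "\<lambda>x. \<phi> x [:0, 1:]"
  interpret O: graded_berk_space_over v ?S "homog n" ..
  have Us: "x \<in> proj_points v n Z" if "x \<in> U" for x
  proof -
    have "openin (top_of_set (proj_points v n Z)) U" using iso by (simp add: analytic_iso_def)
    then show ?thesis using that openin_imp_subset by blast
  qed
  obtain \<psi> where hom: "homeomorphism U (std_annulus v a b) \<phi> \<psi>" using iso unfolding analytic_iso_def by blast
  have phi: "\<phi> x \<in> std_annulus v a b" if "x \<in> U" for x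
    using hom that by (auto simp: homeomorphism_def)
  have Fbot: ?thesis if "U = {}" using that by (intro exI[of _ 0]) simp
  \<comment> \<open>The forms whose zeros must be kept away from the end. Those vanishing on the
    whole curve are left out: they are 0 at every point and have a limit trivially.\<close>
  define Hs where "Hs = {h \<in> insert f ((\<lambda>j. mvar j) ` {..n}). h \<notin> hideal n Z}"
  have Hh: "\<exists>e. h \<in> homog n e" if "h \<in> Hs" for h using that f homog_mvar[of _ n] by (auto simp: Hs_def)
  \<comment> \<open>The radii of finitely many zeros. Between \<open>lo\<close> and
    \<open>hi\<close> there are none, so quotients of the forms in \<open>Hs\<close> of equal degree
    are invertible there.\<close>
  define R where "R = ?t ` {x \<in> U. \<exists>h\<in>Hs. x h = 0}"
  have "{x \<in> U. \<exists>h\<in>Hs. x h = 0} \<subseteq> (\<Union>h\<in>Hs. {x \<in> proj_points v n Z. x h = 0})" using Us by auto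
  moreover have "finite (\<Union>h\<in>Hs. {x \<in> proj_points v n Z. x h = 0})"
  proof (rule finite_UN_I)
    show "finite Hs" by (simp add: Hs_def)
    fix h assume "h \<in> Hs"
    then show "finite {x \<in> proj_points v n Z. x h = 0}" using finite_zeros[OF Z] Hh by (metis (no_types, lifting) Hs_def mem_Collect_eq)
  qed
  ultimately have "finite {x \<in> U. \<exists>h\<in>Hs. x h = 0}" by (rule finite_subset)
  then have "finite R" by (simp add: R_def)
  moreover have "R \<subseteq> {a<..<b}" using phi by (auto simp: R_def std_annulus_def)
  ultimately obtain lo hi where lh: "0 \<le> lo" "a \<le> lo" "hi \<le> b" "{lo<..<hi} \<inter> R = {}" "eventually (\<lambda>r. lo < r \<and> r < hi) G"
    using G by meson
  let ?W = "std_annulus v lo hi"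
  have W: "?W \<subseteq> std_annulus v a b" using lh by (auto simp: std_annulus_def)
  have nz: "x h \<noteq> 0" if "x \<in> U" "\<phi> x \<in> ?W" "h \<in> Hs" for x h
  proof
    assume "x h = 0"
    then have "?t x \<in> R" using that by (auto simp: R_def)
    moreover have "?t x \<in> {lo<..<hi}" using that(2) by (auto simp: std_annulus_def)
    ultimately show False using lh(4) by blast
  qed
  have evU: "eventually (\<lambda>x. x \<in> U) ?F" by (simp add: eventually_inf_principal)
  have evW: "eventually (\<lambda>x. \<phi> x \<in> ?W) ?F"
  proof -
    have "eventually (\<lambda>x. lo < ?t x \<and> ?t x < hi) (filtercomap ?t G)" using lh(5) by (rule eventually_filtercomapI)
    then show ?thesis unfolding eventually_inf_principal
      by eventually_elim (use phi in \<open>auto simp: std_annulus_def\<close>)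
  qed
  have tl: "(?t \<longlongrightarrow> s) ?F"
    by (rule tendsto_mono[OF inf_le1], rule filterlim_compose[OF s(1) filterlim_filtercomap])
  have ratio: "\<exists>L. ((\<lambda>x. x g / x h) \<longlongrightarrow> L) ?F"
    if gh: "g \<in> homog n e" "h \<in> homog n e" and nzz: "\<And>x. x \<in> U \<Longrightarrow> \<phi> x \<in> ?W \<Longrightarrow> x g \<noteq> 0 \<and> x h \<noteq> 0" for g h e
  proof -
    obtain F where F: "loc_rational ?W F" "\<And>x. x \<in> U \<Longrightarrow> \<phi> x \<in> ?W \<Longrightarrow> F (\<phi> x) = x g / x h"
      by (rule O.chart_loc_rational[OF iso openin_std_annulus W gh nzz]) blast+
    obtain C \<alpha> where C: "\<And>y. y \<in> ?W \<Longrightarrow> F y = C * y [:0, 1:] powr \<alpha>"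
      by (rule annulus_monomial[OF F(1) lh(1)]) blast
    have "((\<lambda>x. C * ?t x powr \<alpha>) \<longlongrightarrow> C * s powr \<alpha>) ?F"
      by (rule tendsto_mult[OF tendsto_const tendsto_powr[OF tl tendsto_const]]) (use s(2) in simp)
    moreover have "eventually (\<lambda>x. C * ?t x powr \<alpha> = x g / x h) ?F"
      using evU evW
    proof eventually_elim
      case (elim x)
      show ?case using F(2)[OF elim] C[OF elim(2)] by simp
    qed
    ultimately have "((\<lambda>x. x g / x h) \<longlongrightarrow> C * s powr \<alpha>) ?F" by (rule Lim_transform_eventually)
    then show ?thesis by (rule exI)
  qed
  show ?thesis
  proof (cases "U = {}")
    case False
    then obtain x1 where x1: "x1 \<in> U" by blast
    \<comment> \<open>A coordinate that is nonzero at one point does not lie in the ideal of the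
      curve, so it can serve as denominator near the end.\<close>
    obtain i where i: "i \<le> n" "x1 (mvar i) = 1" using proj_coord_eq_1[OF Us[OF x1]] by blast
    have iH: "mvar i \<in> Hs" using i proj_hideal[OF Us[OF x1], of "mvar i"] by (auto simp: Hs_def)
    have "\<exists>L. ((\<lambda>x. x (mvar j) / x (mvar i)) \<longlongrightarrow> L) ?F" if j: "j \<le> n" for j
    proof (cases "mvar j \<in> hideal n Z")
      case True
      have "eventually (\<lambda>x. 0 = x (mvar j) / x (mvar i)) ?F"
        using evU by eventually_elim (use proj_hideal[OF Us True] in simp)
      from Lim_transform_eventually[OF tendsto_const this] show ?thesis by (rule exI)
    next
      case False
      then have "mvar j \<in> Hs" using j by (auto simp: Hs_def)
      then show ?thesis using nz iH homog_mvar[OF j] homog_mvar[OF i(1)] by (intro ratio) blast+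
    qed
    then have "\<forall>j. \<exists>L. j \<le> n \<longrightarrow> ((\<lambda>x. x (mvar j) / x (mvar i)) \<longlongrightarrow> L) ?F" by simp
    from choice[OF this] obtain Rr
      where "\<forall>j. j \<le> n \<longrightarrow> ((\<lambda>x. x (mvar j) / x (mvar i)) \<longlongrightarrow> Rr j) ?F" by (elim exE)
    then have Rr: "((\<lambda>x. x (mvar j) / x (mvar i)) \<longlongrightarrow> Rr j) ?F" if "j \<le> n" for j using that by simp
    let ?M = "Max (Rr ` {..n})"
    have lim: "((\<lambda>x. Max ((\<lambda>j. x (mvar j) / x (mvar i)) ` {..n})) \<longlongrightarrow> ?M) ?F"
      using Rr by (rule tendsto_Max_atMost)
    have Mx: "Max ((\<lambda>j. x (mvar j) / x (mvar i)) ` {..n}) = 1 / x (mvar i)" if x: "x \<in> U" for x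
    proof (rule Max_eqI)
      have xi: "0 \<le> x (mvar i)" using proj.point_nonneg[of x n Z] Us[OF x] by simp
      show "y \<le> 1 / x (mvar i)" if "y \<in> (\<lambda>j. x (mvar j) / x (mvar i)) ` {..n}" for y
        using that proj_coord_le[OF Us[OF x]] xi by (auto intro!: divide_right_mono)
      show "1 / x (mvar i) \<in> (\<lambda>j. x (mvar j) / x (mvar i)) ` {..n}"
        using proj_coord_eq_1[OF Us[OF x]] by force
    qed simp
    have "eventually (\<lambda>x. Max ((\<lambda>j. x (mvar j) / x (mvar i)) ` {..n}) = 1 / x (mvar i)) ?F"
      using evU by eventually_elim (rule Mx)
    then have lim': "((\<lambda>x. 1 / x (mvar i)) \<longlongrightarrow> ?M) ?F" by (rule Lim_transform_eventually[OF lim])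
    show ?thesis
    proof (cases "?F = bot")
      case True then show ?thesis by simp
    next
      case nbot: False
      have "eventually (\<lambda>x. 1 \<le> 1 / x (mvar i)) ?F"
        using evU evW
      proof eventually_elim
        case (elim x)
        have "0 < x (mvar i)" using nz[OF elim iH] proj.point_nonneg[of x n Z "mvar i"] Us[OF elim(1)] by (simp add: less_le)
        then show ?case using proj_coord_le[OF Us[OF elim(1)] i(1)] by (simp add: le_divide_eq)
      qed
      \<comment> \<open>Coordinates are at most 1, so their reciprocals stay away from 0 and can be
        inverted in the limit.\<close>
      then have "1 \<le> ?M" by (rule tendsto_lowerbound[OF lim' _ nbot])
      then have "((\<lambda>x. inverse (1 / x (mvar i))) \<longlongrightarrow> inverse ?M) ?F"
        using lim' by (intro tendsto_inverse) auto
      then have ilim: "((\<lambda>x. x (mvar i)) \<longlongrightarrow> inverse ?M) ?F" by simp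
      show ?thesis
      proof (cases "f \<in> hideal n Z")
        case True
        have "eventually (\<lambda>x. 0 = x f) ?F"
          using evU by eventually_elim (use proj_hideal[OF Us True] in simp)
        from Lim_transform_eventually[OF tendsto_const this] show ?thesis by (rule exI)
      next
        case False
        then have fH: "f \<in> Hs" by (auto simp: Hs_def)
        have T: "(mvar i :: 'k mpoly) ^ k \<in> homog n k" for k using homog_power[OF homog_mvar[OF i(1)], of k] by simp
        have Tx: "x (mvar i ^ k) = x (mvar i) ^ k" if "x \<in> U" for x k
        proof (induction k)
          case 0 show ?case using proj.point_1[of x n Z] Us[OF that] by simp
        next
          case (Suc k)
          then show ?case using proj.point_mult[OF _ homog_mvar[OF i(1)] T, of x Z k] Us[OF that] by simp
        qed
        have "x f \<noteq> 0 \<and> x (mvar i ^ d) \<noteq> 0" if x: "x \<in> U" "\<phi> x \<in> ?W" for x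
          using nz[OF x fH] nz[OF x iH] Tx[OF x(1), of d] by simp
        then have "\<exists>L. ((\<lambda>x. x f / x (mvar i ^ d)) \<longlongrightarrow> L) ?F" by (rule ratio[OF f T])
        then obtain L where L: "((\<lambda>x. x f / x (mvar i ^ d)) \<longlongrightarrow> L) ?F" by (elim exE)
        have "((\<lambda>x. (x f / x (mvar i ^ d)) * x (mvar i) ^ d) \<longlongrightarrow> L * inverse ?M ^ d) ?F"
          by (rule tendsto_mult[OF L tendsto_power[OF ilim]])
        moreover have "eventually (\<lambda>x. (x f / x (mvar i ^ d)) * x (mvar i) ^ d = x f) ?F"
          using evU evW
        proof eventually_elim
          case (elim x)
          show ?case using Tx[OF elim(1), of d] nz[OF elim iH] by simp
        qed
        ultimately have "((\<lambda>x. x f) \<longlongrightarrow> L * inverse ?M ^ d) ?F" by (rule Lim_transform_eventually)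
        then show ?thesis by (rule exI)
      qed
    qed
  qed (rule Fbot)
qed

lemma tendsto_eval: "((\<lambda>x :: 'b \<Rightarrow> real. x f) \<longlongrightarrow> x0 f) (nhds x0)"
proof (rule topological_tendstoI)
  fix S :: "real set" assume S: "open S" "x0 f \<in> S"
  have "open ((\<lambda>x :: 'b \<Rightarrow> real. x f) -` S)" by (rule open_vimage[OF S(1) continuous_on_product_coordinates])
  then show "\<forall>\<^sub>F x in nhds x0. x f \<in> S" unfolding eventually_nhds using S(2) by blast
qed

text \<open>The topology is that of pointwise convergence, so a cluster point takes the limit along
  \<open>F\<close> as its value on each form. On all other polynomials it is 0.\<close>

lemma end_points_unique:
  assumes lim: "\<And>f d. f \<in> homog n d \<Longrightarrow> \<exists>L. ((\<lambda>x. x f) \<longlongrightarrow> L) F"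
    and x: "x \<in> proj_points v n Z" "inf (nhds x) F \<noteq> bot" and y: "y \<in> proj_points v n Z" "inf (nhds y) F \<noteq> bot"
  shows "x = y"
proof
  fix f :: "'k mpoly"
  show "x f = y f"
  proof (cases "f \<in> (\<Union>d. homog n d)")
    case True
    then obtain L where L: "((\<lambda>x. x f) \<longlongrightarrow> L) F" using lim by blast
    have *: "z f = L" if "inf (nhds z) F \<noteq> bot" for z
      by (rule tendsto_unique[OF that tendsto_mono[OF inf_le1 tendsto_eval] tendsto_mono[OF inf_le2 L]])
    show ?thesis using *[OF x(2)] *[OF y(2)] by simp
  next
    case False
    then show ?thesis using proj_not_homog[OF x(1)] proj_not_homog[OF y(1)] by simp
  qed
qed

lemma end_at_left:
  assumes "a < b" "0 < b" "finite R" "R \<subseteq> {a<..<b}"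
  shows "\<exists>lo hi. 0 \<le> lo \<and> a \<le> lo \<and> hi \<le> b \<and> {lo<..<hi} \<inter> R = {} \<and> eventually (\<lambda>r. lo < r \<and> r < hi) (at_left (b::real))"
proof -
  \<comment> \<open>The \<open>0\<close> matters for discs, where \<open>a\<close> is
    negative.\<close>
  define lo where "lo = Max (insert (max a 0) R)"
  have "lo \<in> insert (max a 0) R" unfolding lo_def by (rule Max_in) (use assms in auto)
  then have "lo < b" using assms by auto
  have le: "r \<le> lo" if "r \<in> insert (max a 0) R" for r
    unfolding lo_def by (rule Max_ge) (use assms that in auto)
  moreover have "a \<le> lo" "0 \<le> lo" using le[of "max a 0"] by auto
  moreover have "{lo<..<b} \<inter> R = {}" using le by force
  moreover have "eventually (\<lambda>r. lo < r \<and> r < b) (at_left b)"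
    unfolding eventually_at_left[OF \<open>lo < b\<close>] using \<open>lo < b\<close> by (intro exI[of _ lo]) simp
  ultimately show ?thesis by (intro exI[of _ lo] exI[of _ b] conjI) simp_all
qed

lemma end_at_right:
  assumes "a < b" "0 < a" "finite R" "R \<subseteq> {a<..<b}"
  shows "\<exists>lo hi. 0 \<le> lo \<and> a \<le> lo \<and> hi \<le> b \<and> {lo<..<hi} \<inter> R = {} \<and> eventually (\<lambda>r. lo < r \<and> r < hi) (at_right (a::real))"
proof -
  define hi where "hi = Min (insert b R)"
  have "hi \<in> insert b R" unfolding hi_def by (rule Min_in) (use assms in auto)
  then have "a < hi" using assms by auto
  have le: "hi \<le> r" if "r \<in> insert b R" for r
    unfolding hi_def by (rule Min_le) (use assms that in auto)
  then have "{a<..<hi} \<inter> R = {}" by force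
  moreover have "eventually (\<lambda>r. a < r \<and> r < hi) (at_right a)"
    unfolding eventually_at_right[OF \<open>a < hi\<close>] using \<open>a < hi\<close> by (intro exI[of _ hi]) simp
  ultimately show ?thesis using le[of b] assms(2) by (intro exI[of _ a] exI[of _ hi] conjI) simp_all
qed

text \<open>If a boundary point were a cluster point of no end, some neighbourhood of it would meet
  \<open>U\<close> only in the image of a closed annulus. That image is compact, hence closed, and
  lies in \<open>U\<close>, which the boundary point does not. A negative \<open>a\<close> describes
  a disc, whose only end is the outer one.\<close>

lemma chart_frontier_finite:
  assumes Z: "proj_irreducible n Z" "proj_dim n Z 1"
    and iso: "analytic_iso (analytification v n Z) U (affine_line v) (std_annulus v a b) \<phi>"
    and ab: "a < b" "0 < b" "a < 0 \<or> 0 < a"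
  shows "finite (top_of_set (proj_points v n Z) frontier_of U)"
proof -
  let ?E = "top_of_set (proj_points v n Z)" and ?t = "\<lambda>x. \<phi> x [:0, 1:]"
  let ?F = "\<lambda>G. inf (filtercomap ?t G) (principal U)"
  let ?C = "\<lambda>G. {x \<in> proj_points v n Z. inf (nhds x) (?F G) \<noteq> bot}"
  have U: "openin ?E U" using iso by (simp add: analytic_iso_def)
  obtain \<psi> where hom: "homeomorphism U (std_annulus v a b) \<phi> \<psi>" using iso unfolding analytic_iso_def by blast
  have tU: "0 \<le> ?t x" "a < ?t x" "?t x < b" "\<phi> x \<in> line_points v" if "x \<in> U" for x
  proof -
    have "\<phi> x \<in> std_annulus v a b" using hom that by (auto simp: homeomorphism_def)
    then show "0 \<le> ?t x" "a < ?t x" "?t x < b" "\<phi> x \<in> line_points v" using line_nonneg by (auto simp: std_annulus_def)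
  qed
  have fin: "finite (?C G)" if "\<And>f d. f \<in> homog n d \<Longrightarrow> \<exists>L. ((\<lambda>x. x f) \<longlongrightarrow> L) (?F G)" for G
  proof -
    have "x = y" if "x \<in> ?C G" "y \<in> ?C G" for x y
      using that by (intro end_points_unique[of n "?F G" x Z y] \<open>\<And>f d. f \<in> homog n d \<Longrightarrow> _ f\<close>) auto
    then have "?C G \<subseteq> {SOME x. x \<in> ?C G}" using someI[of "\<lambda>x. x \<in> ?C G"] by blast
    then show ?thesis using finite_subset by blast
  qed
  have left: "finite (?C (at_left b))"
    by (rule fin, rule end_limit[OF Z iso tendsto_ident_at ab(2)]) (rule end_at_left[OF ab(1,2)])
  have right: "finite (?C (at_right a))" if "0 < a"
    by (rule fin, rule end_limit[OF Z iso tendsto_ident_at that]) (rule end_at_right[OF ab(1) that])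
  have "?E frontier_of U \<subseteq> ?C (at_left b) \<union> (if 0 < a then ?C (at_right a) else {})"
  proof
    fix x assume x: "x \<in> ?E frontier_of U"
    then have xp: "x \<in> proj_points v n Z" using frontier_of_subset_topspace by fastforce
    have xU: "x \<notin> U" using frontier_of_Int_open[OF U] x by blast
    show "x \<in> ?C (at_left b) \<union> (if 0 < a then ?C (at_right a) else {})"
    proof (rule ccontr)
      assume neg: "\<not> ?thesis"
      then have "inf (nhds x) (?F (at_left b)) = bot" using xp by auto
      then obtain O1 B1 where O1: "open O1" "x \<in> O1" "eventually B1 (at_left b)" "\<And>y. y \<in> O1 \<Longrightarrow> y \<in> U \<Longrightarrow> \<not> B1 (?t y)"
        by (rule inf_nhds_eq_bot_obtain) blast
      obtain r2 where r2: "r2 < b" "\<And>r. r2 < r \<Longrightarrow> r < b \<Longrightarrow> B1 r" using O1(3) eventually_at_left[OF ab(1)] by blast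
      have "\<exists>O2 r1. open O2 \<and> x \<in> O2 \<and> a < r1 \<and> (\<forall>y\<in>O2. y \<in> U \<longrightarrow> r1 \<le> ?t y)"
      proof (cases "0 < a")
        case True
        then have "inf (nhds x) (?F (at_right a)) = bot" using xp neg by auto
        then obtain O2 B2 where O2: "open O2" "x \<in> O2" "eventually B2 (at_right a)" "\<And>y. y \<in> O2 \<Longrightarrow> y \<in> U \<Longrightarrow> \<not> B2 (?t y)"
          by (rule inf_nhds_eq_bot_obtain) blast
        obtain r1 where "r1 > a" "\<And>r. a < r \<Longrightarrow> r < r1 \<Longrightarrow> B2 r" using O2(3) eventually_at_right[OF ab(1)] by blast
        then show ?thesis using O2 tU by (intro exI[of _ O2] exI[of _ r1]) (meson not_le)
      next
        case False
        \<comment> \<open>For a disc the radii are bounded below by 0, which exceeds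
          \<open>a\<close>, so no condition near \<open>x\<close> is required.\<close>
        then show ?thesis using ab(3) tU by (intro exI[of _ UNIV] exI[of _ 0]) auto
      qed
      then obtain O2 r1 where O2: "open O2" "x \<in> O2" "a < r1" "\<And>y. y \<in> O2 \<Longrightarrow> y \<in> U \<Longrightarrow> r1 \<le> ?t y" by blast
      let ?K = "closed_annulus r1 r2"
      have "?K \<subseteq> std_annulus v a b" using O2(3) r2(1) by (auto simp: closed_annulus_def std_annulus_def)
      then have "compact (\<psi> ` ?K)" and KU: "\<psi> ` ?K \<subseteq> U"
        using hom by (auto simp: homeomorphism_def intro!: compact_continuous_image compact_closed_annulus elim: continuous_on_subset)
      then have cl: "closed (\<psi> ` ?K)" by (intro compact_imp_closed_fun)
      have "x \<notin> \<psi> ` ?K" using KU xU by blast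
      then have "openin ?E (proj_points v n Z \<inter> (O1 \<inter> O2 \<inter> - \<psi> ` ?K))" "x \<in> proj_points v n Z \<inter> (O1 \<inter> O2 \<inter> - \<psi> ` ?K)"
        using O1 O2 cl xp by (auto intro!: openin_open_Int open_Int)
      then obtain y where y: "y \<in> O1" "y \<in> O2" "y \<notin> \<psi> ` ?K" "y \<in> U" using open_nbhd_meets_frontier(1)[OF _ _ x] by blast
      have "r1 \<le> ?t y" using O2 y by blast
      moreover have "?t y \<le> r2" using O1(4)[OF y(1,4)] r2(2) tU(3)[OF y(4)] by (meson not_le)
      ultimately have "\<phi> y \<in> ?K" using tU(4)[OF y(4)] by (simp add: closed_annulus_def)
      moreover have "\<psi> (\<phi> y) = y" using hom y(4) by (auto simp: homeomorphism_def)
      ultimately show False using y(3) by (metis imageI)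
    qed
  qed
  moreover have "finite (?C (at_left b) \<union> (if 0 < a then ?C (at_right a) else {}))" using left right by simp
  ultimately show ?thesis by (rule finite_subset)
qed

text \<open>A negative inner radius imposes no condition, so discs can be treated as annuli with a
  single end.\<close>

lemma std_disc_eq_annulus: "std_disc v r = std_annulus v (- 1) r"
proof -
  have "- 1 < x [:0, 1:]" if "x \<in> line_points v" for x using line_nonneg[OF that, of "[:0, 1:]"] by linarith
  then show ?thesis by (auto simp: std_disc_def std_annulus_def)
qed

end

theorem corollary5p5:
  fixes v :: "'k::alg_closed_field \<Rightarrow> real"
    and n :: nat
    and C :: "(nat \<Rightarrow> 'k) set"
    and V :: "('k mpoly \<Rightarrow> real) set"
  assumes "nonarch_abs v" and "nontrivial_abs v" and "complete_abs v"
    and "smooth_projective_curve n C"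
    and "strictly_simple_open v (analytification v n C) V"
  shows "finite (top_of_set (points (analytification v n C)) frontier_of V)"
proof -
  interpret nonarch_field v by (rule nonarch_field.intro) (use assms in auto)
  have C: "proj_irreducible n C" "proj_dim n C 1" using assms(4) by (auto simp: smooth_projective_curve_def)
  consider "is_open_disc v (analytification v n C) V" | "is_open_annulus v (analytification v n C) V"
    | V0 P W where "retraction_preimage v (analytification v n C) V0 P W V"
    using assms(5) unfolding strictly_simple_open_def by blast
  then show ?thesis
  proof cases
    case 1
    then obtain r \<phi> where "0 < r" "analytic_iso (analytification v n C) V (affine_line v) (std_annulus v (- 1) r) \<phi>"
      by (auto simp: is_open_disc_def std_disc_eq_annulus)
    then show ?thesis using chart_frontier_finite[OF C, of V "- 1" r] by simp
  next
    case 2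
    then obtain \<phi> r1 r2 where "0 < r1" "r1 < r2" "analytic_iso (analytification v n C) V (affine_line v) (std_annulus v r1 r2) \<phi>"
      by (auto simp: is_open_annulus_def is_annulus_chart_def)
    then show ?thesis using chart_frontier_finite[OF C, of V r1 r2] by simp
  next
    case 3
    then show ?thesis by (rule retraction_preimage_frontier_finite)
  qed
qed

end
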